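(* Let $R$ be a right semihereditary ring. Let $\mathcal G$ be a perfect Gabriel topology on $R$, and let $(\mathcal T,\mathcal F)$ be the hereditary torsion pair associated to $\mathcal G$. Then the ring epimorphism $\lambda_{\mathcal G}:R\to Q_{\mathcal G}$ is equivalent to the universal localization $\lambda_{\mathcal U}:R\to R_{\mathcal U}$ at the set $\mathcal U$ of all finitely presented modules from $\mathcal T$.
   Context: A ring is right semihereditary if every finitely generated right ideal is projective (then all finitely presented right modules have projective dimension at most one). $\operatorname{Mod}R$ is the category of right $R$-modules. "The set of all finitely presented modules from $\mathcal T$" is understood up to isomorphism (a representative set). Two ring epimorphisms $\lambda:R\to S$, $\lambda':R\to S'$ are equivalent if there is a ring isomorphism $\varphi:S\to S'$ with $\lambda'=\varphi\lambda$. A Gabriel topology on $R$ is a non-empty set $\mathcal G$ of right ideals such that: (a) $I\in\mathcal G$, $I\subseteq K$ imply $K\in\mathcal G$; (b) $I,K\in\mathcal G$ imply $I\cap K\in\mathcal G$; (c) $I\in\mathcal G$, $x\in R$ imply $(I:x)=\{r\in R\mid xr\in I\}\in\mathcal G$; (d) if $K$ is a right ideal and there is $I\in\mathcal G$ with $(K:x)\in\mathcal G$ for all $x\in I$, then $K\in\mathcal G$. A torsion pair $(\mathcal T,\mathcal F)$ in $\operatorname{Mod}R$ (i.e. $\mathcal T=\{M\mid\operatorname{Hom}_R(M,F)=0\ \forall F\in\mathcal F\}$ and $\mathcal F=\{M\mid\operatorname{Hom}_R(X,M)=0\ \forall X\in\mathcal T\}$) is hereditary if $\mathcal T$ is closed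 under submodules. The hereditary torsion pair associated to $\mathcal G$ has torsion class $\mathcal T=\{X\mid\operatorname{ann}_R(x)\in\mathcal G\ \forall x\in X\}$, and $\mathcal G=\{I\mid R/I\in\mathcal T\}$. A right module $C$ is $\mathcal G$-closed if $\operatorname{Hom}_R(R,C)\to\operatorname{Hom}_R(I,C)$ is bijective for all $I\in\mathcal G$. The inclusion of the category $\mathcal X(\mathcal G)$ of $\mathcal G$-closed modules into $\operatorname{Mod}R$ has an exact left adjoint; $Q_{\mathcal G}$ is the image of $R$ under it, and the unit $\lambda_{\mathcal G}:R\to Q_{\mathcal G}$ induces a ring structure on $Q_{\mathcal G}$ for which $\lambda_{\mathcal G}$ is a ring homomorphism. $\mathcal G$ is perfect if the following equivalent conditions hold: $\mathcal X(\mathcal G)$ is the essential image of the restriction functor $\operatorname{Mod}Q_{\mathcal G}\to\operatorname{Mod}R$ along $\lambda_{\mathcal G}$; the inclusion $\mathcal X(\mathcal G)\to\operatorname{Mod}R$ has a right adjoint; $IQ_{\mathcal G}=Q_{\mathcal G}$ for all $I\in\mathcal G$. In this case $\lambda_{\mathcal G}$ is a ring epimorphism. For a set $\mathcal U$ of finitely presented right $R$-modules of projective dimension at most one, choose exact sequences $0\to P\xrightarrow{\alpha_U}Q\to U\to0$ ($U\in\mathcal U$) with $P,Q$ finitely generated projective. The universal localization $\lambda_{\mathcal U}:R\to R_{\mathcal U}$ is the ring homomorphism such that all $\alpha_U\otimes_RR_{\mathcal U}$ are isomorphisms and which is universal among ring homomorphisms out of $R$ with this property; it does not depend on the chosen $\alpha_U$.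 *)

theory Defs
  imports "HOL-Algebra.Free_Abelian_Groups" "HOL-Algebra.QuotRing" "HOL-Algebra.Module"
begin

text \<open>
  Rings are unital, not necessarily commutative and possibly zero (locale \<^locale>\<open>ring\<close>).
  The library's locale \<^locale>\<open>module\<close> requires a commutative ring, so right modules are
  set up here. As in the library's record of modules, the multiplication and the unit that
  the record inherits from rings carry no meaning for a module.

  HOL cannot quantify over types inside a formula, so the category \<open>Mod R\<close> is represented by
  the right modules whose elements come from one ambient type, written \<open>'u\<close> below. Notions
  whose definition ranges over test objects take that type as an argument (through the type
  \<^typ>\<open>'u itself\<close> or the type of another argument). It is enough that \<open>'u\<close>
  admits an injection from \<open>'a list set\<close>, where \<open>'a\<close> is the type of the elements of \<open>R\<close>: elements of
  finitely generated modules are represented by tuples over \<open>R\<close>, and elements of the ring of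
  quotients by homomorphisms from right ideals to a quotient of \<open>R\<close>, hence by sets of pairs over
  \<open>R\<close>. So \<open>'u\<close> then contains copies of all objects that are needed (finitely generated modules,
  the ring of quotients, the universal localization), and for these the restriction to \<open>'u\<close>
  makes no difference.
\<close>

subsection \<open>Right modules\<close>

record ('a, 'm) rmod = "'m ring" +
  ract :: "'m \<Rightarrow> 'a \<Rightarrow> 'm"  (infixl "\<star>\<index>" 70)

locale right_module = R?: ring R + M?: abelian_group M
  for R (structure) and M :: "('a, 'm) rmod" (structure) +
  assumes ract_closed:
      "\<lbrakk>x \<in> carrier M; r \<in> carrier R\<rbrakk> \<Longrightarrow> x \<star>\<^bsub>M\<^esub> r \<in> carrier M"
    and ract_add_left:
      "\<lbrakk>x \<in> carrier M; y \<in> carrier M; r \<in> carrier R\<rbrakk>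
        \<Longrightarrow> (x \<oplus>\<^bsub>M\<^esub> y) \<star>\<^bsub>M\<^esub> r = x \<star>\<^bsub>M\<^esub> r \<oplus>\<^bsub>M\<^esub> y \<star>\<^bsub>M\<^esub> r"
    and ract_add_right:
      "\<lbrakk>x \<in> carrier M; r \<in> carrier R; s \<in> carrier R\<rbrakk>
        \<Longrightarrow> x \<star>\<^bsub>M\<^esub> (r \<oplus>\<^bsub>R\<^esub> s) = x \<star>\<^bsub>M\<^esub> r \<oplus>\<^bsub>M\<^esub> x \<star>\<^bsub>M\<^esub> s"
    and ract_assoc:
      "\<lbrakk>x \<in> carrier M; r \<in> carrier R; s \<in> carrier R\<rbrakk>
        \<Longrightarrow> x \<star>\<^bsub>M\<^esub> (r \<otimes>\<^bsub>R\<^esub> s) = (x \<star>\<^bsub>M\<^esub> r) \<star>\<^bsub>M\<^esub> s"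
    and ract_one:
      "x \<in> carrier M \<Longrightarrow> x \<star>\<^bsub>M\<^esub> \<one>\<^bsub>R\<^esub> = x"

definition right_submodule :: "('a, 'r) ring_scheme \<Rightarrow> ('a, 'm) rmod \<Rightarrow> 'm set \<Rightarrow> bool" where
  "right_submodule R M N \<longleftrightarrow>
     additive_subgroup N M \<and> (\<forall>x\<in>N. \<forall>r\<in>carrier R. x \<star>\<^bsub>M\<^esub> r \<in> N)"

definition submod :: "('a, 'm) rmod \<Rightarrow> 'm set \<Rightarrow> ('a, 'm) rmod" where
  "submod M N = M\<lparr>carrier := N\<rparr>"

text \<open>Homomorphisms are extensional outside the carrier, so that equality of homomorphisms
  is equality of functions.\<close>

definition Hom :: "('a, 'r) ring_scheme \<Rightarrow> ('a, 'm) rmod \<Rightarrow> ('a, 'n) rmod \<Rightarrow> ('m \<Rightarrow> 'n) set" where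
  "Hom R M N = {f \<in> carrier M \<rightarrow>\<^sub>E carrier N.
     (\<forall>x\<in>carrier M. \<forall>y\<in>carrier M. f (x \<oplus>\<^bsub>M\<^esub> y) = f x \<oplus>\<^bsub>N\<^esub> f y) \<and>
     (\<forall>x\<in>carrier M. \<forall>r\<in>carrier R. f (x \<star>\<^bsub>M\<^esub> r) = f x \<star>\<^bsub>N\<^esub> r)}"

definition hom_kernel :: "('a, 'm) rmod \<Rightarrow> ('a, 'n) rmod \<Rightarrow> ('m \<Rightarrow> 'n) \<Rightarrow> 'm set" where
  "hom_kernel M N f = {x \<in> carrier M. f x = \<zero>\<^bsub>N\<^esub>}"

definition rmod_isomorphic :: "('a, 'r) ring_scheme \<Rightarrow> ('a, 'm) rmod \<Rightarrow> ('a, 'n) rmod \<Rightarrow> bool" where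
  "rmod_isomorphic R M N \<longleftrightarrow> (\<exists>f\<in>Hom R M N. bij_betw f (carrier M) (carrier N))"

definition regular :: "('a, 'r) ring_scheme \<Rightarrow> ('a, 'a) rmod" where
  "regular R = \<lparr>carrier = carrier R, monoid.mult = undefined, one = undefined,
     zero = \<zero>\<^bsub>R\<^esub>, add = add R, ract = mult R\<rparr>"

text \<open>A ring \<open>S\<close> regarded as a right \<open>R\<close>-module along \<open>\<sigma> : R \<rightarrow> S\<close>.\<close>

definition restrict_scalars ::
    "('s, 'k) ring_scheme \<Rightarrow> ('a \<Rightarrow> 's) \<Rightarrow> ('a, 's) rmod" where
  "restrict_scalars S \<sigma> = \<lparr>carrier = carrier S, monoid.mult = undefined, one = undefined,
     zero = \<zero>\<^bsub>S\<^esub>, add = add S, ract = (\<lambda>x r. x \<otimes>\<^bsub>S\<^esub> \<sigma> r)\<rparr>"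

definition free_rmod :: "('a, 'r) ring_scheme \<Rightarrow> nat \<Rightarrow> ('a, nat \<Rightarrow> 'a) rmod" where
  "free_rmod R n = \<lparr>carrier = {..<n} \<rightarrow>\<^sub>E carrier R, monoid.mult = undefined, one = undefined,
     zero = (\<lambda>i\<in>{..<n}. \<zero>\<^bsub>R\<^esub>), add = (\<lambda>v w. \<lambda>i\<in>{..<n}. v i \<oplus>\<^bsub>R\<^esub> w i),
     ract = (\<lambda>v r. \<lambda>i\<in>{..<n}. v i \<otimes>\<^bsub>R\<^esub> r)\<rparr>"

subsection \<open>Finiteness conditions, projective modules, right semihereditary rings\<close>

definition finitely_generated :: "('a, 'r) ring_scheme \<Rightarrow> ('a, 'm) rmod \<Rightarrow> bool" where
  "finitely_generated R M \<longleftrightarrow>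
     (\<exists>X. finite X \<and> X \<subseteq> carrier M \<and> (\<forall>N. right_submodule R M N \<and> X \<subseteq> N \<longrightarrow> N = carrier M))"

definition finitely_presented :: "('a, 'r) ring_scheme \<Rightarrow> ('a, 'm) rmod \<Rightarrow> bool" where
  "finitely_presented R M \<longleftrightarrow> right_module R M \<and>
     (\<exists>n. \<exists>p\<in>Hom R (free_rmod R n) M.
        p ` carrier (free_rmod R n) = carrier M \<and>
        finitely_generated R (submod (free_rmod R n) (hom_kernel (free_rmod R n) M p)))"

definition projective ::
    "'u itself \<Rightarrow> ('a, 'r) ring_scheme \<Rightarrow> ('a, 'm) rmod \<Rightarrow> bool" where
  "projective u R P \<longleftrightarrow> right_module R P \<and>
     (\<forall>(M :: ('a, 'u) rmod) (N :: ('a, 'u) rmod) g f.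
        right_module R M \<and> right_module R N \<and>
        g \<in> Hom R M N \<and> g ` carrier M = carrier N \<and> f \<in> Hom R P N \<longrightarrow>
        (\<exists>h\<in>Hom R P M. \<forall>x\<in>carrier P. g (h x) = f x))"

definition right_ideal :: "('a, 'r) ring_scheme \<Rightarrow> 'a set \<Rightarrow> bool" where
  "right_ideal R I \<longleftrightarrow> right_submodule R (regular R) I"

definition ideal_mod :: "('a, 'r) ring_scheme \<Rightarrow> 'a set \<Rightarrow> ('a, 'a) rmod" where
  "ideal_mod R I = submod (regular R) I"

definition right_semihereditary :: "'u itself \<Rightarrow> ('a, 'r) ring_scheme \<Rightarrow> bool" where
  "right_semihereditary u R \<longleftrightarrow> ring R \<and>
     (\<forall>I. right_ideal R I \<and> finitely_generated R (ideal_mod R I) \<longrightarrow>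
        projective u R (ideal_mod R I))"

subsection \<open>Gabriel topologies and hereditary torsion pairs\<close>

definition gabriel_topology :: "('a, 'r) ring_scheme \<Rightarrow> 'a set set \<Rightarrow> bool" where
  "gabriel_topology R \<G> \<longleftrightarrow> \<G> \<noteq> {} \<and> (\<forall>I\<in>\<G>. right_ideal R I) \<and>
     (\<forall>I K. I \<in> \<G> \<and> right_ideal R K \<and> I \<subseteq> K \<longrightarrow> K \<in> \<G>) \<and>
     (\<forall>I K. I \<in> \<G> \<and> K \<in> \<G> \<longrightarrow> I \<inter> K \<in> \<G>) \<and>
     (\<forall>I x. I \<in> \<G> \<and> x \<in> carrier R \<longrightarrow> {r \<in> carrier R. x \<otimes>\<^bsub>R\<^esub> r \<in> I} \<in> \<G>) \<and>
     (\<forall>K. right_ideal R K \<and>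
        (\<exists>I\<in>\<G>. \<forall>x\<in>I. {r \<in> carrier R. x \<otimes>\<^bsub>R\<^esub> r \<in> K} \<in> \<G>) \<longrightarrow> K \<in> \<G>)"

definition annihilator :: "('a, 'r) ring_scheme \<Rightarrow> ('a, 'm) rmod \<Rightarrow> 'm \<Rightarrow> 'a set" where
  "annihilator R M x = {r \<in> carrier R. x \<star>\<^bsub>M\<^esub> r = \<zero>\<^bsub>M\<^esub>}"

definition hereditary_torsion_pair ::
    "('a, 'r) ring_scheme \<Rightarrow> ('a, 'u) rmod set \<Rightarrow> ('a, 'u) rmod set \<Rightarrow> bool" where
  "hereditary_torsion_pair R \<T> \<F> \<longleftrightarrow>
     \<T> = {M. right_module R M \<and> (\<forall>F\<in>\<F>. Hom R M F = {\<lambda>x\<in>carrier M. \<zero>\<^bsub>F\<^esub>})} \<and>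
     \<F> = {M. right_module R M \<and> (\<forall>X\<in>\<T>. Hom R X M = {\<lambda>x\<in>carrier X. \<zero>\<^bsub>M\<^esub>})} \<and>
     (\<forall>M\<in>\<T>. \<forall>N. right_submodule R M N \<longrightarrow> submod M N \<in> \<T>)"

definition gabriel_torsion_class ::
    "('a, 'r) ring_scheme \<Rightarrow> 'a set set \<Rightarrow> ('a, 'u) rmod set" where
  "gabriel_torsion_class R \<G> =
     {X. right_module R X \<and> (\<forall>x\<in>carrier X. annihilator R X x \<in> \<G>)}"

subsection \<open>The ring of quotients of a Gabriel topology\<close>

definition gabriel_closed ::
    "('a, 'r) ring_scheme \<Rightarrow> 'a set set \<Rightarrow> ('a, 'm) rmod \<Rightarrow> bool" where
  "gabriel_closed R \<G> C \<longleftrightarrow> right_module R C \<and>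
     (\<forall>I\<in>\<G>. bij_betw (\<lambda>f. restrict f I) (Hom R (regular R) C) (Hom R (ideal_mod R I) C))"

text \<open>\<open>\<eta> : M \<rightarrow> N\<close> is the value at \<open>M\<close> of the unit of the left adjoint of the inclusion of the
  closed modules over the type \<open>'u\<close> into \<open>Mod R\<close>, i.e. a universal arrow from \<open>M\<close> to that
  inclusion.\<close>

definition closed_reflection ::
    "('a, 'r) ring_scheme \<Rightarrow> 'a set set \<Rightarrow> ('a, 'm) rmod \<Rightarrow> ('a, 'u) rmod \<Rightarrow> ('m \<Rightarrow> 'u) \<Rightarrow> bool" where
  "closed_reflection R \<G> M N \<eta> \<longleftrightarrow>
     gabriel_closed R \<G> N \<and> \<eta> \<in> Hom R M N \<and>
     (\<forall>C :: ('a, 'u) rmod. gabriel_closed R \<G> C \<longrightarrow>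
        (\<forall>f\<in>Hom R M C. \<exists>!g. g \<in> Hom R N C \<and> compose (carrier M) g \<eta> = f))"

text \<open>The right \<open>R\<close>-module underlying the ring structure of \<open>Q\<close>, along \<open>\<lambda>\<close>, is the reflection of
  \<open>R\<close>. This determines the ring structure: the unit is the image of \<open>1\<close>, and left multiplication
  by \<open>q\<close> is the unique \<open>R\<close>-endomorphism of \<open>Q\<close> that sends \<open>1\<close> to \<open>q\<close>.\<close>

definition ring_of_quotients ::
    "('a, 'r) ring_scheme \<Rightarrow> 'a set set \<Rightarrow> 'u ring \<Rightarrow> ('a \<Rightarrow> 'u) \<Rightarrow> bool" where
  "ring_of_quotients R \<G> Q lam \<longleftrightarrow> ring Q \<and> lam \<in> ring_hom R Q \<and>
     closed_reflection R \<G> (regular R) (restrict_scalars Q lam) (restrict lam (carrier R))"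

text \<open>\<open>IQ = Q\<close> for all \<open>I \<in> \<G>\<close>.\<close>

definition perfect_topology ::
    "('a, 'r) ring_scheme \<Rightarrow> 'a set set \<Rightarrow> 'u ring \<Rightarrow> ('a \<Rightarrow> 'u) \<Rightarrow> bool" where
  "perfect_topology R \<G> Q lam \<longleftrightarrow>
     (\<forall>I\<in>\<G>. generate (add_monoid Q) {lam i \<otimes>\<^bsub>Q\<^esub> q | i q. i \<in> I \<and> q \<in> carrier Q} = carrier Q)"

subsection \<open>Extension of scalars\<close>

text \<open>\<open>M \<otimes>\<^sub>R T\<close> for \<open>\<tau> : R \<rightarrow> T\<close>: the free abelian group on \<open>M \<times> T\<close> modulo the usual relations.
  Only its additive group is recorded; the maps \<open>\<alpha> \<otimes> T\<close> are \<open>T\<close>-linear, and they are isomorphisms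
  of \<open>T\<close>-modules iff they are isomorphisms of abelian groups.\<close>

definition tensor_relations ::
    "('a, 'r) ring_scheme \<Rightarrow> ('a, 'm) rmod \<Rightarrow> ('t, 'k) ring_scheme \<Rightarrow> ('a \<Rightarrow> 't) \<Rightarrow>
      (('m \<times> 't) \<Rightarrow>\<^sub>0 int) set" where
  "tensor_relations R M T \<tau> = generate (free_Abelian_group (carrier M \<times> carrier T))
     ({frag_of (x \<oplus>\<^bsub>M\<^esub> y, t) - frag_of (x, t) - frag_of (y, t) | x y t.
         x \<in> carrier M \<and> y \<in> carrier M \<and> t \<in> carrier T} \<union>
      {frag_of (x, s \<oplus>\<^bsub>T\<^esub> t) - frag_of (x, s) - frag_of (x, t) | x s t.
         x \<in> carrier M \<and> s \<in> carrier T \<and> t \<in> carrier T} \<union>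
      {frag_of (x \<star>\<^bsub>M\<^esub> r, t) - frag_of (x, \<tau> r \<otimes>\<^bsub>T\<^esub> t) | x r t.
         x \<in> carrier M \<and> r \<in> carrier R \<and> t \<in> carrier T})"

definition tensor ::
    "('a, 'r) ring_scheme \<Rightarrow> ('a, 'm) rmod \<Rightarrow> ('t, 'k) ring_scheme \<Rightarrow> ('a \<Rightarrow> 't) \<Rightarrow>
      (('m \<times> 't) \<Rightarrow>\<^sub>0 int) set monoid" where
  "tensor R M T \<tau> =
     free_Abelian_group (carrier M \<times> carrier T) Mod tensor_relations R M T \<tau>"

text \<open>The common value taken by \<open>the_elem\<close> exists whenever \<open>\<alpha> \<in> Hom R M N\<close>.\<close>

definition tensor_map ::
    "('a, 'r) ring_scheme \<Rightarrow> ('a, 'm) rmod \<Rightarrow> ('a, 'n) rmod \<Rightarrow> ('t, 'k) ring_scheme \<Rightarrow> ('a \<Rightarrow> 't) \<Rightarrow>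
      ('m \<Rightarrow> 'n) \<Rightarrow> (('m \<times> 't) \<Rightarrow>\<^sub>0 int) set \<Rightarrow> (('n \<times> 't) \<Rightarrow>\<^sub>0 int) set" where
  "tensor_map R M N T \<tau> \<alpha> X =
     the_elem ((\<lambda>c. tensor_relations R N T \<tau>
        #>\<^bsub>free_Abelian_group (carrier N \<times> carrier T)\<^esub>
          frag_extend (\<lambda>(x, t). frag_of (\<alpha> x, t)) c) ` X)"

subsection \<open>Universal localization\<close>

text \<open>\<open>0 \<rightarrow> P1 \<rightarrow> P0 \<rightarrow> M \<rightarrow> 0\<close> is exact with \<open>P1\<close>, \<open>P0\<close> finitely generated projective.\<close>

definition fg_projective_resolution ::
    "('a, 'r) ring_scheme \<Rightarrow> ('a, 'u) rmod \<Rightarrow> ('u \<Rightarrow> 'u) \<Rightarrow> ('a, 'u) rmod \<Rightarrow> ('u \<Rightarrow> 'u) \<Rightarrow>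
      ('a, 'u) rmod \<Rightarrow> bool" where
  "fg_projective_resolution R P1 \<alpha> P0 \<pi> M \<longleftrightarrow>
     right_module R M \<and>
     finitely_generated R P1 \<and> projective TYPE('u) R P1 \<and>
     finitely_generated R P0 \<and> projective TYPE('u) R P0 \<and>
     \<alpha> \<in> Hom R P1 P0 \<and> inj_on \<alpha> (carrier P1) \<and>
     \<pi> \<in> Hom R P0 M \<and> \<pi> ` carrier P0 = carrier M \<and>
     \<alpha> ` carrier P1 = hom_kernel P0 M \<pi>"

text \<open>A family of such resolutions, indexed by the modules \<open>U \<in> \<U>\<close>, is passed below as functions
  \<open>P1\<close>, \<open>\<alpha>\<close>, \<open>P0\<close> of \<open>U\<close>.\<close>

definition inverting ::
    "('a, 'r) ring_scheme \<Rightarrow> ('a, 'u) rmod set \<Rightarrow> (('a, 'u) rmod \<Rightarrow> ('a, 'u) rmod) \<Rightarrow>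
      (('a, 'u) rmod \<Rightarrow> 'u \<Rightarrow> 'u) \<Rightarrow> (('a, 'u) rmod \<Rightarrow> ('a, 'u) rmod) \<Rightarrow>
      't ring \<Rightarrow> ('a \<Rightarrow> 't) \<Rightarrow> bool" where
  "inverting R \<U> P1 \<alpha> P0 T \<tau> \<longleftrightarrow>
     (\<forall>U\<in>\<U>. tensor_map R (P1 U) (P0 U) T \<tau> (\<alpha> U) \<in> iso (tensor R (P1 U) T \<tau>) (tensor R (P0 U) T \<tau>))"

text \<open>Universality is tested on the rings over the type \<open>'t\<close>.\<close>

definition universal_localization ::
    "'t itself \<Rightarrow> ('a, 'r) ring_scheme \<Rightarrow> ('a, 'u) rmod set \<Rightarrow> (('a, 'u) rmod \<Rightarrow> ('a, 'u) rmod) \<Rightarrow>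
      (('a, 'u) rmod \<Rightarrow> 'u \<Rightarrow> 'u) \<Rightarrow> (('a, 'u) rmod \<Rightarrow> ('a, 'u) rmod) \<Rightarrow>
      's ring \<Rightarrow> ('a \<Rightarrow> 's) \<Rightarrow> bool" where
  "universal_localization t R \<U> P1 \<alpha> P0 S \<sigma> \<longleftrightarrow>
     ring S \<and> \<sigma> \<in> ring_hom R S \<and> inverting R \<U> P1 \<alpha> P0 S \<sigma> \<and>
     (\<forall>(T :: 't ring) \<tau>. ring T \<and> \<tau> \<in> ring_hom R T \<and> inverting R \<U> P1 \<alpha> P0 T \<tau> \<longrightarrow>
        (\<exists>!\<phi>. \<phi> \<in> ring_hom S T \<and> \<phi> \<in> extensional (carrier S) \<and>
           (\<forall>r\<in>carrier R. \<phi> (\<sigma> r) = \<tau> r)))"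

definition equivalent_ring_homs ::
    "('a, 'r) ring_scheme \<Rightarrow> 's ring \<Rightarrow> ('a \<Rightarrow> 's) \<Rightarrow> 't ring \<Rightarrow> ('a \<Rightarrow> 't) \<Rightarrow> bool" where
  "equivalent_ring_homs R S \<sigma> T \<tau> \<longleftrightarrow>
     (\<exists>\<phi>\<in>ring_iso S T. \<forall>r\<in>carrier R. \<tau> r = \<phi> (\<sigma> r))"

text \<open>\<open>\<U>\<close> consists of finitely presented modules from \<open>\<T>\<close> and contains at least one
  representative of each isomorphism class of these.\<close>

definition representative_fp_modules ::
    "('a, 'r) ring_scheme \<Rightarrow> ('a, 'u) rmod set \<Rightarrow> ('a, 'u) rmod set \<Rightarrow> bool" where
  "representative_fp_modules R \<T> \<U> \<longleftrightarrow>
     \<U> \<subseteq> {M \<in> \<T>. finitely_presented R M} \<and>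
     (\<forall>M\<in>\<T>. finitely_presented R M \<longrightarrow> (\<exists>U\<in>\<U>. rmod_isomorphic R M U))"

end

(* The idea is that every ring T inverting the presentations of the finitely presented torsion modules is
   G-closed as an R-module, so that the R-linear universal property of Q applies to it.
   Since IQ = Q for I in G, the finitely generated ideals are cofinal in G; for such an ideal J, the
   module R/J is finitely presented and torsion, and inverting its presentation says that
   Hom(R, T) -> Hom(J, T) is bijective. Conversely, Q itself inverts a presentation
   0 -> P1 -> P0 -> U -> 0 of a torsion module U: U tensor Q = 0 because IQ = Q, and linear maps from P1
   to Q extend to P0 because Q is closed, so that a dual basis of P1 shows that
   P1 tensor Q -> P0 tensor Q is injective.
   Every linear map from R to a closed module extends uniquely to Q, whatever type that module lives in,
   because R -> Q has torsion kernel and cokernel. The cokernel is torsion since the elements of Q that are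
   torsion modulo the image of R form a closed submodule. For the kernel one needs a closed module into which
   R modulo torsion embeds; it is built from germs of linear maps I -> R with I in G. *)
theory Submission
  imports Defs
begin

section \<open>Linear maps and modules\<close>

text \<open>The defining property of \<open>Q\<close> is tested on modules over \<open>'u\<close>
  only, while the rings that compete in the universal property may live on any type. That the kernel
  and the cokernel of \<open>lam\<close> are torsion is a statement about elements, and so it
  survives the change of type. It has a price: a reflection says nothing about an element of its
  kernel unless some closed module tells that element from zero, and this module has to fit into
  \<open>'u\<close>. Hence germs are represented by plain sets of pairs over \<open>R\<close>. The
  detour through finitely generated ideals is forced because \<open>R/I\<close> need not be finitely
  presented for \<open>I\<close> in \<open>\<G>\<close>, so that \<open>\<U>\<close> need not
  contain a copy of it.\<close>

definition linear_map ::
    "('a, 'r) ring_scheme \<Rightarrow> ('a, 'm) rmod \<Rightarrow> ('a, 'n) rmod \<Rightarrow> ('m \<Rightarrow> 'n) \<Rightarrow> bool" where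
  "linear_map R M N f \<longleftrightarrow> f \<in> carrier M \<rightarrow> carrier N \<and>
     (\<forall>x\<in>carrier M. \<forall>y\<in>carrier M. f (x \<oplus>\<^bsub>M\<^esub> y) = f x \<oplus>\<^bsub>N\<^esub> f y) \<and>
     (\<forall>x\<in>carrier M. \<forall>r\<in>carrier R. f (x \<star>\<^bsub>M\<^esub> r) = f x \<star>\<^bsub>N\<^esub> r)"

lemma linear_mapI:
  assumes "\<And>x. x \<in> carrier M \<Longrightarrow> f x \<in> carrier N"
    and "\<And>x y. x \<in> carrier M \<Longrightarrow> y \<in> carrier M \<Longrightarrow> f (x \<oplus>\<^bsub>M\<^esub> y) = f x \<oplus>\<^bsub>N\<^esub> f y"
    and "\<And>x r. x \<in> carrier M \<Longrightarrow> r \<in> carrier R \<Longrightarrow> f (x \<star>\<^bsub>M\<^esub> r) = f x \<star>\<^bsub>N\<^esub> r"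
  shows "linear_map R M N f"
  using assms unfolding linear_map_def by auto

lemma linear_map_closed: "linear_map R M N f \<Longrightarrow> x \<in> carrier M \<Longrightarrow> f x \<in> carrier N"
  and linear_map_add: "linear_map R M N f \<Longrightarrow> x \<in> carrier M \<Longrightarrow> y \<in> carrier M \<Longrightarrow>
    f (x \<oplus>\<^bsub>M\<^esub> y) = f x \<oplus>\<^bsub>N\<^esub> f y"
  and linear_map_ract: "linear_map R M N f \<Longrightarrow> x \<in> carrier M \<Longrightarrow> r \<in> carrier R \<Longrightarrow>
    f (x \<star>\<^bsub>M\<^esub> r) = f x \<star>\<^bsub>N\<^esub> r"
  unfolding linear_map_def by auto

text \<open>Extensionality only serves equality of functions. \<open>linear_map\<close> leaves it
  out, so that composites and lambda terms are linear as they stand; \<open>restrict_in_Hom\<close>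
  restores it where \<open>Hom\<close> is required.\<close>

lemma Hom_iff: "f \<in> Hom R M N \<longleftrightarrow> linear_map R M N f \<and> f \<in> extensional (carrier M)"
  unfolding Hom_def linear_map_def PiE_def by auto

lemma restrict_in_Hom:
  assumes "right_module R M" "linear_map R M N f"
  shows "restrict f (carrier M) \<in> Hom R M N"
proof -
  interpret right_module R M by fact
  show ?thesis using assms(2) ract_closed unfolding Hom_iff linear_map_def by (auto simp: Pi_iff)
qed

lemma linear_map_compose:
  "linear_map R M N f \<Longrightarrow> linear_map R N L g \<Longrightarrow> linear_map R M L (\<lambda>x. g (f x))"
  unfolding linear_map_def by (auto simp: Pi_iff)

lemma (in abelian_group) minus_eq_zero_iff [simp]:
  "x \<in> carrier G \<Longrightarrow> y \<in> carrier G \<Longrightarrow> x \<ominus> y = \<zero> \<longleftrightarrow> x = y"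
  by (metis add.inv_closed add.inv_inv minus_equality r_neg a_minus_def)

context right_module
begin

lemma zero_ract [simp]: "r \<in> carrier R \<Longrightarrow> \<zero>\<^bsub>M\<^esub> \<star>\<^bsub>M\<^esub> r = \<zero>\<^bsub>M\<^esub>"
  by (metis M.add.r_cancel_one' M.l_zero M.zero_closed ract_add_left ract_closed)

lemma ract_zero [simp]: "x \<in> carrier M \<Longrightarrow> x \<star>\<^bsub>M\<^esub> \<zero> = \<zero>\<^bsub>M\<^esub>"
  by (metis M.add.r_cancel_one' R.l_zero R.zero_closed ract_add_right ract_closed)

lemma ract_minus: "x \<in> carrier M \<Longrightarrow> r \<in> carrier R \<Longrightarrow> x \<star>\<^bsub>M\<^esub> (\<ominus> r) = \<ominus>\<^bsub>M\<^esub> (x \<star>\<^bsub>M\<^esub> r)"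
  by (metis M.minus_equality R.add.inv_closed R.l_neg ract_add_right ract_closed ract_zero)

lemma minus_ract: "x \<in> carrier M \<Longrightarrow> r \<in> carrier R \<Longrightarrow> (\<ominus>\<^bsub>M\<^esub> x) \<star>\<^bsub>M\<^esub> r = \<ominus>\<^bsub>M\<^esub> (x \<star>\<^bsub>M\<^esub> r)"
  by (metis M.add.inv_closed M.l_neg M.minus_equality ract_add_left ract_closed zero_ract)

text \<open>Closure under negation need not be asked for: \<open>-x\<close> is \<open>x\<close>
  acted on by \<open>-1\<close>.\<close>

lemma right_submodule_iff:
  "right_submodule R M N \<longleftrightarrow> N \<subseteq> carrier M \<and> \<zero>\<^bsub>M\<^esub> \<in> N \<and>
     (\<forall>x\<in>N. \<forall>y\<in>N. x \<oplus>\<^bsub>M\<^esub> y \<in> N) \<and> (\<forall>x\<in>N. \<forall>r\<in>carrier R. x \<star>\<^bsub>M\<^esub> r \<in> N)"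
    (is "?A \<longleftrightarrow> ?B")
proof
  assume ?A
  then interpret additive_subgroup N M by (simp add: right_submodule_def)
  show ?B using \<open>?A\<close> a_subset zero_closed a_closed by (auto simp: right_submodule_def)
next
  assume B: ?B
  have "\<ominus>\<^bsub>M\<^esub> x \<in> N" if "x \<in> N" for x
  proof -
    have x: "x \<in> carrier M" and "x \<star>\<^bsub>M\<^esub> (\<ominus> \<one>) \<in> N" using that B by auto
    then show ?thesis using ract_minus[OF x R.one_closed] ract_one[OF x] by simp
  qed
  then have "subgroup N (add_monoid M)"
    using B by (intro M.add.subgroupI) (auto simp: a_inv_def)
  with B show ?A by (auto simp: right_submodule_def additive_subgroup_def)
qed

lemma right_submoduleI:
  assumes "N \<subseteq> carrier M" "\<zero>\<^bsub>M\<^esub> \<in> N" "\<And>x y. x \<in> N \<Longrightarrow> y \<in> N \<Longrightarrow> x \<oplus>\<^bsub>M\<^esub> y \<in> N"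
    "\<And>x r. x \<in> N \<Longrightarrow> r \<in> carrier R \<Longrightarrow> x \<star>\<^bsub>M\<^esub> r \<in> N"
  shows "right_submodule R M N"
  using assms unfolding right_submodule_iff by blast

lemma right_submoduleD:
  assumes "right_submodule R M N"
  shows "N \<subseteq> carrier M" "\<zero>\<^bsub>M\<^esub> \<in> N" "\<And>x y. x \<in> N \<Longrightarrow> y \<in> N \<Longrightarrow> x \<oplus>\<^bsub>M\<^esub> y \<in> N"
    "\<And>x r. x \<in> N \<Longrightarrow> r \<in> carrier R \<Longrightarrow> x \<star>\<^bsub>M\<^esub> r \<in> N"
  using assms unfolding right_submodule_iff by blast+

end

lemma submod_simps [simp]:
  "carrier (submod M N) = N" "\<zero>\<^bsub>submod M N\<^esub> = \<zero>\<^bsub>M\<^esub>"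
  "x \<oplus>\<^bsub>submod M N\<^esub> y = x \<oplus>\<^bsub>M\<^esub> y" "x \<star>\<^bsub>submod M N\<^esub> r = x \<star>\<^bsub>M\<^esub> r"
  by (simp_all add: submod_def)

lemma regular_simps [simp]:
  "carrier (regular R) = carrier R" "\<zero>\<^bsub>regular R\<^esub> = \<zero>\<^bsub>R\<^esub>"
  "x \<oplus>\<^bsub>regular R\<^esub> y = x \<oplus>\<^bsub>R\<^esub> y" "x \<star>\<^bsub>regular R\<^esub> r = x \<otimes>\<^bsub>R\<^esub> r"
  by (simp_all add: regular_def)

lemma ideal_mod_simps [simp]:
  "carrier (ideal_mod R I) = I" "\<zero>\<^bsub>ideal_mod R I\<^esub> = \<zero>\<^bsub>R\<^esub>"
  "x \<oplus>\<^bsub>ideal_mod R I\<^esub> y = x \<oplus>\<^bsub>R\<^esub> y" "x \<star>\<^bsub>ideal_mod R I\<^esub> r = x \<otimes>\<^bsub>R\<^esub> r"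
  by (simp_all add: ideal_mod_def)

lemma restrict_scalars_simps [simp]:
  "carrier (restrict_scalars S \<sigma>) = carrier S" "\<zero>\<^bsub>restrict_scalars S \<sigma>\<^esub> = \<zero>\<^bsub>S\<^esub>"
  "x \<oplus>\<^bsub>restrict_scalars S \<sigma>\<^esub> y = x \<oplus>\<^bsub>S\<^esub> y" "x \<star>\<^bsub>restrict_scalars S \<sigma>\<^esub> r = x \<otimes>\<^bsub>S\<^esub> \<sigma> r"
  by (simp_all add: restrict_scalars_def)

lemma free_rmod_simps [simp]:
  "carrier (free_rmod R n) = {..<n} \<rightarrow>\<^sub>E carrier R" "\<zero>\<^bsub>free_rmod R n\<^esub> = (\<lambda>i\<in>{..<n}. \<zero>\<^bsub>R\<^esub>)"
  "v \<oplus>\<^bsub>free_rmod R n\<^esub> w = (\<lambda>i\<in>{..<n}. v i \<oplus>\<^bsub>R\<^esub> w i)"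
  "v \<star>\<^bsub>free_rmod R n\<^esub> r = (\<lambda>i\<in>{..<n}. v i \<otimes>\<^bsub>R\<^esub> r)"
  by (simp_all add: free_rmod_def)

lemma right_moduleI:
  fixes M :: "('a, 'm) rmod"
  assumes "ring R"
    and "\<And>x y. \<lbrakk>x \<in> carrier M; y \<in> carrier M\<rbrakk> \<Longrightarrow> x \<oplus>\<^bsub>M\<^esub> y \<in> carrier M"
    and "\<zero>\<^bsub>M\<^esub> \<in> carrier M"
    and "\<And>x y z. \<lbrakk>x \<in> carrier M; y \<in> carrier M; z \<in> carrier M\<rbrakk> \<Longrightarrow>
      (x \<oplus>\<^bsub>M\<^esub> y) \<oplus>\<^bsub>M\<^esub> z = x \<oplus>\<^bsub>M\<^esub> (y \<oplus>\<^bsub>M\<^esub> z)"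
    and "\<And>x y. \<lbrakk>x \<in> carrier M; y \<in> carrier M\<rbrakk> \<Longrightarrow> x \<oplus>\<^bsub>M\<^esub> y = y \<oplus>\<^bsub>M\<^esub> x"
    and "\<And>x. x \<in> carrier M \<Longrightarrow> \<zero>\<^bsub>M\<^esub> \<oplus>\<^bsub>M\<^esub> x = x"
    and "\<And>x. x \<in> carrier M \<Longrightarrow> \<exists>y\<in>carrier M. y \<oplus>\<^bsub>M\<^esub> x = \<zero>\<^bsub>M\<^esub>"
    and "\<And>x r. \<lbrakk>x \<in> carrier M; r \<in> carrier R\<rbrakk> \<Longrightarrow> x \<star>\<^bsub>M\<^esub> r \<in> carrier M"
    and "\<And>x y r. \<lbrakk>x \<in> carrier M; y \<in> carrier M; r \<in> carrier R\<rbrakk> \<Longrightarrow>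
      (x \<oplus>\<^bsub>M\<^esub> y) \<star>\<^bsub>M\<^esub> r = x \<star>\<^bsub>M\<^esub> r \<oplus>\<^bsub>M\<^esub> y \<star>\<^bsub>M\<^esub> r"
    and "\<And>x r s. \<lbrakk>x \<in> carrier M; r \<in> carrier R; s \<in> carrier R\<rbrakk> \<Longrightarrow>
      x \<star>\<^bsub>M\<^esub> (r \<oplus>\<^bsub>R\<^esub> s) = x \<star>\<^bsub>M\<^esub> r \<oplus>\<^bsub>M\<^esub> x \<star>\<^bsub>M\<^esub> s"
    and "\<And>x r s. \<lbrakk>x \<in> carrier M; r \<in> carrier R; s \<in> carrier R\<rbrakk> \<Longrightarrow>
      x \<star>\<^bsub>M\<^esub> (r \<otimes>\<^bsub>R\<^esub> s) = (x \<star>\<^bsub>M\<^esub> r) \<star>\<^bsub>M\<^esub> s"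
    and "\<And>x. x \<in> carrier M \<Longrightarrow> x \<star>\<^bsub>M\<^esub> \<one>\<^bsub>R\<^esub> = x"
  shows "right_module R M"
proof -
  interpret R: ring R by fact
  interpret M: abelian_group M
    using assms(2-7) by (intro abelian_groupI) auto
  show ?thesis
    by unfold_locales (use assms in auto)
qed

lemma (in right_module) submod_right_module:
  assumes N: "right_submodule R M N"
  shows "right_module R (submod M N)"
proof (rule right_moduleI)
  note D = right_submoduleD[OF N]
  fix x assume "x \<in> carrier (submod M N)"
  then have x: "x \<in> N" by simp
  then have "x \<star>\<^bsub>M\<^esub> (\<ominus> \<one>) \<in> N" "x \<in> carrier M" using D by auto
  then show "\<exists>y\<in>carrier (submod M N). y \<oplus>\<^bsub>submod M N\<^esub> x = \<zero>\<^bsub>submod M N\<^esub>"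
    using ract_minus[of x "\<one>"] ract_one[of x] M.l_neg by auto
qed (use right_submoduleD[OF N] in \<open>auto simp: R.ring_axioms ract_add_left ract_add_right ract_assoc ract_one
    subset_iff M.a_assoc M.a_comm M.a_lcomm\<close>)

lemma (in ring) regular_right_module: "right_module R (regular R)"
  by (rule right_moduleI) (auto simp: ring_axioms a_assoc a_comm a_lcomm l_distr r_distr m_assoc intro: l_neg)

lemma restrict_scalars_right_module:
  assumes "ring R" "ring S" "\<sigma> \<in> ring_hom R S"
  shows "right_module R (restrict_scalars S \<sigma>)"
proof -
  interpret R: ring R by fact
  interpret S: ring S by fact
  interpret ring_hom_ring R S \<sigma> using assms by (simp add: ring_hom_ringI2)
  show ?thesis
    by (rule right_moduleI)
      (auto simp: R.ring_axioms S.a_assoc S.a_comm S.a_lcomm S.l_distr S.r_distr S.m_assoc intro: S.l_neg)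
qed

lemma (in ring) free_rmod_right_module: "right_module R (free_rmod R n)"
proof (rule right_moduleI)
  fix x assume x: "x \<in> carrier (free_rmod R n)"
  show "\<exists>y\<in>carrier (free_rmod R n). y \<oplus>\<^bsub>free_rmod R n\<^esub> x = \<zero>\<^bsub>free_rmod R n\<^esub>"
    using x by (intro bexI[of _ "\<lambda>i\<in>{..<n}. \<ominus> x i"]) (auto simp: PiE_iff l_neg restrict_def fun_eq_iff extensional_def)
qed (auto simp: ring_axioms PiE_iff a_assoc a_comm a_lcomm l_distr r_distr m_assoc restrict_def extensional_def fun_eq_iff)

text \<open>The structure moves to the image of \<open>g\<close>, which may lie in another type.
  Operands are pulled back to preimages chosen by \<open>inv_into\<close>, so the definition also
  makes sense when \<open>g\<close> is not injective: if the fibres are cosets of a submodule, it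
  yields the quotient module.\<close>

definition transport :: "('m \<Rightarrow> 'n) \<Rightarrow> ('a, 'm) rmod \<Rightarrow> ('a, 'n) rmod" where
  "transport g M = \<lparr>carrier = g ` carrier M, monoid.mult = undefined, one = undefined,
     zero = g \<zero>\<^bsub>M\<^esub>,
     add = (\<lambda>x y. g (inv_into (carrier M) g x \<oplus>\<^bsub>M\<^esub> inv_into (carrier M) g y)),
     ract = (\<lambda>x r. g (inv_into (carrier M) g x \<star>\<^bsub>M\<^esub> r))\<rparr>"

lemma transport_simps:
  assumes "inj_on g (carrier M)"
  shows "carrier (transport g M) = g ` carrier M" "\<zero>\<^bsub>transport g M\<^esub> = g \<zero>\<^bsub>M\<^esub>"
    "x \<in> carrier M \<Longrightarrow> y \<in> carrier M \<Longrightarrow> g x \<oplus>\<^bsub>transport g M\<^esub> g y = g (x \<oplus>\<^bsub>M\<^esub> y)"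
    "x \<in> carrier M \<Longrightarrow> g x \<star>\<^bsub>transport g M\<^esub> r = g (x \<star>\<^bsub>M\<^esub> r)"
  using assms by (auto simp: transport_def)

text \<open>By the hypothesis on \<open>g\<close> the fibres are the cosets of \<open>N\<close>. A
  chosen preimage differs from the given one by an element of \<open>N\<close>; such differences
  stay in \<open>N\<close> under addition and action, so the choice disappears after applying
  \<open>g\<close>.\<close>

lemma transport_quotient:
  fixes M :: "('a, 'm) rmod" and g :: "'m \<Rightarrow> 'n"
  assumes M: "right_module R M" and N: "right_submodule R M N"
    and g: "\<And>x y. x \<in> carrier M \<Longrightarrow> y \<in> carrier M \<Longrightarrow> g x = g y \<longleftrightarrow> x \<ominus>\<^bsub>M\<^esub> y \<in> N"
  shows "right_module R (transport g M)" and "linear_map R M (transport g M) g"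
proof -
  interpret right_module R M by fact
  note D = right_submoduleD[OF N]
  have inv: "inv_into (carrier M) g (g x) \<in> carrier M" "inv_into (carrier M) g (g x) \<ominus>\<^bsub>M\<^esub> x \<in> N"
    if x: "x \<in> carrier M" for x
  proof -
    show "inv_into (carrier M) g (g x) \<in> carrier M" using x by (intro inv_into_into) auto
    then show "inv_into (carrier M) g (g x) \<ominus>\<^bsub>M\<^esub> x \<in> N"
      using x g f_inv_into_f[of "g x" g "carrier M"] by simp
  qed
  have car: "carrier (transport g M) = g ` carrier M" "\<zero>\<^bsub>transport g M\<^esub> = g \<zero>\<^bsub>M\<^esub>"
    by (simp_all add: transport_def)
  have add: "g x \<oplus>\<^bsub>transport g M\<^esub> g y = g (x \<oplus>\<^bsub>M\<^esub> y)" if x: "x \<in> carrier M" and y: "y \<in> carrier M" for x y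
  proof -
    let ?u = "inv_into (carrier M) g (g x)" and ?v = "inv_into (carrier M) g (g y)"
    have "?u \<oplus>\<^bsub>M\<^esub> ?v \<ominus>\<^bsub>M\<^esub> (x \<oplus>\<^bsub>M\<^esub> y) = (?u \<ominus>\<^bsub>M\<^esub> x) \<oplus>\<^bsub>M\<^esub> (?v \<ominus>\<^bsub>M\<^esub> y)"
      using x y inv(1)[OF x] inv(1)[OF y] by (simp add: a_minus_def M.minus_add M.a_ac)
    then have "?u \<oplus>\<^bsub>M\<^esub> ?v \<ominus>\<^bsub>M\<^esub> (x \<oplus>\<^bsub>M\<^esub> y) \<in> N" using D(3) inv(2)[OF x] inv(2)[OF y] by simp
    then have "g (?u \<oplus>\<^bsub>M\<^esub> ?v) = g (x \<oplus>\<^bsub>M\<^esub> y)"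
      using g[of "?u \<oplus>\<^bsub>M\<^esub> ?v" "x \<oplus>\<^bsub>M\<^esub> y"] x y inv(1)[OF x] inv(1)[OF y] by simp
    then show ?thesis by (simp add: transport_def)
  qed
  have act: "g x \<star>\<^bsub>transport g M\<^esub> r = g (x \<star>\<^bsub>M\<^esub> r)" if x: "x \<in> carrier M" and r: "r \<in> carrier R" for x r
  proof -
    let ?u = "inv_into (carrier M) g (g x)"
    have "?u \<star>\<^bsub>M\<^esub> r \<ominus>\<^bsub>M\<^esub> x \<star>\<^bsub>M\<^esub> r = (?u \<ominus>\<^bsub>M\<^esub> x) \<star>\<^bsub>M\<^esub> r"
      using x r inv(1)[OF x] by (simp add: a_minus_def ract_add_left minus_ract)
    then have "?u \<star>\<^bsub>M\<^esub> r \<ominus>\<^bsub>M\<^esub> x \<star>\<^bsub>M\<^esub> r \<in> N" using D(4) inv(2)[OF x] r by simp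
    then have "g (?u \<star>\<^bsub>M\<^esub> r) = g (x \<star>\<^bsub>M\<^esub> r)"
      using g[of "?u \<star>\<^bsub>M\<^esub> r" "x \<star>\<^bsub>M\<^esub> r"] x r inv(1)[OF x] by (simp add: ract_closed)
    then show ?thesis by (simp add: transport_def)
  qed
  show "right_module R (transport g M)"
  proof (rule right_moduleI)
    fix x assume "x \<in> carrier (transport g M)"
    then obtain y where y: "x = g y" "y \<in> carrier M" by (auto simp: car)
    then show "\<exists>y\<in>carrier (transport g M). y \<oplus>\<^bsub>transport g M\<^esub> x = \<zero>\<^bsub>transport g M\<^esub>"
      by (intro bexI[of _ "g (\<ominus>\<^bsub>M\<^esub> y)"]) (auto simp: M.l_neg car add)
  qed (auto simp: car add act R.ring_axioms ract_add_left ract_add_right ract_assoc ract_one ract_closed M.a_assoc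
      intro: arg_cong[OF M.a_comm])
  show "linear_map R M (transport g M) g"
    by (rule linear_mapI) (auto simp: car add act)
qed

lemma (in right_module) zero_submodule: "right_submodule R M {\<zero>\<^bsub>M\<^esub>}"
  by (rule right_submoduleI) auto

text \<open>For injective \<open>g\<close> this is the case of the zero submodule. It moves modules
  into \<open>'u\<close>, where projectivity and the reflection can be applied.\<close>

lemma
  assumes M: "right_module R M" and g: "inj_on g (carrier M)"
  shows transport_right_module: "right_module R (transport g M)"
    and transport_linear_map: "linear_map R M (transport g M) g"
    and transport_linear_map_inv: "linear_map R (transport g M) M (inv_into (carrier M) g)"
proof -
  interpret right_module R M by fact
  note [simp] = transport_simps[OF g]
  show "right_module R (transport g M)" "linear_map R M (transport g M) g"
    using transport_quotient[OF M zero_submodule, of g] inj_on_eq_iff[OF g] by simp_all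
  show "linear_map R (transport g M) M (inv_into (carrier M) g)"
    by (rule linear_mapI) (auto simp: g ract_closed)
qed

section \<open>Linear maps: zero, negatives, images and preimages of submodules\<close>

context
  fixes R :: "('a, 'r) ring_scheme" and M :: "('a, 'm) rmod" and N :: "('a, 'n) rmod" and f
  assumes M: "right_module R M" and N: "right_module R N" and f: "linear_map R M N f"
begin

interpretation M: right_module R M by (rule M)
interpretation N: right_module R N by (rule N)

lemma linear_map_zero: "f \<zero>\<^bsub>M\<^esub> = \<zero>\<^bsub>N\<^esub>"
proof -
  have "f (\<zero>\<^bsub>M\<^esub> \<star>\<^bsub>M\<^esub> \<zero>\<^bsub>R\<^esub>) = f \<zero>\<^bsub>M\<^esub> \<star>\<^bsub>N\<^esub> \<zero>\<^bsub>R\<^esub>"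
    by (rule linear_map_ract[OF f]) auto
  then show ?thesis using linear_map_closed[OF f, of "\<zero>\<^bsub>M\<^esub>"] by simp
qed

lemma linear_map_a_inv: "x \<in> carrier M \<Longrightarrow> f (\<ominus>\<^bsub>M\<^esub> x) = \<ominus>\<^bsub>N\<^esub> f x"
  using linear_map_add[OF f, of "\<ominus>\<^bsub>M\<^esub> x" x] linear_map_closed[OF f, of x]
    linear_map_closed[OF f, of "\<ominus>\<^bsub>M\<^esub> x"]
  by (simp add: M.M.l_neg linear_map_zero N.M.minus_equality[symmetric])

lemma linear_map_minus:
  "x \<in> carrier M \<Longrightarrow> y \<in> carrier M \<Longrightarrow> f (x \<ominus>\<^bsub>M\<^esub> y) = f x \<ominus>\<^bsub>N\<^esub> f y"
  by (simp add: a_minus_def linear_map_add[OF f] linear_map_a_inv)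

lemma linear_image_submodule:
  assumes L: "right_submodule R M L"
  shows "right_submodule R N (f ` L)"
proof (rule N.right_submoduleI)
  note D = M.right_submoduleD[OF L]
  show "f ` L \<subseteq> carrier N" using D f by (auto intro: linear_map_closed)
  show "\<zero>\<^bsub>N\<^esub> \<in> f ` L" using D linear_map_zero by (metis image_eqI)
  show "x \<oplus>\<^bsub>N\<^esub> y \<in> f ` L" if "x \<in> f ` L" "y \<in> f ` L" for x y
    using that D by (auto simp: linear_map_add[OF f, symmetric] subset_iff)
  show "x \<star>\<^bsub>N\<^esub> r \<in> f ` L" if "x \<in> f ` L" "r \<in> carrier R" for x r
    using that D by (auto simp: linear_map_ract[OF f, symmetric] subset_iff)
qed

lemma linear_preimage_submodule:
  assumes L: "right_submodule R N L"
  shows "right_submodule R M {x \<in> carrier M. f x \<in> L}"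
  using N.right_submoduleD[OF L]
  by (intro M.right_submoduleI) (auto simp: linear_map_zero linear_map_add[OF f] linear_map_ract[OF f] M.ract_closed)

end

lemma (in right_module) carrier_submodule: "right_submodule R M (carrier M)"
  by (rule right_submoduleI) (auto simp: ract_closed)

lemma (in right_module) linear_map_ract_elem:
  "x \<in> carrier M \<Longrightarrow> linear_map R (regular R) M (\<lambda>r. x \<star>\<^bsub>M\<^esub> r)"
  by (rule linear_mapI) (auto simp: ract_closed ract_add_right ract_assoc)

section \<open>Gabriel topologies and closed modules\<close>

text \<open>For a submodule \<open>N\<close> this is the right ideal \<open>(N : x)\<close>, the
  annihilator of the class of \<open>x\<close> in \<open>M/N\<close>. Its membership in
  \<open>\<G>\<close> says that \<open>x\<close> is torsion modulo \<open>N\<close>, without a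
  quotient being formed.\<close>

abbreviation (input) colon ::
    "('a, 'r) ring_scheme \<Rightarrow> ('a, 'm) rmod \<Rightarrow> 'm set \<Rightarrow> 'm \<Rightarrow> 'a set" where
  "colon R M N x \<equiv> {r \<in> carrier R. x \<star>\<^bsub>M\<^esub> r \<in> N}"

locale gabriel_ring = ring R for R :: "('a, 'r) ring_scheme" (structure) +
  fixes \<G> :: "'a set set"
  assumes gabriel: "gabriel_topology R \<G>"
begin

interpretation reg: right_module R "regular R" by (rule regular_right_module)

abbreviation (input) residual :: "'a set \<Rightarrow> 'a \<Rightarrow> 'a set" where
  "residual I x \<equiv> {r \<in> carrier R. x \<otimes> r \<in> I}"

lemma right_ideal_iff:
  "right_ideal R I \<longleftrightarrow> I \<subseteq> carrier R \<and> \<zero> \<in> I \<and>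
     (\<forall>x\<in>I. \<forall>y\<in>I. x \<oplus> y \<in> I) \<and> (\<forall>x\<in>I. \<forall>r\<in>carrier R. x \<otimes> r \<in> I)"
  unfolding right_ideal_def reg.right_submodule_iff by simp

lemma right_idealI:
  assumes "I \<subseteq> carrier R" "\<zero> \<in> I" "\<And>x y. x \<in> I \<Longrightarrow> y \<in> I \<Longrightarrow> x \<oplus> y \<in> I"
    "\<And>x r. x \<in> I \<Longrightarrow> r \<in> carrier R \<Longrightarrow> x \<otimes> r \<in> I"
  shows "right_ideal R I"
  using assms unfolding right_ideal_iff by blast

lemma G_right_ideal: "I \<in> \<G> \<Longrightarrow> right_ideal R I"
  using gabriel[unfolded gabriel_topology_def, THEN conjunct2, THEN conjunct1] by blast

lemma G_subset: "I \<in> \<G> \<Longrightarrow> I \<subseteq> carrier R"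
  by (simp add: right_ideal_iff[THEN iffD1, OF G_right_ideal])

lemma G_superset: "I \<in> \<G> \<Longrightarrow> right_ideal R K \<Longrightarrow> I \<subseteq> K \<Longrightarrow> K \<in> \<G>"
  using gabriel[unfolded gabriel_topology_def, THEN conjunct2, THEN conjunct2, THEN conjunct1] by blast

lemma G_Int: "I \<in> \<G> \<Longrightarrow> K \<in> \<G> \<Longrightarrow> I \<inter> K \<in> \<G>"
  using gabriel[unfolded gabriel_topology_def, THEN conjunct2, THEN conjunct2, THEN conjunct2, THEN conjunct1] by blast

lemma G_colon: "I \<in> \<G> \<Longrightarrow> x \<in> carrier R \<Longrightarrow> {r \<in> carrier R. x \<otimes> r \<in> I} \<in> \<G>"
  using gabriel[unfolded gabriel_topology_def, THEN conjunct2, THEN conjunct2, THEN conjunct2, THEN conjunct2, THEN conjunct1] by blast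

lemma G_local:
  "right_ideal R K \<Longrightarrow> I \<in> \<G> \<Longrightarrow> (\<And>x. x \<in> I \<Longrightarrow> residual K x \<in> \<G>) \<Longrightarrow> K \<in> \<G>"
  using gabriel[unfolded gabriel_topology_def, THEN conjunct2, THEN conjunct2, THEN conjunct2, THEN conjunct2, THEN conjunct2] by blast

lemma carrier_right_ideal: "right_ideal R (carrier R)"
  by (rule right_idealI) auto

lemma G_carrier: "carrier R \<in> \<G>"
proof -
  obtain I where I: "I \<in> \<G>" using gabriel[unfolded gabriel_topology_def, THEN conjunct1] by blast
  show ?thesis by (rule G_superset[OF I carrier_right_ideal G_subset[OF I]])
qed

lemma ideal_mod_right_module: "right_ideal R I \<Longrightarrow> right_module R (ideal_mod R I)"
  unfolding ideal_mod_def right_ideal_def by (rule reg.submod_right_module)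

lemma colon_right_ideal:
  assumes "right_module R M" "right_submodule R M N" "x \<in> carrier M"
  shows "right_ideal R (colon R M N x)"
proof -
  interpret M: right_module R M by fact
  show ?thesis
    by (rule right_idealI)
      (use assms M.right_submoduleD[OF assms(2)] in \<open>auto simp: M.ract_add_right M.ract_assoc\<close>)
qed

text \<open>A linear map from \<open>R\<close> to \<open>C\<close> is determined by its value at
  \<open>1\<close>, so restriction to \<open>I\<close> becomes the map that sends \<open>c\<close>
  to multiplication by \<open>c\<close> on \<open>I\<close>. Its injectivity says that
  \<open>I\<close> kills no nonzero element; its surjectivity says that every map on
  \<open>I\<close> is such a multiplication.\<close>

lemma gabriel_closed_iff:
  fixes C :: "('a, 'm) rmod"
  shows "gabriel_closed R \<G> C \<longleftrightarrow> right_module R C \<and>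
    (\<forall>I\<in>\<G>. (\<forall>c\<in>carrier C. (\<forall>i\<in>I. c \<star>\<^bsub>C\<^esub> i = \<zero>\<^bsub>C\<^esub>) \<longrightarrow> c = \<zero>\<^bsub>C\<^esub>) \<and>
      (\<forall>f. linear_map R (ideal_mod R I) C f \<longrightarrow> (\<exists>c\<in>carrier C. \<forall>i\<in>I. f i = c \<star>\<^bsub>C\<^esub> i)))"
proof (cases "right_module R C")
  case True
  interpret C: right_module R C by fact
  have "bij_betw (\<lambda>f. restrict f I) (Hom R (regular R) C) (Hom R (ideal_mod R I) C) \<longleftrightarrow>
      (\<forall>c\<in>carrier C. (\<forall>i\<in>I. c \<star>\<^bsub>C\<^esub> i = \<zero>\<^bsub>C\<^esub>) \<longrightarrow> c = \<zero>\<^bsub>C\<^esub>) \<and>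
      (\<forall>f. linear_map R (ideal_mod R I) C f \<longrightarrow> (\<exists>c\<in>carrier C. \<forall>i\<in>I. f i = c \<star>\<^bsub>C\<^esub> i))"
    (is "?bij \<longleftrightarrow> ?inj \<and> ?surj") if I: "I \<in> \<G>" for I
  proof -
    let ?m = "\<lambda>c. restrict (\<lambda>r. c \<star>\<^bsub>C\<^esub> r) (carrier R)"
    interpret I: right_module R "ideal_mod R I"
      by (rule ideal_mod_right_module[OF G_right_ideal[OF I]])
    have sub: "I \<subseteq> carrier R" by (rule G_subset[OF I])
    have m_Hom: "?m c \<in> Hom R (regular R) C" if "c \<in> carrier C" for c
      using restrict_in_Hom[OF regular_right_module C.linear_map_ract_elem[OF that]] by simp
    have Hom_m: "f \<one> \<in> carrier C" "?m (f \<one>) = f" if f: "f \<in> Hom R (regular R) C" for f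
    proof -
      have lin: "linear_map R (regular R) C f" and ext: "f \<in> extensional (carrier R)"
        using f by (auto simp: Hom_iff)
      show "f \<one> \<in> carrier C" using linear_map_closed[OF lin, of "\<one>"] by simp
      show "?m (f \<one>) = f"
      proof (rule extensionalityI[OF _ ext])
        fix r assume "r \<in> carrier R"
        then show "?m (f \<one>) r = f r" using linear_map_ract[OF lin, of "\<one>" r] by simp
      qed simp
    qed
    let ?n = "\<lambda>c. \<lambda>i\<in>I. c \<star>\<^bsub>C\<^esub> i"
    have "bij_betw ?m (carrier C) (Hom R (regular R) C)"
      by (rule bij_betwI[where g = "\<lambda>f. f \<one>"]) (use m_Hom Hom_m in \<open>auto simp: C.ract_one\<close>)
    moreover have "(\<lambda>f. restrict f I) \<circ> ?m = ?n"
      using sub by (auto simp: restrict_def fun_eq_iff)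
    ultimately have bij_iff: "?bij \<longleftrightarrow> bij_betw ?n (carrier C) (Hom R (ideal_mod R I) C)"
      using bij_betw_comp_iff[of ?m "carrier C" "Hom R (regular R) C" "\<lambda>f. restrict f I"] by simp
    have n_Hom: "?n c \<in> Hom R (ideal_mod R I) C" if "c \<in> carrier C" for c
      using restrict_in_Hom[OF I.right_module_axioms, of C "\<lambda>i. c \<star>\<^bsub>C\<^esub> i"] sub that
      by (auto simp: linear_map_def C.ract_closed C.ract_add_right C.ract_assoc subset_iff)
    \<comment> \<open>\<open>Hom\<close> carries no group structure here, so injectivity is reduced
      to a kernel condition by subtracting in \<open>C\<close>.\<close>
    have n_eq: "?n c = ?n d \<longleftrightarrow> (\<forall>i\<in>I. (c \<ominus>\<^bsub>C\<^esub> d) \<star>\<^bsub>C\<^esub> i = \<zero>\<^bsub>C\<^esub>)"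
      if cd: "c \<in> carrier C" "d \<in> carrier C" for c d
    proof -
      have "?n c = ?n d \<longleftrightarrow> (\<forall>i\<in>I. c \<star>\<^bsub>C\<^esub> i = d \<star>\<^bsub>C\<^esub> i)"
        by (auto simp: restrict_def fun_eq_iff)
      also have "\<dots> \<longleftrightarrow> (\<forall>i\<in>I. c \<star>\<^bsub>C\<^esub> i \<ominus>\<^bsub>C\<^esub> d \<star>\<^bsub>C\<^esub> i = \<zero>\<^bsub>C\<^esub>)"
        using cd sub by (intro ball_cong refl) (simp add: C.ract_closed subset_iff)
      also have "\<dots> \<longleftrightarrow> (\<forall>i\<in>I. (c \<ominus>\<^bsub>C\<^esub> d) \<star>\<^bsub>C\<^esub> i = \<zero>\<^bsub>C\<^esub>)"
        using cd sub
        by (intro ball_cong refl) (simp add: a_minus_def C.ract_add_left C.minus_ract subset_iff)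
      finally show ?thesis .
    qed
    have "inj_on ?n (carrier C) \<longleftrightarrow> ?inj"
    proof
      assume inj: "inj_on ?n (carrier C)"
      show ?inj
      proof (intro ballI impI)
        fix c assume c: "c \<in> carrier C" and z: "\<forall>i\<in>I. c \<star>\<^bsub>C\<^esub> i = \<zero>\<^bsub>C\<^esub>"
        have "?n c = ?n \<zero>\<^bsub>C\<^esub>" using z sub by (auto simp: restrict_def fun_eq_iff)
        then show "c = \<zero>\<^bsub>C\<^esub>" by (rule inj_onD[OF inj]) (simp_all add: c)
      qed
    next
      assume inj: ?inj
      show "inj_on ?n (carrier C)"
      proof (rule inj_onI)
        fix c d assume c: "c \<in> carrier C" and d: "d \<in> carrier C" and "?n c = ?n d"
        then have "c \<ominus>\<^bsub>C\<^esub> d = \<zero>\<^bsub>C\<^esub>" using inj[rule_format, of "c \<ominus>\<^bsub>C\<^esub> d"] n_eq[OF c d] by simp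
        then show "c = d" using c d by simp
      qed
    qed
    moreover have "?n ` carrier C = Hom R (ideal_mod R I) C \<longleftrightarrow> ?surj"
    proof
      assume im: "?n ` carrier C = Hom R (ideal_mod R I) C"
      show ?surj
      proof (intro allI impI)
        fix f assume "linear_map R (ideal_mod R I) C f"
        then have "restrict f I \<in> ?n ` carrier C"
          using restrict_in_Hom[OF I.right_module_axioms] im by simp
        then obtain c where "c \<in> carrier C" and eq: "restrict f I = ?n c" by blast
        moreover have "f i = c \<star>\<^bsub>C\<^esub> i" if "i \<in> I" for i using fun_cong[OF eq, of i] that by simp
        ultimately show "\<exists>c\<in>carrier C. \<forall>i\<in>I. f i = c \<star>\<^bsub>C\<^esub> i" by blast
      qed
    next
      assume surj: ?surj
      have "f \<in> ?n ` carrier C" if f: "f \<in> Hom R (ideal_mod R I) C" for f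
      proof -
        have ext: "f \<in> extensional I" and "linear_map R (ideal_mod R I) C f"
          using f by (auto simp: Hom_iff)
        then obtain c where c: "c \<in> carrier C" "\<forall>i\<in>I. f i = c \<star>\<^bsub>C\<^esub> i" using surj by blast
        have "f = ?n c" by (rule extensionalityI[OF ext]) (use c(2) in auto)
        then show ?thesis using c(1) by blast
      qed
      then show "?n ` carrier C = Hom R (ideal_mod R I) C" using n_Hom by blast
    qed
    ultimately show ?thesis unfolding bij_iff unfolding bij_betw_def by blast
  qed
  then show ?thesis unfolding gabriel_closed_def by auto
qed (simp add: gabriel_closed_def)

section \<open>Uniqueness and extension of maps into closed modules\<close>

lemma closed_right_module: "gabriel_closed R \<G> C \<Longrightarrow> right_module R C"
  by (simp add: gabriel_closed_def)

lemma closed_torsion_zero: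
  assumes "gabriel_closed R \<G> C" "I \<in> \<G>" "c \<in> carrier C" "\<forall>i\<in>I. c \<star>\<^bsub>C\<^esub> i = \<zero>\<^bsub>C\<^esub>"
  shows "c = \<zero>\<^bsub>C\<^esub>"
  using iffD1[OF gabriel_closed_iff assms(1), THEN conjunct2, THEN bspec, OF assms(2), THEN conjunct1]
    assms(3,4) by blast

lemma closed_torsion_free:
  assumes C: "gabriel_closed R \<G> C" and L: "L \<in> \<G>" "c \<in> carrier C" "d \<in> carrier C"
    and eq: "\<And>l. l \<in> L \<Longrightarrow> c \<star>\<^bsub>C\<^esub> l = d \<star>\<^bsub>C\<^esub> l"
  shows "c = d"
proof -
  interpret C: right_module R C by (rule closed_right_module[OF C])
  have "\<forall>l\<in>L. (c \<ominus>\<^bsub>C\<^esub> d) \<star>\<^bsub>C\<^esub> l = \<zero>\<^bsub>C\<^esub>"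
    using eq L G_subset[OF L(1)]
    by (auto simp: a_minus_def C.ract_add_left C.minus_ract C.M.r_neg C.ract_closed subset_iff)
  then have "c \<ominus>\<^bsub>C\<^esub> d = \<zero>\<^bsub>C\<^esub>" using L by (intro closed_torsion_zero[OF C L(1)]) auto
  then show ?thesis using L by simp
qed

lemma closed_ideal_extension:
  assumes "gabriel_closed R \<G> C" "I \<in> \<G>" "linear_map R (ideal_mod R I) C f"
  obtains c where "c \<in> carrier C" "\<And>i. i \<in> I \<Longrightarrow> f i = c \<star>\<^bsub>C\<^esub> i"
  using iffD1[OF gabriel_closed_iff assms(1), THEN conjunct2, THEN bspec, OF assms(2), THEN conjunct2]
    assms(3) by blast

text \<open>At each \<open>m\<close> the two values agree after multiplication by the ideal of all
  \<open>l\<close> with \<open>m l\<close> in \<open>N\<close>, and a closed module has no torsion.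
  This is the uniqueness that belongs to \<open>linear_map_extension\<close>.\<close>

lemma linear_map_unique:
  assumes C: "gabriel_closed R \<G> C" and g: "linear_map R M C g" and h: "linear_map R M C h"
    and coker: "\<And>m. m \<in> carrier M \<Longrightarrow> colon R M N m \<in> \<G>"
    and eq: "\<And>x. x \<in> N \<Longrightarrow> g x = h x" and m: "m \<in> carrier M"
  shows "g m = h m"
proof (rule closed_torsion_free[OF C coker[OF m]])
  show "g m \<in> carrier C" "h m \<in> carrier C" using g h m by (auto intro: linear_map_closed)
  show "g m \<star>\<^bsub>C\<^esub> l = h m \<star>\<^bsub>C\<^esub> l" if "l \<in> colon R M N m" for l
    using that m eq[of "m \<star>\<^bsub>M\<^esub> l"] by (simp add: linear_map_ract[OF g] linear_map_ract[OF h])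
qed

text \<open>The value at \<open>m\<close> is the element of \<open>C\<close> that represents
  \<open>r \<mapsto> f (\<alpha>\<^sup>-\<^sup>1 (m r))\<close> on the ideal of all \<open>r\<close> with \<open>m r\<close> in the image of \<open>\<alpha>\<close>.\<close>

lemma linear_map_extension:
  fixes C :: "('a, 'c) rmod" and M :: "('a, 'm) rmod" and N :: "('a, 'n) rmod"
  assumes C: "gabriel_closed R \<G> C" and M: "right_module R M" and N: "right_module R N"
    and \<alpha>: "linear_map R N M \<alpha>" and f: "linear_map R N C f"
    and ker: "\<And>y. y \<in> carrier N \<Longrightarrow> \<alpha> y = \<zero>\<^bsub>M\<^esub> \<Longrightarrow> f y = \<zero>\<^bsub>C\<^esub>"
    and coker: "\<And>m. m \<in> carrier M \<Longrightarrow> colon R M (\<alpha> ` carrier N) m \<in> \<G>"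
  obtains g where "linear_map R M C g" "\<And>y. y \<in> carrier N \<Longrightarrow> g (\<alpha> y) = f y"
proof -
  interpret M: right_module R M by fact
  interpret N: right_module R N by fact
  interpret C: right_module R C by (rule closed_right_module[OF C])
  let ?I = "\<lambda>m. colon R M (\<alpha> ` carrier N) m"
  \<comment> \<open>The kernel condition makes \<open>f y\<close> depend on
    \<open>\<alpha> y\<close> only, so any preimage under \<open>\<alpha>\<close> may be
    used.\<close>
  have wd: "f y = f y'" if "y \<in> carrier N" "y' \<in> carrier N" "\<alpha> y = \<alpha> y'" for y y'
  proof -
    have "\<alpha> (y \<ominus>\<^bsub>N\<^esub> y') = \<zero>\<^bsub>M\<^esub>"
      using that linear_map_minus[OF N M \<alpha>] linear_map_closed[OF \<alpha>]
      by (simp add: a_minus_def M.M.r_neg)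
    then have "f (y \<ominus>\<^bsub>N\<^esub> y') = \<zero>\<^bsub>C\<^esub>" using ker that by simp
    then show ?thesis
      using that linear_map_minus[OF N C.right_module_axioms f] linear_map_closed[OF f] by simp
  qed
  have "\<exists>c\<in>carrier C. \<forall>r\<in>?I m. \<forall>y\<in>carrier N. \<alpha> y = m \<star>\<^bsub>M\<^esub> r \<longrightarrow> f y = c \<star>\<^bsub>C\<^esub> r"
    if m: "m \<in> carrier M" for m
  proof -
    define h where "h = (\<lambda>r. f (SOME y. y \<in> carrier N \<and> \<alpha> y = m \<star>\<^bsub>M\<^esub> r))"
    have h: "h r = f y" if "y \<in> carrier N" "\<alpha> y = m \<star>\<^bsub>M\<^esub> r" for r y
    proof -
      have "(SOME y. y \<in> carrier N \<and> \<alpha> y = m \<star>\<^bsub>M\<^esub> r) \<in> carrier N \<and>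
          \<alpha> (SOME y. y \<in> carrier N \<and> \<alpha> y = m \<star>\<^bsub>M\<^esub> r) = m \<star>\<^bsub>M\<^esub> r"
        by (rule someI[of _ y]) (use that in simp)
      then show ?thesis unfolding h_def using that by (intro wd) auto
    qed
    have "linear_map R (ideal_mod R (?I m)) C h"
    proof (rule linear_mapI; simp)
      fix r assume r: "r \<in> carrier R \<and> m \<star>\<^bsub>M\<^esub> r \<in> \<alpha> ` carrier N"
      then obtain y where y: "y \<in> carrier N" "\<alpha> y = m \<star>\<^bsub>M\<^esub> r" by auto
      show "h r \<in> carrier C" using h[OF y] linear_map_closed[OF f y(1)] by simp
      show "h (r \<otimes> s) = h r \<star>\<^bsub>C\<^esub> s" if "s \<in> carrier R" for s
        using h[OF y] h[of "y \<star>\<^bsub>N\<^esub> s" "r \<otimes> s"] y r that m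
        by (simp add: linear_map_ract[OF \<alpha>] linear_map_ract[OF f] M.ract_assoc N.ract_closed)
      show "h (r \<oplus> r') = h r \<oplus>\<^bsub>C\<^esub> h r'"
        if r': "r' \<in> carrier R \<and> m \<star>\<^bsub>M\<^esub> r' \<in> \<alpha> ` carrier N" for r'
      proof -
        obtain y' where y': "y' \<in> carrier N" "\<alpha> y' = m \<star>\<^bsub>M\<^esub> r'" using r' by auto
        show ?thesis
          using h[OF y] h[OF y'] h[of "y \<oplus>\<^bsub>N\<^esub> y'" "r \<oplus> r'"] y y' r r' m
          by (simp add: linear_map_add[OF \<alpha>] linear_map_add[OF f] M.ract_add_right)
      qed
    qed
    then obtain c where c: "c \<in> carrier C" "\<And>i. i \<in> ?I m \<Longrightarrow> h i = c \<star>\<^bsub>C\<^esub> i"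
      by (rule closed_ideal_extension[OF C coker[OF m]]) blast
    show ?thesis
    proof (intro bexI ballI impI)
      fix r y assume "r \<in> ?I m" "y \<in> carrier N" "\<alpha> y = m \<star>\<^bsub>M\<^esub> r"
      then show "f y = c \<star>\<^bsub>C\<^esub> r" using c(2)[of r] h[of y r] by simp
    qed (rule c(1))
  qed
  then obtain g where gc: "\<And>m. m \<in> carrier M \<Longrightarrow> g m \<in> carrier C"
    and g: "\<And>m r y. m \<in> carrier M \<Longrightarrow> r \<in> carrier R \<Longrightarrow> y \<in> carrier N \<Longrightarrow>
      \<alpha> y = m \<star>\<^bsub>M\<^esub> r \<Longrightarrow> f y = g m \<star>\<^bsub>C\<^esub> r"
    by (simp add: image_iff) metis
  show thesis
  proof (rule that)
    show "linear_map R M C g"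
    proof (rule linear_mapI)
      fix x assume x: "x \<in> carrier M"
      show "g x \<in> carrier C" by (rule gc[OF x])
      show "g (x \<oplus>\<^bsub>M\<^esub> y) = g x \<oplus>\<^bsub>C\<^esub> g y" if y: "y \<in> carrier M" for y
      \<comment> \<open>For \<open>r\<close> in both ideals, \<open>x r\<close> and
        \<open>y r\<close> have preimages, and the sum of these is a preimage of
        \<open>(x + y) r\<close>.\<close>
      proof (rule closed_torsion_free[OF C G_Int[OF coker[OF x] coker[OF y]]])
        fix r assume "r \<in> ?I x \<inter> ?I y"
        then obtain u v where u: "u \<in> carrier N" "\<alpha> u = x \<star>\<^bsub>M\<^esub> r"
          and v: "v \<in> carrier N" "\<alpha> v = y \<star>\<^bsub>M\<^esub> r" and r: "r \<in> carrier R" by auto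
        have "f (u \<oplus>\<^bsub>N\<^esub> v) = g (x \<oplus>\<^bsub>M\<^esub> y) \<star>\<^bsub>C\<^esub> r"
          by (rule g) (use x y u v r in \<open>auto simp: linear_map_add[OF \<alpha>] M.ract_add_left\<close>)
        then show "g (x \<oplus>\<^bsub>M\<^esub> y) \<star>\<^bsub>C\<^esub> r = (g x \<oplus>\<^bsub>C\<^esub> g y) \<star>\<^bsub>C\<^esub> r"
          using x y u v r gc g[of x r u] g[of y r v]
          by (simp add: linear_map_add[OF f] C.ract_add_left)
      qed (use x y gc in auto)
      show "g (x \<star>\<^bsub>M\<^esub> s) = g x \<star>\<^bsub>C\<^esub> s" if s: "s \<in> carrier R" for s
      \<comment> \<open>A preimage of \<open>x s r\<close> belongs to the element \<open>x s\<close>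
        with scalar \<open>r\<close>, and also to \<open>x\<close> with scalar \<open>s r\<close>;
        the two readings give the two sides.\<close>
      proof (rule closed_torsion_free[OF C coker[of "x \<star>\<^bsub>M\<^esub> s"]])
        fix r assume "r \<in> ?I (x \<star>\<^bsub>M\<^esub> s)"
        then obtain u where u: "u \<in> carrier N" "\<alpha> u = x \<star>\<^bsub>M\<^esub> s \<star>\<^bsub>M\<^esub> r" and r: "r \<in> carrier R"
          by auto
        have "f u = g (x \<star>\<^bsub>M\<^esub> s) \<star>\<^bsub>C\<^esub> r"
          using x s u r by (intro g) (auto simp: M.ract_closed)
        moreover have "f u = g x \<star>\<^bsub>C\<^esub> (s \<otimes> r)"
          using x s u r by (intro g) (auto simp: M.ract_assoc)
        ultimately show "g (x \<star>\<^bsub>M\<^esub> s) \<star>\<^bsub>C\<^esub> r = g x \<star>\<^bsub>C\<^esub> s \<star>\<^bsub>C\<^esub> r"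
          using x s r gc by (simp add: C.ract_assoc)
      qed (use x s gc in \<open>auto simp: C.ract_closed M.ract_closed\<close>)
    qed
    fix y assume y: "y \<in> carrier N"
    then have \<alpha>y: "\<alpha> y \<in> carrier M" by (rule linear_map_closed[OF \<alpha>])
    then have "f y = g (\<alpha> y) \<star>\<^bsub>C\<^esub> \<one>"
      using y by (intro g) (auto simp: M.ract_one)
    then show "g (\<alpha> y) = f y" using gc[OF \<alpha>y] by (simp add: C.ract_one)
  qed
qed

text \<open>This is the preimage in \<open>M\<close> of the torsion part of \<open>M/N\<close>. Sums
  use intersections in \<open>\<G>\<close>, and the action uses
  \<open>((N : x) : s) = (N : x s)\<close>.\<close>

lemma closure_submodule:
  assumes M: "right_module R M" and N: "right_submodule R M N"
  shows "right_submodule R M {x \<in> carrier M. colon R M N x \<in> \<G>}"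
proof -
  interpret M: right_module R M by fact
  note D = M.right_submoduleD[OF N]
  note colon = colon_right_ideal[OF M N]
  show ?thesis
  proof (rule M.right_submoduleI; simp)
    have "colon R M N \<zero>\<^bsub>M\<^esub> = carrier R" using D by auto
    then show "colon R M N \<zero>\<^bsub>M\<^esub> \<in> \<G>" using G_carrier by simp
  next
    fix x y assume x: "x \<in> carrier M \<and> colon R M N x \<in> \<G>"
      and y: "y \<in> carrier M \<and> colon R M N y \<in> \<G>"
    have "colon R M N x \<inter> colon R M N y \<in> \<G>"
      using x y by (intro G_Int) auto
    then show "colon R M N (x \<oplus>\<^bsub>M\<^esub> y) \<in> \<G>"
      by (rule G_superset) (use x y colon D in \<open>auto simp: M.ract_add_left\<close>)
  next
    fix x s assume x: "x \<in> carrier M \<and> colon R M N x \<in> \<G>" and s: "s \<in> carrier R"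
    have "residual (colon R M N x) s \<in> \<G>"
      using x s by (intro G_colon) auto
    also have "residual (colon R M N x) s =
        colon R M N (x \<star>\<^bsub>M\<^esub> s)"
      using x s by (auto simp: M.ract_assoc)
    finally show "x \<star>\<^bsub>M\<^esub> s \<in> carrier M \<and> colon R M N (x \<star>\<^bsub>M\<^esub> s) \<in> \<G>"
      using x s by (simp add: M.ract_closed)
  qed
qed

text \<open>The only question is whether the element \<open>c\<close> that represents a map
  \<open>f\<close> stays in the closure. Each \<open>c i = f i\<close> is torsion modulo
  \<open>N\<close>, and \<open>(N : c i) = ((N : c) : i)\<close>, so \<open>G_local\<close> makes
  \<open>c\<close> torsion modulo \<open>N\<close>.\<close>

lemma closure_closed:
  assumes C: "gabriel_closed R \<G> C" and N: "right_submodule R C N"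
  shows "gabriel_closed R \<G> (submod C {x \<in> carrier C. colon R C N x \<in> \<G>})"
    (is "gabriel_closed R \<G> (submod C ?D)")
proof -
  interpret C: right_module R C by (rule closed_right_module[OF C])
  show ?thesis
    unfolding gabriel_closed_iff
  proof (intro conjI ballI allI impI)
    show "right_module R (submod C ?D)"
      by (rule C.submod_right_module[OF closure_submodule[OF C.right_module_axioms N]])
    fix I assume I: "I \<in> \<G>"
    show "c = \<zero>\<^bsub>submod C ?D\<^esub>"
      if "c \<in> carrier (submod C ?D)" "\<forall>i\<in>I. c \<star>\<^bsub>submod C ?D\<^esub> i = \<zero>\<^bsub>submod C ?D\<^esub>" for c
      using closed_torsion_zero[OF C I, of c] that by simp
    show "\<exists>c\<in>carrier (submod C ?D). \<forall>i\<in>I. f i = c \<star>\<^bsub>submod C ?D\<^esub> i"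
      if f: "linear_map R (ideal_mod R I) (submod C ?D) f" for f
    proof -
      have "linear_map R (ideal_mod R I) C f"
        using f by (auto simp: linear_map_def Pi_iff)
      then obtain c where c: "c \<in> carrier C" and ci: "\<And>i. i \<in> I \<Longrightarrow> f i = c \<star>\<^bsub>C\<^esub> i"
        by (rule closed_ideal_extension[OF C I]) blast
      have "colon R C N c \<in> \<G>"
      proof (rule G_local[OF colon_right_ideal[OF C.right_module_axioms N c] I])
        fix i assume i: "i \<in> I"
        then have "f i \<in> ?D" using linear_map_closed[OF f, of i] by simp
        then have "colon R C N (c \<star>\<^bsub>C\<^esub> i) \<in> \<G>" using ci[OF i] by simp
        also have "colon R C N (c \<star>\<^bsub>C\<^esub> i) =
            residual (colon R C N c) i"
          using c i G_subset[OF I] by (auto simp: C.ract_assoc subset_iff)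
        finally show "residual (colon R C N c) i \<in> \<G>" .
      qed
      then show ?thesis using c ci by (intro bexI[of _ c]) auto
    qed
  qed
qed

lemma transport_closed:
  assumes C: "gabriel_closed R \<G> C" and g: "inj_on g (carrier C)"
  shows "gabriel_closed R \<G> (transport g C)"
proof -
  interpret C: right_module R C by (rule closed_right_module[OF C])
  note [simp] = transport_simps[OF g]
  show ?thesis
    unfolding gabriel_closed_iff
  proof (intro conjI ballI allI impI)
    show "right_module R (transport g C)"
      by (rule transport_right_module[OF C.right_module_axioms g])
    fix I assume I: "I \<in> \<G>"
    show "c = \<zero>\<^bsub>transport g C\<^esub>"
      if c: "c \<in> carrier (transport g C)" and z: "\<forall>i\<in>I. c \<star>\<^bsub>transport g C\<^esub> i = \<zero>\<^bsub>transport g C\<^esub>" for c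
    proof -
      obtain d where d: "d \<in> carrier C" "c = g d" using c by auto
      have "d \<star>\<^bsub>C\<^esub> i = \<zero>\<^bsub>C\<^esub>" if "i \<in> I" for i
      proof (rule inj_onD[OF g])
        show "g (d \<star>\<^bsub>C\<^esub> i) = g \<zero>\<^bsub>C\<^esub>" using z d that by auto
      qed (use d that G_subset[OF I] in \<open>auto simp: C.ract_closed\<close>)
      then show ?thesis using closed_torsion_zero[OF C I d(1)] d(2) by simp
    qed
    show "\<exists>c\<in>carrier (transport g C). \<forall>i\<in>I. f i = c \<star>\<^bsub>transport g C\<^esub> i"
      if f: "linear_map R (ideal_mod R I) (transport g C) f" for f
    proof -
      have "linear_map R (ideal_mod R I) C (\<lambda>i. inv_into (carrier C) g (f i))"
        by (rule linear_map_compose[OF f transport_linear_map_inv[OF C.right_module_axioms g]])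
      then obtain c where c: "c \<in> carrier C" "\<And>i. i \<in> I \<Longrightarrow> inv_into (carrier C) g (f i) = c \<star>\<^bsub>C\<^esub> i"
        using closed_ideal_extension[OF C I] by blast
      have "f i = g c \<star>\<^bsub>transport g C\<^esub> i" if "i \<in> I" for i
      proof -
        have "f i \<in> g ` carrier C" using linear_map_closed[OF f, of i] that by simp
        then have "f i = g (inv_into (carrier C) g (f i))" by (simp add: f_inv_into_f)
        then show ?thesis using c(2)[OF that] c(1) by simp
      qed
      then show ?thesis using c(1) by (intro bexI[of _ "g c"]) auto
    qed
  qed
qed

end

section \<open>A closed module that contains \<open>R\<close> modulo torsion\<close>

context gabriel_ring
begin

definition torsion :: "'a set" where
  "torsion = {x \<in> carrier R. {r \<in> carrier R. x \<otimes> r = \<zero>} \<in> \<G>}"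

lemma torsion_submodule: "right_submodule R (regular R) torsion"
proof -
  interpret reg: right_module R "regular R" by (rule regular_right_module)
  show ?thesis
    using closure_submodule[OF regular_right_module reg.zero_submodule]
    by (simp add: torsion_def)
qed

lemma torsion_closed:
  "torsion \<subseteq> carrier R" "\<zero> \<in> torsion"
  "x \<in> torsion \<Longrightarrow> y \<in> torsion \<Longrightarrow> x \<oplus> y \<in> torsion"
  "x \<in> torsion \<Longrightarrow> r \<in> carrier R \<Longrightarrow> x \<otimes> r \<in> torsion"
proof -
  interpret reg: right_module R "regular R" by (rule regular_right_module)
  note D = reg.right_submoduleD[OF torsion_submodule]
  show "torsion \<subseteq> carrier R" "\<zero> \<in> torsion"
    "x \<in> torsion \<Longrightarrow> y \<in> torsion \<Longrightarrow> x \<oplus> y \<in> torsion"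
    "x \<in> torsion \<Longrightarrow> r \<in> carrier R \<Longrightarrow> x \<otimes> r \<in> torsion"
    using D by simp_all
qed

text \<open>\<open>R\<close> modulo its torsion is torsion-free. The reason is
  \<open>G_local\<close>, since the annihilator of \<open>x l\<close> is
  \<open>(ann x : l)\<close>.\<close>

lemma torsion_local:
  assumes x: "x \<in> carrier R" and L: "L \<in> \<G>" and t: "\<And>l. l \<in> L \<Longrightarrow> x \<otimes> l \<in> torsion"
  shows "x \<in> torsion"
proof -
  interpret reg: right_module R "regular R" by (rule regular_right_module)
  have "right_ideal R {r \<in> carrier R. x \<otimes> r = \<zero>}"
    using colon_right_ideal[OF regular_right_module reg.zero_submodule, of x] x by simp
  then have "{r \<in> carrier R. x \<otimes> r = \<zero>} \<in> \<G>"
  proof (rule G_local[OF _ L])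
    fix l assume l: "l \<in> L"
    have "{r \<in> carrier R. x \<otimes> l \<otimes> r = \<zero>} \<in> \<G>"
      using t[OF l] by (simp add: torsion_def)
    also have "{r \<in> carrier R. x \<otimes> l \<otimes> r = \<zero>} =
        {r \<in> carrier R. l \<otimes> r \<in> {r \<in> carrier R. x \<otimes> r = \<zero>}}"
      using x l G_subset[OF L] by (auto simp: m_assoc subset_iff)
    finally show "{r \<in> carrier R. l \<otimes> r \<in> {r \<in> carrier R. x \<otimes> r = \<zero>}} \<in> \<G>" .
  qed
  with x show ?thesis by (simp add: torsion_def)
qed

text \<open>\<open>S\<close> is viewed as a submodule of \<open>R \<times> R\<close>; this is the
  ideal \<open>(S : (a, b))\<close>.\<close>

abbreviation (input) pair_colon :: "('a \<times> 'a) set \<Rightarrow> 'a \<Rightarrow> 'a \<Rightarrow> 'a set" where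
  "pair_colon S a b \<equiv> {r \<in> carrier R. (a \<otimes> r, b \<otimes> r) \<in> S}"

text \<open>An element of the closed module is a linear map from an ideal in \<open>\<G>\<close> to \<open>R\<close> modulo torsion,
  up to agreement on a smaller ideal in \<open>\<G>\<close>. It is represented by the largest graph in
  its class, so that no quotient needs to be taken.\<close>

definition partial_graph :: "('a \<times> 'a) set \<Rightarrow> bool" where
  "partial_graph S \<longleftrightarrow> S \<subseteq> carrier R \<times> carrier R \<and>
     (\<forall>a b c d. (a, b) \<in> S \<longrightarrow> (c, d) \<in> S \<longrightarrow> (a \<oplus> c, b \<oplus> d) \<in> S) \<and>
     (\<forall>a b. \<forall>r\<in>carrier R. (a, b) \<in> S \<longrightarrow> (a \<otimes> r, b \<otimes> r) \<in> S) \<and>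
     Domain S \<in> \<G> \<and> (\<forall>x. (\<zero>, x) \<in> S \<longrightarrow> x \<in> torsion)"

text \<open>The closure of \<open>S\<close> in \<open>R \<times> R\<close> in the sense of
  \<open>closure_submodule\<close>. It enlarges the domain and adds torsion to the values, so that
  maps agreeing on an ideal of \<open>\<G>\<close> receive the same graph.\<close>

definition saturation :: "('a \<times> 'a) set \<Rightarrow> ('a \<times> 'a) set" where
  "saturation S = {(a, b) \<in> carrier R \<times> carrier R. pair_colon S a b \<in> \<G>}"

definition germ :: "('a \<times> 'a) set \<Rightarrow> bool" where
  "germ S \<longleftrightarrow> partial_graph S \<and> saturation S \<subseteq> S"

section \<open>Partial graphs, their saturation and the module of germs\<close>

lemma partial_graphI:
  assumes "S \<subseteq> carrier R \<times> carrier R"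
    "\<And>a b c d. (a, b) \<in> S \<Longrightarrow> (c, d) \<in> S \<Longrightarrow> (a \<oplus> c, b \<oplus> d) \<in> S"
    "\<And>a b r. (a, b) \<in> S \<Longrightarrow> r \<in> carrier R \<Longrightarrow> (a \<otimes> r, b \<otimes> r) \<in> S"
    "Domain S \<in> \<G>" "\<And>x. (\<zero>, x) \<in> S \<Longrightarrow> x \<in> torsion"
  shows "partial_graph S"
  unfolding partial_graph_def using assms by (intro conjI allI impI ballI)

lemma partial_graphD:
  assumes "partial_graph S"
  shows "(a, b) \<in> S \<Longrightarrow> a \<in> carrier R" "(a, b) \<in> S \<Longrightarrow> b \<in> carrier R"
    and "(a, b) \<in> S \<Longrightarrow> (c, d) \<in> S \<Longrightarrow> (a \<oplus> c, b \<oplus> d) \<in> S"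
    and "(a, b) \<in> S \<Longrightarrow> r \<in> carrier R \<Longrightarrow> (a \<otimes> r, b \<otimes> r) \<in> S"
    and "Domain S \<in> \<G>" and "(\<zero>, x) \<in> S \<Longrightarrow> x \<in> torsion"
proof -
  note D = assms[unfolded partial_graph_def]
  show "(a, b) \<in> S \<Longrightarrow> a \<in> carrier R" "(a, b) \<in> S \<Longrightarrow> b \<in> carrier R"
    using D[THEN conjunct1] by blast+
  show "(a, b) \<in> S \<Longrightarrow> (c, d) \<in> S \<Longrightarrow> (a \<oplus> c, b \<oplus> d) \<in> S"
    using D[THEN conjunct2, THEN conjunct1] by blast
  show "(a, b) \<in> S \<Longrightarrow> r \<in> carrier R \<Longrightarrow> (a \<otimes> r, b \<otimes> r) \<in> S"
    using D[THEN conjunct2, THEN conjunct2, THEN conjunct1] by blast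
  show "Domain S \<in> \<G>" "(\<zero>, x) \<in> S \<Longrightarrow> x \<in> torsion"
    using D by simp_all
qed

lemma partial_graph_zero: "partial_graph S \<Longrightarrow> (\<zero>, \<zero>) \<in> S"
proof -
  assume S: "partial_graph S"
  have "\<zero> \<in> Domain S"
    using G_right_ideal[OF partial_graphD(5)[OF S]] unfolding right_ideal_iff by blast
  then obtain b where b: "(\<zero>, b) \<in> S" by blast
  show ?thesis
    using partial_graphD(4)[OF S b zero_closed] partial_graphD(2)[OF S b] by simp
qed

lemma partial_graph_colon:
  assumes S: "partial_graph S" and a: "a \<in> carrier R" "b \<in> carrier R"
  shows "right_ideal R (pair_colon S a b)"
proof (rule right_idealI)
  note D = partial_graphD[OF S]
  show "\<zero> \<in> pair_colon S a b" using a partial_graph_zero[OF S] by simp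
  show "x \<oplus> y \<in> pair_colon S a b"
    if "x \<in> pair_colon S a b" "y \<in> pair_colon S a b" for x y
    using that a D(3)[of "a \<otimes> x" "b \<otimes> x" "a \<otimes> y" "b \<otimes> y"] by (simp add: r_distr)
  show "x \<otimes> r \<in> pair_colon S a b"
    if "x \<in> pair_colon S a b" "r \<in> carrier R" for x r
    using that a D(4)[of "a \<otimes> x" "b \<otimes> x" r] by (simp add: m_assoc)
qed auto

lemma subset_saturation: "partial_graph S \<Longrightarrow> S \<subseteq> saturation S"
proof
  fix x assume S: "partial_graph S" and x: "x \<in> S"
  obtain a b where ab: "x = (a, b)" by force
  note D = partial_graphD[OF S]
  have "pair_colon S a b = carrier R"
    using D(4) x ab by auto
  then show "x \<in> saturation S"
    using x ab D(1,2) G_carrier by (auto simp: saturation_def)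
qed

text \<open>One saturation suffices: a pair in the second closure already lies in the first, by
  \<open>G_local\<close>. Values over zero remain torsion by \<open>torsion_local\<close>.\<close>

lemma germ_saturation:
  assumes S: "partial_graph S"
  shows "germ (saturation S)"
proof -
  note D = partial_graphD[OF S]
  have sat: "(a, b) \<in> saturation S \<longleftrightarrow> a \<in> carrier R \<and> b \<in> carrier R \<and>
      pair_colon S a b \<in> \<G>" for a b
    by (simp add: saturation_def)
  have add: "(a \<oplus> c, b \<oplus> d) \<in> saturation S"
    if ab: "(a, b) \<in> saturation S" and cd: "(c, d) \<in> saturation S" for a b c d
  proof -
    have car: "a \<in> carrier R" "b \<in> carrier R" "c \<in> carrier R" "d \<in> carrier R"
      using ab cd by (auto simp: sat)
    have "pair_colon S (a \<oplus> c) (b \<oplus> d) \<in> \<G>"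
    proof (rule G_superset)
      show "pair_colon S a b \<inter> pair_colon S c d \<in> \<G>"
        using ab cd by (intro G_Int) (auto simp: sat)
      show "right_ideal R (pair_colon S (a \<oplus> c) (b \<oplus> d))"
        using car by (intro partial_graph_colon[OF S]) auto
      show "pair_colon S a b \<inter> pair_colon S c d
          \<subseteq> pair_colon S (a \<oplus> c) (b \<oplus> d)"
        using car D(3) by (auto simp: l_distr)
    qed
    then show ?thesis using car by (simp add: sat)
  qed
  have smult: "(a \<otimes> s, b \<otimes> s) \<in> saturation S"
    if ab: "(a, b) \<in> saturation S" and s: "s \<in> carrier R" for a b s
  proof -
    have car: "a \<in> carrier R" "b \<in> carrier R" using ab by (auto simp: sat)
    have "residual (pair_colon S a b) s \<in> \<G>"
      using ab s by (intro G_colon) (auto simp: sat)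
    also have "residual (pair_colon S a b) s =
        pair_colon S (a \<otimes> s) (b \<otimes> s)"
      using car s by (auto simp: m_assoc)
    finally show ?thesis using car s by (simp add: sat)
  qed
  have "partial_graph (saturation S)"
  proof (rule partial_graphI[OF _ add smult])
    show "saturation S \<subseteq> carrier R \<times> carrier R" by (auto simp: saturation_def)
    show "Domain (saturation S) \<in> \<G>"
    proof (rule G_superset[OF D(5)])
      show "Domain S \<subseteq> Domain (saturation S)" using subset_saturation[OF S] by blast
      obtain b where "(\<zero>, b) \<in> saturation S"
        using partial_graph_zero[OF S] subset_saturation[OF S] by blast
      then show "right_ideal R (Domain (saturation S))"
        using add smult by (intro right_idealI) (auto simp: sat intro: DomainI dest: add smult)
    qed
    show "x \<in> torsion" if "(\<zero>, x) \<in> saturation S" for x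
    proof (rule torsion_local)
      show "x \<in> carrier R" "pair_colon S \<zero> x \<in> \<G>"
        using that by (auto simp: sat)
    qed (auto intro: D(6))
  qed
  moreover have "(a, b) \<in> saturation S" if ab: "(a, b) \<in> saturation (saturation S)" for a b
  proof -
    have car: "a \<in> carrier R" "b \<in> carrier R"
      and K: "pair_colon (saturation S) a b \<in> \<G>"
      using ab by (auto simp: saturation_def)
    have "pair_colon S a b \<in> \<G>"
    proof (rule G_local[OF partial_graph_colon[OF S car] K])
      fix r assume r: "r \<in> pair_colon (saturation S) a b"
      then have "pair_colon S (a \<otimes> r) (b \<otimes> r) \<in> \<G>" by (simp add: sat)
      also have "pair_colon S (a \<otimes> r) (b \<otimes> r) =
          residual (pair_colon S a b) r"
        using r car by (auto simp: m_assoc)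
      finally show "residual (pair_colon S a b) r \<in> \<G>" .
    qed
    then show ?thesis using car by (simp add: sat)
  qed
  ultimately show ?thesis unfolding germ_def by auto
qed

lemma germ_saturated:
  assumes "germ S" "a \<in> carrier R" "b \<in> carrier R" "pair_colon S a b \<in> \<G>"
  shows "(a, b) \<in> S"
  using assms unfolding germ_def saturation_def by blast

text \<open>Take \<open>(a, b)\<close> in \<open>S\<close> and \<open>r\<close> with
  \<open>a r\<close> in \<open>L\<close>. The common value \<open>c\<close> at \<open>a r\<close>
  differs from \<open>b r\<close> by a value of \<open>S\<close> over zero, which is torsion. So
  \<open>(a r, b r)\<close> enters \<open>S'\<close> after multiplication by an ideal of
  \<open>\<G>\<close>. Since these \<open>r\<close> form an ideal of \<open>\<G>\<close>,
  \<open>G_local\<close> and the saturation of \<open>S'\<close> give \<open>(a, b)\<close> in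
  \<open>S'\<close>.\<close>

lemma germ_subsetI:
  assumes S: "germ S" and S': "germ S'" and L: "L \<in> \<G>"
    and common: "\<And>l. l \<in> L \<Longrightarrow> \<exists>b. (l, b) \<in> S \<and> (l, b) \<in> S'"
  shows "S \<subseteq> S'"
proof
  fix x assume "x \<in> S"
  then obtain a b where x: "x = (a, b)" and ab: "(a, b) \<in> S" by (metis surj_pair)
  have pS: "partial_graph S" and pS': "partial_graph S'" using S S' by (auto simp: germ_def)
  note D = partial_graphD[OF pS] and D' = partial_graphD[OF pS']
  have car: "a \<in> carrier R" "b \<in> carrier R" using D(1,2) ab by auto
  have "pair_colon S' a b \<in> \<G>"
  proof (rule G_local[OF partial_graph_colon[OF pS' car] G_colon[OF L car(1)]])
    fix r assume r: "r \<in> residual L a"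
    then obtain c where c: "(a \<otimes> r, c) \<in> S" "(a \<otimes> r, c) \<in> S'" using common by auto
    have cR: "c \<in> carrier R" using D(2) c(1) by blast
    have brR: "b \<otimes> r \<in> carrier R" using r car by simp
    have "(a \<otimes> r \<otimes> \<ominus> \<one>, c \<otimes> \<ominus> \<one>) \<in> S" using D(4)[OF c(1), of "\<ominus> \<one>"] by simp
    then have "(\<ominus> (a \<otimes> r), \<ominus> c) \<in> S" using cR r car by (simp add: r_minus)
    moreover have "(a \<otimes> r, b \<otimes> r) \<in> S" using D(4)[OF ab] r by simp
    ultimately have "(a \<otimes> r \<oplus> \<ominus> (a \<otimes> r), b \<otimes> r \<oplus> \<ominus> c) \<in> S" using D(3) by blast
    then have "b \<otimes> r \<oplus> \<ominus> c \<in> torsion" using r car D(6) by (simp add: r_neg)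
    then have "{s \<in> carrier R. (b \<otimes> r \<oplus> \<ominus> c) \<otimes> s = \<zero>} \<in> \<G>" by (simp add: torsion_def)
    then show "residual (pair_colon S' a b) r \<in> \<G>"
    proof (rule G_superset)
      have "right_ideal R (pair_colon S' (a \<otimes> r) (b \<otimes> r))"
        by (rule partial_graph_colon[OF pS']) (use car r in auto)
      moreover have eq: "pair_colon S' (a \<otimes> r) (b \<otimes> r) =
          residual (pair_colon S' a b) r"
        using car r by (auto simp: m_assoc)
      ultimately show "right_ideal R (residual (pair_colon S' a b) r)"
        by simp
      show "{s \<in> carrier R. (b \<otimes> r \<oplus> \<ominus> c) \<otimes> s = \<zero>}
          \<subseteq> residual (pair_colon S' a b) r"
      proof
        fix s assume s: "s \<in> {s \<in> carrier R. (b \<otimes> r \<oplus> \<ominus> c) \<otimes> s = \<zero>}"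
        then have sR: "s \<in> carrier R" and "b \<otimes> r \<otimes> s \<ominus> c \<otimes> s = \<zero>"
          using brR cR by (auto simp: l_distr l_minus a_minus_def)
        then have "b \<otimes> r \<otimes> s = c \<otimes> s" using brR cR by simp
        then have "(a \<otimes> r \<otimes> s, b \<otimes> r \<otimes> s) \<in> S'" using D'(4)[OF c(2) sR] by simp
        then show "s \<in> residual (pair_colon S' a b) r"
          using sR r eq by auto
      qed
    qed
  qed
  then show "x \<in> S'" unfolding x by (rule germ_saturated[OF S' car])
qed

text \<open>Equality of germs is equality of sets, yet it can be tested on any one ideal of
  \<open>\<G>\<close>. Most module laws below reduce in this way to identities between values in
  \<open>R\<close>.\<close>

lemma germ_eqI:
  assumes "germ S" "germ S'" "L \<in> \<G>" "\<And>l. l \<in> L \<Longrightarrow> \<exists>b. (l, b) \<in> S \<and> (l, b) \<in> S'"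
  shows "S = S'"
proof
  show "S \<subseteq> S'" using assms by (rule germ_subsetI)
  show "S' \<subseteq> S" using assms(4) by (intro germ_subsetI[OF assms(2,1,3)]) blast
qed

text \<open>The colimit of \<open>Hom(I, R/t)\<close> over \<open>I\<close> in \<open>\<G>\<close>,
  where \<open>t\<close> is the torsion of \<open>R\<close>: the classical construction of the ring
  of quotients, here only as a module. The pointwise sum lives on the common domain and has to be
  saturated again; zero is the zero map modulo \<open>t\<close>; the action is precomposition with
  left multiplication by \<open>r\<close>.\<close>

definition germ_module :: "('a, ('a \<times> 'a) set) rmod" where
  "germ_module = \<lparr>carrier = Collect germ, monoid.mult = undefined, one = undefined,
     zero = carrier R \<times> torsion,
     add = (\<lambda>S S'. saturation {(a, b \<oplus> b') | a b b'. (a, b) \<in> S \<and> (a, b') \<in> S'}),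
     ract = (\<lambda>S r. {(a, b). a \<in> carrier R \<and> (r \<otimes> a, b) \<in> S})\<rparr>"

abbreviation (input) germ_add_op (infixl "\<boxplus>" 65) where "S \<boxplus> S' \<equiv> S \<oplus>\<^bsub>germ_module\<^esub> S'"
abbreviation (input) germ_ract_op (infixl "\<boxdot>" 70) where "S \<boxdot> r \<equiv> S \<star>\<^bsub>germ_module\<^esub> r"

lemma germ_module_simps [simp]:
  "carrier germ_module = Collect germ" "\<zero>\<^bsub>germ_module\<^esub> = carrier R \<times> torsion"
  "S \<boxdot> r = {(a, b). a \<in> carrier R \<and> (r \<otimes> a, b) \<in> S}"
  by (simp_all add: germ_module_def)

lemma germ_partial_graph: "germ S \<Longrightarrow> partial_graph S"
  by (simp add: germ_def)

lemmas germD = partial_graphD[OF germ_partial_graph]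

lemma germ_add:
  assumes S: "germ S" and S': "germ S'"
  shows "germ (S \<boxplus> S')"
    and "(a, b) \<in> S \<Longrightarrow> (a, b') \<in> S' \<Longrightarrow> (a, b \<oplus> b') \<in> S \<boxplus> S'"
proof -
  note D = germD[OF S]
  note D' = germD[OF S']
  let ?P = "{(a, b \<oplus> b') | a b b'. (a, b) \<in> S \<and> (a, b') \<in> S'}"
  have eq: "S \<boxplus> S' = saturation ?P" by (simp add: germ_module_def)
  have P: "partial_graph ?P"
  proof (rule partial_graphI)
    show "?P \<subseteq> carrier R \<times> carrier R" using D(1,2) D'(2) by blast
  next
    fix a b c d assume "(a, b) \<in> ?P" "(c, d) \<in> ?P"
    then obtain b1 b2 d1 d2 where ab: "b = b1 \<oplus> b2" "(a, b1) \<in> S" "(a, b2) \<in> S'"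
      and cd: "d = d1 \<oplus> d2" "(c, d1) \<in> S" "(c, d2) \<in> S'" by auto
    have "(a \<oplus> c, b1 \<oplus> d1) \<in> S" "(a \<oplus> c, b2 \<oplus> d2) \<in> S'" using ab cd D(3) D'(3) by auto
    moreover have "b1 \<in> carrier R" "b2 \<in> carrier R" "d1 \<in> carrier R" "d2 \<in> carrier R"
      using ab cd D(2) D'(2) by auto
    then have "b \<oplus> d = (b1 \<oplus> d1) \<oplus> (b2 \<oplus> d2)" using ab cd by (simp add: a_ac)
    ultimately show "(a \<oplus> c, b \<oplus> d) \<in> ?P" by blast
  next
    fix a b r assume "(a, b) \<in> ?P" and r: "r \<in> carrier R"
    then obtain b1 b2 where ab: "b = b1 \<oplus> b2" "(a, b1) \<in> S" "(a, b2) \<in> S'" by auto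
    have "(a \<otimes> r, b1 \<otimes> r) \<in> S" "(a \<otimes> r, b2 \<otimes> r) \<in> S'" using ab r D(4) D'(4) by auto
    moreover have "b1 \<in> carrier R" "b2 \<in> carrier R" using ab D(2) D'(2) by auto
    then have "b \<otimes> r = b1 \<otimes> r \<oplus> b2 \<otimes> r" using ab r by (simp add: l_distr)
    ultimately show "(a \<otimes> r, b \<otimes> r) \<in> ?P" by blast
  next
    have "Domain ?P = Domain S \<inter> Domain S'" by blast
    then show "Domain ?P \<in> \<G>" using G_Int D(5) D'(5) by simp
  next
    show "x \<in> torsion" if "(\<zero>, x) \<in> ?P" for x
      using that D(6) D'(6) torsion_closed(3) by auto
  qed
  show "germ (S \<boxplus> S')" unfolding eq by (rule germ_saturation[OF P])
  show "(a, b \<oplus> b') \<in> S \<boxplus> S'" if "(a, b) \<in> S" "(a, b') \<in> S'"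
    unfolding eq using subset_saturation[OF P] that by blast
qed

lemma germ_zero: "germ (carrier R \<times> torsion)"
  unfolding germ_def
proof
  show "partial_graph (carrier R \<times> torsion)"
  proof (rule partial_graphI)
    have "Domain (carrier R \<times> torsion) = carrier R" using torsion_closed(2) by blast
    then show "Domain (carrier R \<times> torsion) \<in> \<G>" using G_carrier by simp
  qed (use torsion_closed in auto)
  show "saturation (carrier R \<times> torsion) \<subseteq> carrier R \<times> torsion"
  proof
    fix x assume "x \<in> saturation (carrier R \<times> torsion)"
    then obtain a b where x: "x = (a, b)" "a \<in> carrier R" "b \<in> carrier R"
      and K: "{r \<in> carrier R. (a \<otimes> r, b \<otimes> r) \<in> carrier R \<times> torsion} \<in> \<G>"
      by (auto simp: saturation_def)
    have "b \<in> torsion" by (rule torsion_local[OF x(3) K]) simp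
    then show "x \<in> carrier R \<times> torsion" using x by simp
  qed
qed

text \<open>The preimage of \<open>S\<close> under \<open>(a, b) \<mapsto> (r a, b)\<close> is
  saturated as it stands, because its ideal \<open>pair_colon\<close> at \<open>(a, b)\<close> is
  that of \<open>S\<close> at \<open>(r a, b)\<close>. Its domain lies in \<open>\<G>\<close> by
  \<open>G_colon\<close>.\<close>

lemma germ_ract:
  assumes S: "germ S" and r: "r \<in> carrier R"
  shows "germ {(a, b). a \<in> carrier R \<and> (r \<otimes> a, b) \<in> S}" (is "germ ?P")
  unfolding germ_def
proof
  note D = germD[OF S]
  show "partial_graph ?P"
  proof (rule partial_graphI)
    have "Domain ?P = residual (Domain S) r" by auto
    then show "Domain ?P \<in> \<G>" using G_colon[OF D(5) r] by simp
    show "(a \<oplus> c, b \<oplus> d) \<in> ?P" if "(a, b) \<in> ?P" "(c, d) \<in> ?P" for a b c d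
      using that r D(3)[of "r \<otimes> a" b "r \<otimes> c" d] by (simp add: r_distr)
    show "(a \<otimes> s, b \<otimes> s) \<in> ?P" if "(a, b) \<in> ?P" "s \<in> carrier R" for a b s
      using that r D(4)[of "r \<otimes> a" b s] by (simp add: m_assoc)
    show "x \<in> torsion" if "(\<zero>, x) \<in> ?P" for x
      using that r D(6) by simp
  qed (use D(2) in auto)
  show "saturation ?P \<subseteq> ?P"
  proof
    fix x assume "x \<in> saturation ?P"
    then obtain a b where x: "x = (a, b)" "a \<in> carrier R" "b \<in> carrier R"
      and K: "pair_colon ?P a b \<in> \<G>"
      by (auto simp: saturation_def)
    have "pair_colon ?P a b = pair_colon S (r \<otimes> a) b"
      using x r by (auto simp: m_assoc)
    then have "(r \<otimes> a, b) \<in> S" using germ_saturated[OF S, of "r \<otimes> a" b] x r K by simp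
    then show "x \<in> ?P" using x by simp
  qed
qed

lemma germ_module_right_module: "right_module R germ_module"
proof -
  \<comment> \<open>The action stays folded and is unfolded only through membership
    (\<open>act\<close>), so that \<open>germ_add\<close> still matches terms of the form
    \<open>S \<boxdot> r\<close>.\<close>
  note [simp del] = germ_module_simps(3)
  have act: "(a, b) \<in> S \<boxdot> r \<longleftrightarrow> a \<in> carrier R \<and> (r \<otimes> a, b) \<in> S" for a b S r
    by (simp add: germ_module_simps(3))
  have act_germ: "germ (S \<boxdot> r)" if "germ S" "r \<in> carrier R" for S r
    using germ_ract[OF that] by (simp add: germ_module_simps(3))
  have pair: "\<exists>b. (l, b) \<in> S \<and> b \<in> carrier R" if "germ S" "l \<in> Domain S" for S l
    using that germD(2)[OF that(1)] by blast
  have dom: "Domain S \<in> \<G>" if "germ S" for S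
    by (rule germD(5)[OF that])
  have assoc: "S \<boxplus> S' \<boxplus> S'' = S \<boxplus> (S' \<boxplus> S'')"
    if g: "germ S" "germ S'" "germ S''" for S S' S''
  proof (rule germ_eqI)
    show "Domain S \<inter> (Domain S' \<inter> Domain S'') \<in> \<G>" by (intro G_Int dom g)
    fix l assume l: "l \<in> Domain S \<inter> (Domain S' \<inter> Domain S'')"
    obtain b where b: "(l, b) \<in> S" "b \<in> carrier R" using pair[OF g(1), of l] l by blast
    obtain b' where b': "(l, b') \<in> S'" "b' \<in> carrier R" using pair[OF g(2), of l] l by blast
    obtain b'' where b'': "(l, b'') \<in> S''" "b'' \<in> carrier R" using pair[OF g(3), of l] l by blast
    have "(l, b \<oplus> b' \<oplus> b'') \<in> S \<boxplus> S' \<boxplus> S''"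
      by (intro germ_add(2) germ_add(1) g b b' b'')
    moreover have "(l, b \<oplus> (b' \<oplus> b'')) \<in> S \<boxplus> (S' \<boxplus> S'')"
      by (intro germ_add(2) germ_add(1) g b b' b'')
    ultimately show "\<exists>b. (l, b) \<in> S \<boxplus> S' \<boxplus> S'' \<and>
        (l, b) \<in> S \<boxplus> (S' \<boxplus> S'')"
      using b b' b'' by (auto simp: a_assoc)
  qed (intro germ_add(1) g)+
  have comm: "S \<boxplus> S' = S' \<boxplus> S"
    if g: "germ S" "germ S'" for S S'
  proof (rule germ_eqI)
    show "Domain S \<inter> Domain S' \<in> \<G>" by (intro G_Int dom g)
    fix l assume l: "l \<in> Domain S \<inter> Domain S'"
    obtain b where b: "(l, b) \<in> S" "b \<in> carrier R" using pair[OF g(1), of l] l by blast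
    obtain b' where b': "(l, b') \<in> S'" "b' \<in> carrier R" using pair[OF g(2), of l] l by blast
    show "\<exists>b. (l, b) \<in> S \<boxplus> S' \<and> (l, b) \<in> S' \<boxplus> S"
      using germ_add(2)[OF g(1,2) b(1) b'(1)] germ_add(2)[OF g(2,1) b'(1) b(1)] b b'
      by (auto simp: a_comm)
  qed (intro germ_add(1) g)+
  have zero: "\<zero>\<^bsub>germ_module\<^esub> \<boxplus> S = S" if g: "germ S" for S
  proof (rule germ_eqI)
    show "Domain S \<in> \<G>" by (rule dom[OF g(1)])
    fix l assume l: "l \<in> Domain S"
    obtain b where b: "(l, b) \<in> S" "b \<in> carrier R" using pair[OF g(1) l] by blast
    have "(l, \<zero>) \<in> carrier R \<times> torsion"
      using l G_subset[OF dom[OF g(1)]] torsion_closed(2) by auto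
    then show "\<exists>b. (l, b) \<in> \<zero>\<^bsub>germ_module\<^esub> \<boxplus> S \<and> (l, b) \<in> S"
      using germ_add(2)[OF germ_zero g(1) _ b(1), of "\<zero>"] b by (intro exI[of _ b]) auto
  qed (use germ_add(1)[OF germ_zero g(1)] g in auto)
  \<comment> \<open>The negative of \<open>S\<close> is \<open>S\<close> acted on by
    \<open>-1\<close>; where \<open>S\<close> has the value \<open>b\<close>, it has the value
    \<open>-b\<close>.\<close>
  have neg: "\<exists>y\<in>carrier germ_module. y \<boxplus> S = \<zero>\<^bsub>germ_module\<^esub>"
    if g: "germ S" for S
  proof (rule bexI)
    have n: "germ (S \<boxdot> \<ominus> \<one>)" by (rule act_germ[OF g(1)]) simp
    then show "S \<boxdot> \<ominus> \<one> \<in> carrier germ_module" by simp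
    show "S \<boxdot> \<ominus> \<one> \<boxplus> S = \<zero>\<^bsub>germ_module\<^esub>"
    proof (rule germ_eqI)
      show "Domain S \<in> \<G>" by (rule dom[OF g(1)])
      fix l assume l: "l \<in> Domain S"
      obtain b where b: "(l, b) \<in> S" "b \<in> carrier R" using pair[OF g(1) l] by blast
      have lR: "l \<in> carrier R" using l G_subset[OF dom[OF g(1)]] by auto
      have "(l \<otimes> \<ominus> \<one>, b \<otimes> \<ominus> \<one>) \<in> S"
        using germD(4)[OF g(1) b(1)] by simp
      then have "(l, \<ominus> b) \<in> S \<boxdot> \<ominus> \<one>"
        using lR b by (simp add: act l_minus r_minus)
      then have "(l, \<ominus> b \<oplus> b) \<in> S \<boxdot> \<ominus> \<one> \<boxplus> S"
        by (rule germ_add(2)[OF n g(1) _ b(1)])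
      then show "\<exists>b. (l, b) \<in> S \<boxdot> \<ominus> \<one> \<boxplus> S \<and> (l, b) \<in> \<zero>\<^bsub>germ_module\<^esub>"
        using b lR torsion_closed(2) by (intro exI[of _ "\<zero>"]) (simp add: l_neg)
    qed (use germ_zero germ_add(1)[OF n g(1)] in auto)
  qed
  have add_left: "(S \<boxplus> S') \<boxdot> r =
      S \<boxdot> r \<boxplus> S' \<boxdot> r"
    if g: "germ S" "germ S'" and r: "r \<in> carrier R" for S S' r
  proof (rule germ_eqI)
    show "residual (Domain S \<inter> Domain S') r \<in> \<G>" by (intro G_colon G_Int dom g r)
    fix l assume l: "l \<in> residual (Domain S \<inter> Domain S') r"
    obtain b where b: "(r \<otimes> l, b) \<in> S" using l by blast
    obtain b' where b': "(r \<otimes> l, b') \<in> S'" using l by blast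
    have "(l, b \<oplus> b') \<in> (S \<boxplus> S') \<boxdot> r"
      using germ_add(2)[OF g(1,2) b b'] l by (simp add: act)
    moreover have "(l, b \<oplus> b') \<in> S \<boxdot> r \<boxplus> S' \<boxdot> r"
      by (rule germ_add(2)[OF act_germ[OF g(1) r] act_germ[OF g(2) r]]) (use b b' l in \<open>auto simp: act\<close>)
    ultimately show "\<exists>b. (l, b) \<in> (S \<boxplus> S') \<boxdot> r \<and>
      (l, b) \<in> S \<boxdot> r \<boxplus> S' \<boxdot> r" by blast
  qed (intro germ_add(1) act_germ g r)+
  have one: "S \<boxdot> \<one> = S" if g: "germ S" for S
    using germD(1)[OF g(1)] by (auto simp: act)
  have add_right: "S \<boxdot> (r \<oplus> s) = S \<boxdot> r \<boxplus> S \<boxdot> s"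
    if g: "germ S" and r: "r \<in> carrier R" and s: "s \<in> carrier R" for S r s
  proof (rule germ_eqI)
    show "residual (Domain S) r \<inter> residual (Domain S) s \<in> \<G>"
      by (intro G_Int G_colon dom g r s)
    fix l assume l: "l \<in> residual (Domain S) r \<inter> residual (Domain S) s"
    obtain b where b: "(r \<otimes> l, b) \<in> S" using l by blast
    obtain b' where b': "(s \<otimes> l, b') \<in> S" using l by blast
    have "(l, b \<oplus> b') \<in> S \<boxdot> (r \<oplus> s)"
      using germD(3)[OF g(1) b b'] l r s by (simp add: act l_distr)
    moreover have "(l, b \<oplus> b') \<in> S \<boxdot> r \<boxplus> S \<boxdot> s"
      by (rule germ_add(2)[OF act_germ[OF g(1) r] act_germ[OF g(1) s]]) (use b b' l in \<open>auto simp: act\<close>)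
    ultimately show "\<exists>b. (l, b) \<in> S \<boxdot> (r \<oplus> s) \<and>
      (l, b) \<in> S \<boxdot> r \<boxplus> S \<boxdot> s" by blast
  qed (intro germ_add(1) act_germ g r s add.m_closed)+
  have act_assoc: "S \<boxdot> (r \<otimes> s) = S \<boxdot> r \<boxdot> s"
    if "r \<in> carrier R" "s \<in> carrier R" for S r s
    using that by (auto simp: act m_assoc)
  have car: "germ S" if "S \<in> carrier germ_module" for S using that by simp
  have closed: "S \<boxplus> S' \<in> carrier germ_module" "S \<boxdot> r \<in> carrier germ_module"
    "\<zero>\<^bsub>germ_module\<^esub> \<in> carrier germ_module" if "germ S" "germ S'" "r \<in> carrier R" for S S' r
    using that germ_add(1) act_germ germ_zero by auto
  show ?thesis
    \<comment> \<open>The facts \<open>closed\<close> share three hypotheses; the zero germ and the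
      zero scalar fill those that a given law does not supply.\<close>
    by (rule right_moduleI; (rule ring_axioms assoc comm zero neg add_left add_right act_assoc one
        closed(1)[OF _ _ zero_closed] closed(2)[OF _ germ_zero] closed(3)[OF germ_zero germ_zero zero_closed]);
        (erule car | assumption))
qed

text \<open>A germ \<open>c\<close> has the value \<open>b\<close> at \<open>l\<close> exactly when
  \<open>c \<boxdot> l\<close> has the value \<open>b\<close> at \<open>1\<close>. Hence a germ
  killed by \<open>I\<close> has only torsion values on the part of \<open>I\<close> in its domain,
  and a linear map \<open>f\<close> from \<open>I\<close> to germs is represented by the graph that
  assigns to \<open>i\<close> the value of \<open>f i\<close> at \<open>1\<close>.\<close>

lemma germ_module_closed: "gabriel_closed R \<G> germ_module"
  unfolding gabriel_closed_iff
proof (intro conjI ballI allI impI)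
  show "right_module R germ_module" by (rule germ_module_right_module)
  fix I assume I: "I \<in> \<G>"
  note IR = G_subset[OF I]
  show "c = \<zero>\<^bsub>germ_module\<^esub>"
    if c: "c \<in> carrier germ_module" and z: "\<forall>i\<in>I. c \<boxdot> i = \<zero>\<^bsub>germ_module\<^esub>" for c
  proof -
    have gc: "germ c" using c by simp
    note D = germD[OF gc]
    show ?thesis unfolding germ_module_simps
    proof (rule germ_eqI[OF gc germ_zero G_Int[OF I D(5)]])
      fix l assume l: "l \<in> I \<inter> Domain c"
      then obtain b where b: "(l, b) \<in> c" by blast
      then have "(\<one>, b) \<in> c \<boxdot> l" using l IR by (auto simp: subset_iff)
      then have "(\<one>, b) \<in> \<zero>\<^bsub>germ_module\<^esub>" using z l by (metis IntD1)
      then show "\<exists>b. (l, b) \<in> c \<and> (l, b) \<in> carrier R \<times> torsion"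
        using b l IR by auto
    qed
  qed
  show "\<exists>c\<in>carrier germ_module. \<forall>i\<in>I. f i = c \<boxdot> i"
    if f: "linear_map R (ideal_mod R I) germ_module f" for f
  proof -
    have fg: "germ (f i)" if "i \<in> I" for i using linear_map_closed[OF f, of i] that by simp
    have f_add: "f (i \<oplus> j) = f i \<boxplus> f j" if "i \<in> I" "j \<in> I" for i j
      using linear_map_add[OF f, of i j] that by simp
    have f_act: "f (i \<otimes> r) = {(a, b). a \<in> carrier R \<and> (r \<otimes> a, b) \<in> f i}"
      if "i \<in> I" "r \<in> carrier R" for i r
      using linear_map_ract[OF f, of i r] that by simp
    note Dg = germD[OF fg]
    have I_ideal: "\<zero> \<in> I" "\<And>i j. i \<in> I \<Longrightarrow> j \<in> I \<Longrightarrow> i \<oplus> j \<in> I"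
      "\<And>i r. i \<in> I \<Longrightarrow> r \<in> carrier R \<Longrightarrow> i \<otimes> r \<in> I"
      using G_right_ideal[OF I] unfolding right_ideal_iff by auto
    \<comment> \<open>Only those \<open>i\<close> occur whose germ \<open>f i\<close> is defined at
      \<open>1\<close>, so the domain may be smaller than \<open>I\<close>.\<close>
    define D where "D = {(i, b). i \<in> I \<and> (\<one>, b) \<in> f i}"
    \<comment> \<open>Linearity turns the value of \<open>f i\<close> at \<open>l\<close> into the
      value of \<open>f (i l)\<close> at \<open>1\<close>.\<close>
    have D_I: "(i \<otimes> l, b) \<in> D" if i: "i \<in> I" and l: "(l, b) \<in> f i" for i l b
    proof -
      have "l \<in> carrier R" using Dg(1)[OF i l] .
      then show ?thesis using i l I_ideal by (auto simp: D_def f_act)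
    qed
    have D_add: "(a \<oplus> c, b \<oplus> d) \<in> D" if "(a, b) \<in> D" "(c, d) \<in> D" for a b c d
      using that germ_add(2)[OF fg fg, of a c "\<one>" b d] I_ideal by (auto simp: D_def f_add)
    have D_act: "(a \<otimes> r, b \<otimes> r) \<in> D" if "(a, b) \<in> D" "r \<in> carrier R" for a b r
      using that Dg(4)[of a "\<one>" b r] I_ideal by (auto simp: D_def f_act)
    have D_zero: "(\<zero>, b) \<in> D \<longleftrightarrow> b \<in> torsion" for b
    proof -
      interpret I: right_module R "ideal_mod R I"
        by (rule ideal_mod_right_module[OF G_right_ideal[OF I]])
      have "f \<zero> = carrier R \<times> torsion"
        using linear_map_zero[OF I.right_module_axioms germ_module_right_module f] by simp
      then show ?thesis using I_ideal by (auto simp: D_def)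
    qed
    have "partial_graph D"
    proof (rule partial_graphI[OF _ D_add D_act])
      show "D \<subseteq> carrier R \<times> carrier R" using IR Dg(2) by (auto simp: D_def)
      show "x \<in> torsion" if "(\<zero>, x) \<in> D" for x using that D_zero by simp
      show "Domain D \<in> \<G>"
      \<comment> \<open>By \<open>D_I\<close> the domain of \<open>f i\<close> lies in
        \<open>(Domain D : i)\<close> for each \<open>i\<close> in \<open>I\<close>, so the local
        condition applies although \<open>D\<close> need not reach all of \<open>I\<close>.\<close>
      proof (rule G_local[OF _ I])
        show dom: "right_ideal R (Domain D)"
        proof (rule right_idealI)
          show "Domain D \<subseteq> carrier R" using IR by (auto simp: D_def)
          show "\<zero> \<in> Domain D" using D_zero torsion_closed(2) by blast
          show "x \<oplus> y \<in> Domain D" if "x \<in> Domain D" "y \<in> Domain D" for x y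
            using that D_add by blast
          show "x \<otimes> r \<in> Domain D" if "x \<in> Domain D" "r \<in> carrier R" for x r
            using that D_act by blast
        qed
        fix i assume i: "i \<in> I"
        show "residual (Domain D) i \<in> \<G>"
        proof (rule G_superset[OF Dg(5)[OF i]])
          show "right_ideal R (residual (Domain D) i)"
            using colon_right_ideal[OF regular_right_module, of "Domain D" i] dom i IR
            by (auto simp: right_ideal_def)
          show "Domain (f i) \<subseteq> residual (Domain D) i"
            using D_I[OF i] Dg(1)[OF i] by auto
        qed
      qed
    qed
    note pD = this
    show ?thesis
    proof (intro bexI ballI)
      have gs: "germ (saturation D)" by (rule germ_saturation[OF pD])
      then show "saturation D \<in> carrier germ_module" by simp
      fix i assume i: "i \<in> I"
      show "f i = saturation D \<boxdot> i"
        unfolding germ_module_simps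
      proof (rule germ_eqI[OF fg[OF i] germ_ract[OF gs] Dg(5)[OF i]])
        show "i \<in> carrier R" using i IR by auto
        fix l assume "l \<in> Domain (f i)"
        then obtain b where b: "(l, b) \<in> f i" by blast
        then have "(i \<otimes> l, b) \<in> saturation D" using D_I[OF i] subset_saturation[OF pD] by blast
        then show "\<exists>b. (l, b) \<in> f i \<and> (l, b) \<in> {(a, b). a \<in> carrier R \<and> (i \<otimes> a, b) \<in> saturation D}"
          using b Dg(1)[OF i b] by blast
      qed
    qed
  qed
qed

lemma diagonal_partial_graph: "partial_graph (Id_on (carrier R))"
proof (rule partial_graphI)
  have "Domain (Id_on (carrier R)) = carrier R" by auto
  then show "Domain (Id_on (carrier R)) \<in> \<G>" using G_carrier by simp
qed (auto simp: torsion_closed(2))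

text \<open>\<open>c\<close> is the germ of the identity map of \<open>R\<close>. The germ
  \<open>c x\<close> has the value \<open>x\<close> at \<open>1\<close>, so \<open>c x = 0\<close>
  makes \<open>x\<close> torsion.\<close>

lemma closed_module_detecting_torsion:
  fixes \<iota> :: "'a list set \<Rightarrow> 'u"
  assumes "inj \<iota>"
  obtains C :: "('a, 'u) rmod" and c where "gabriel_closed R \<G> C" "c \<in> carrier C"
    "\<And>x. x \<in> carrier R \<Longrightarrow> c \<star>\<^bsub>C\<^esub> x = \<zero>\<^bsub>C\<^esub> \<Longrightarrow> {r \<in> carrier R. x \<otimes> r = \<zero>} \<in> \<G>"
proof -
  \<comment> \<open>Pairs are coded as lists of length two, so that a germ becomes an element of
    \<open>'a list set\<close> and \<open>\<iota>\<close> applies.\<close>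
  define p :: "'a \<times> 'a \<Rightarrow> 'a list" where "p = (\<lambda>(a, b). [a, b])"
  define g where "g = (\<lambda>S. \<iota> (p ` S))"
  have "inj p" by (auto simp: inj_def p_def)
  then have "inj g"
    using assms by (intro injI) (simp add: g_def inj_eq inj_image_eq_iff)
  then have g: "inj_on g (carrier germ_module)" by (rule inj_on_subset) simp
  define S where "S = saturation (Id_on (carrier R))"
  have S: "S \<in> carrier germ_module" using germ_saturation[OF diagonal_partial_graph] by (simp add: S_def)
  note T = transport_simps[OF g]
  show thesis
  proof (rule that)
    show "gabriel_closed R \<G> (transport g germ_module)"
      by (rule transport_closed[OF germ_module_closed g])
    show "g S \<in> carrier (transport g germ_module)" using S by (simp add: T(1))
    fix x assume x: "x \<in> carrier R" and z: "g S \<star>\<^bsub>transport g germ_module\<^esub> x = \<zero>\<^bsub>transport g germ_module\<^esub>"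
    have "g (S \<boxdot> x) = g \<zero>\<^bsub>germ_module\<^esub>" using z by (simp only: T(2) T(4)[OF S])
    then have eq: "S \<boxdot> x = \<zero>\<^bsub>germ_module\<^esub>" using \<open>inj g\<close> by (simp only: inj_eq)
    have "(\<one>, x) \<in> S \<boxdot> x"
      using x subset_saturation[OF diagonal_partial_graph] by (auto simp: S_def)
    then have "x \<in> torsion" unfolding eq by simp
    then show "{r \<in> carrier R. x \<otimes> r = \<zero>} \<in> \<G>" by (simp add: torsion_def)
  qed
qed

end

section \<open>Extension of scalars\<close>

locale scalar_extension = R: ring R + T: ring T
  for R :: "('a, 'r) ring_scheme" and T :: "('t, 'k) ring_scheme" +
  fixes \<tau> :: "'a \<Rightarrow> 't"
  assumes \<tau>_hom: "\<tau> \<in> ring_hom R T"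
begin

lemma \<tau>_simps [simp]:
  "r \<in> carrier R \<Longrightarrow> \<tau> r \<in> carrier T"
  "r \<in> carrier R \<Longrightarrow> s \<in> carrier R \<Longrightarrow> \<tau> (r \<oplus>\<^bsub>R\<^esub> s) = \<tau> r \<oplus>\<^bsub>T\<^esub> \<tau> s"
  "r \<in> carrier R \<Longrightarrow> s \<in> carrier R \<Longrightarrow> \<tau> (r \<otimes>\<^bsub>R\<^esub> s) = \<tau> r \<otimes>\<^bsub>T\<^esub> \<tau> s"
  "\<tau> \<one>\<^bsub>R\<^esub> = \<one>\<^bsub>T\<^esub>"
  using \<tau>_hom by (auto simp: ring_hom_def Pi_iff)

abbreviation plus_T (infixl "\<oplus>\<^sub>T" 65) where "s \<oplus>\<^sub>T t \<equiv> s \<oplus>\<^bsub>T\<^esub> t"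
abbreviation minus_T (infixl "\<ominus>\<^sub>T" 65) where "s \<ominus>\<^sub>T t \<equiv> s \<ominus>\<^bsub>T\<^esub> t"
abbreviation times_T (infixl "\<otimes>\<^sub>T" 70) where "s \<otimes>\<^sub>T t \<equiv> s \<otimes>\<^bsub>T\<^esub> t"
abbreviation zero_T ("\<zero>\<^sub>T") where "\<zero>\<^sub>T \<equiv> \<zero>\<^bsub>T\<^esub>"
abbreviation one_T ("\<one>\<^sub>T") where "\<one>\<^sub>T \<equiv> \<one>\<^bsub>T\<^esub>"

abbreviation T\<^sub>R :: "('a, 't) rmod" where "T\<^sub>R \<equiv> restrict_scalars T \<tau>"

lemma T\<^sub>R_right_module: "right_module R T\<^sub>R"
  by (rule restrict_scalars_right_module[OF R.ring_axioms T.ring_axioms \<tau>_hom])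

lemma \<tau>_linear: "linear_map R (regular R) T\<^sub>R \<tau>"
  by (rule linear_mapI) auto

abbreviation relations :: "('a, 'm) rmod \<Rightarrow> ('m \<times> 't \<Rightarrow>\<^sub>0 int) set" where
  "relations M \<equiv> tensor_relations R M T \<tau>"

text \<open>The carrier of the free abelian group on \<open>M \<times> T\<close>. Calculations use
  chains modulo \<open>relations\<close>; cosets appear only in
  \<open>tensor_map_iso_iff\<close>.\<close>

definition chains :: "('a, 'm) rmod \<Rightarrow> ('m \<times> 't \<Rightarrow>\<^sub>0 int) set" where
  "chains M = {c. Poly_Mapping.keys c \<subseteq> carrier M \<times> carrier T}"

definition relation_generators :: "('a, 'm) rmod \<Rightarrow> ('m \<times> 't \<Rightarrow>\<^sub>0 int) set" where
  "relation_generators M = {frag_of (x \<oplus>\<^bsub>M\<^esub> y, t) - frag_of (x, t) - frag_of (y, t) | x y t.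
         x \<in> carrier M \<and> y \<in> carrier M \<and> t \<in> carrier T} \<union>
      {frag_of (x, s \<oplus>\<^sub>T t) - frag_of (x, s) - frag_of (x, t) | x s t.
         x \<in> carrier M \<and> s \<in> carrier T \<and> t \<in> carrier T} \<union>
      {frag_of (x \<star>\<^bsub>M\<^esub> r, t) - frag_of (x, \<tau> r \<otimes>\<^sub>T t) | x r t.
         x \<in> carrier M \<and> r \<in> carrier R \<and> t \<in> carrier T}"

lemma relations_eq:
  "relations M = generate (free_Abelian_group (carrier M \<times> carrier T)) (relation_generators M)"
  by (simp add: tensor_relations_def relation_generators_def)

lemma carrier_free_eq_chains: "carrier (free_Abelian_group (carrier M \<times> carrier T)) = chains M"
  by (auto simp: chains_def)

text \<open>The map \<open>\<alpha> \<otimes> T\<close> on chains.\<close>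

abbreviation push :: "('m \<Rightarrow> 'n) \<Rightarrow> ('m \<times> 't \<Rightarrow>\<^sub>0 int) \<Rightarrow> ('n \<times> 't \<Rightarrow>\<^sub>0 int)" where
  "push \<alpha> \<equiv> frag_extend (\<lambda>(x, t). frag_of (\<alpha> x, t))"

lemma chains_zero: "0 \<in> chains M"
  and chains_add: "c \<in> chains M \<Longrightarrow> d \<in> chains M \<Longrightarrow> c + d \<in> chains M"
  and chains_diff: "c \<in> chains M \<Longrightarrow> d \<in> chains M \<Longrightarrow> c - d \<in> chains M"
  and chains_frag_of: "x \<in> carrier M \<Longrightarrow> t \<in> carrier T \<Longrightarrow> frag_of (x, t) \<in> chains M"
  using keys_add[of c d] keys_diff[of c d] by (auto simp: chains_def)

lemma push_chains: "linear_map R M N \<alpha> \<Longrightarrow> c \<in> chains M \<Longrightarrow> push \<alpha> c \<in> chains N"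
  using keys_frag_extend[of "\<lambda>(x, t). frag_of (\<alpha> x, t)" c]
  by (fastforce simp: chains_def dest: linear_map_closed)

text \<open>\<open>h\<close> extends \<open>x \<otimes> t \<mapsto> f x t\<close> additively to
  chains. Nothing is said about other arguments, since the universal property of the free group
  controls \<open>h\<close> only there.\<close>

definition evaluates :: "('a, 'm) rmod \<Rightarrow> ('m \<Rightarrow> 't) \<Rightarrow> (('m \<times> 't \<Rightarrow>\<^sub>0 int) \<Rightarrow> 't) \<Rightarrow> bool" where
  "evaluates M f h \<longleftrightarrow> (\<forall>c\<in>chains M. h c \<in> carrier T) \<and>
     (\<forall>c\<in>chains M. \<forall>d\<in>chains M. h (c + d) = h c \<oplus>\<^sub>T h d) \<and>
     (\<forall>c\<in>chains M. \<forall>d\<in>chains M. h (c - d) = h c \<ominus>\<^sub>T h d) \<and>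
     (\<forall>x\<in>carrier M. \<forall>t\<in>carrier T. h (frag_of (x, t)) = f x \<otimes>\<^sub>T t) \<and> h 0 = \<zero>\<^sub>T"

lemma evaluatesD:
  assumes "evaluates M f h"
  shows "c \<in> chains M \<Longrightarrow> h c \<in> carrier T"
    and "c \<in> chains M \<Longrightarrow> d \<in> chains M \<Longrightarrow> h (c + d) = h c \<oplus>\<^sub>T h d"
    and "c \<in> chains M \<Longrightarrow> d \<in> chains M \<Longrightarrow> h (c - d) = h c \<ominus>\<^sub>T h d"
    and "x \<in> carrier M \<Longrightarrow> t \<in> carrier T \<Longrightarrow> h (frag_of (x, t)) = f x \<otimes>\<^sub>T t"
    and "h 0 = \<zero>\<^sub>T"
  using assms unfolding evaluates_def by simp_all

section \<open>Relations of the tensor product and evaluation of chains\<close>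

context
  fixes M :: "('a, 'm) rmod"
  assumes M: "right_module R M"
begin

interpretation M: right_module R M by (rule M)

lemma relation_generators_subset: "relation_generators M \<subseteq> chains M"
  unfolding relation_generators_def
  by (intro Un_least subsetI; clarify; intro chains_diff chains_frag_of)
    (auto simp: M.ract_closed)

lemma relations_subset: "relations M \<subseteq> chains M"
  unfolding relations_eq carrier_free_eq_chains[symmetric]
  by (rule group.generate_incl[OF group_free_Abelian_group])
    (use relation_generators_subset in \<open>simp only: carrier_free_eq_chains\<close>)

lemma relations_subgroup: "subgroup (relations M) (free_Abelian_group (carrier M \<times> carrier T))"
  unfolding relations_eq
  by (rule group.generate_is_subgroup[OF group_free_Abelian_group])
    (use relation_generators_subset in \<open>simp only: carrier_free_eq_chains\<close>)

lemma relations_zero: "0 \<in> relations M"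
  using subgroup.one_closed[OF relations_subgroup] by simp

lemma relations_add: "c \<in> relations M \<Longrightarrow> d \<in> relations M \<Longrightarrow> c + d \<in> relations M"
  using subgroup.m_closed[OF relations_subgroup] by simp

lemma relations_uminus: "c \<in> relations M \<Longrightarrow> - c \<in> relations M"
  using subgroup.m_inv_closed[OF relations_subgroup, of c] relations_subset
  by (simp add: chains_def subset_iff)

lemma relations_diff: "c \<in> relations M \<Longrightarrow> d \<in> relations M \<Longrightarrow> c - d \<in> relations M"
  using relations_add[OF _ relations_uminus] by fastforce

lemma relations_trans: "a - b \<in> relations M \<Longrightarrow> b - c \<in> relations M \<Longrightarrow> a - c \<in> relations M"
  using relations_add[of "a - b" "b - c"] by simp

lemma relations_sum: "(\<And>i. i \<in> I \<Longrightarrow> f i \<in> relations M) \<Longrightarrow> sum f I \<in> relations M"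
  by (induction I rule: infinite_finite_induct) (auto intro: relations_zero relations_add)

lemma relations_left: "x \<in> carrier M \<Longrightarrow> y \<in> carrier M \<Longrightarrow> t \<in> carrier T \<Longrightarrow>
    frag_of (x \<oplus>\<^bsub>M\<^esub> y, t) - frag_of (x, t) - frag_of (y, t) \<in> relations M"
  and relations_right: "x \<in> carrier M \<Longrightarrow> s \<in> carrier T \<Longrightarrow> t \<in> carrier T \<Longrightarrow>
    frag_of (x, s \<oplus>\<^sub>T t) - frag_of (x, s) - frag_of (x, t) \<in> relations M"
  and relations_balanced: "x \<in> carrier M \<Longrightarrow> r \<in> carrier R \<Longrightarrow> t \<in> carrier T \<Longrightarrow>
    frag_of (x \<star>\<^bsub>M\<^esub> r, t) - frag_of (x, \<tau> r \<otimes>\<^sub>T t) \<in> relations M"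
  unfolding relations_eq by (rule generate.incl, simp only: relation_generators_def, blast)+

text \<open>The inverses that \<open>generate\<close> adds to the generators are absorbed into the
  case of negation, so only the three kinds of relations need an argument. In the inductive cases
  membership in \<open>relations M\<close> is kept, because it places \<open>c\<close> and
  \<open>d\<close> among the chains.\<close>

lemma relations_induct [consumes 1, case_names zero add uminus left right balanced]:
  assumes "c \<in> relations M" and "P 0"
    and add: "\<And>c d. c \<in> relations M \<Longrightarrow> d \<in> relations M \<Longrightarrow> P c \<Longrightarrow> P d \<Longrightarrow> P (c + d)"
    and um: "\<And>c. c \<in> relations M \<Longrightarrow> P c \<Longrightarrow> P (- c)"
    and left: "\<And>x y t. x \<in> carrier M \<Longrightarrow> y \<in> carrier M \<Longrightarrow> t \<in> carrier T \<Longrightarrow>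
      P (frag_of (x \<oplus>\<^bsub>M\<^esub> y, t) - frag_of (x, t) - frag_of (y, t))"
    and right: "\<And>x s t. x \<in> carrier M \<Longrightarrow> s \<in> carrier T \<Longrightarrow> t \<in> carrier T \<Longrightarrow>
      P (frag_of (x, s \<oplus>\<^sub>T t) - frag_of (x, s) - frag_of (x, t))"
    and balanced: "\<And>x r t. x \<in> carrier M \<Longrightarrow> r \<in> carrier R \<Longrightarrow> t \<in> carrier T \<Longrightarrow>
      P (frag_of (x \<star>\<^bsub>M\<^esub> r, t) - frag_of (x, \<tau> r \<otimes>\<^sub>T t))"
  shows "P c"
proof -
  let ?H = "relation_generators M"
  let ?G = "free_Abelian_group (carrier M \<times> carrier T)"
  have gen: "P h" if "h \<in> ?H" for h
  proof -
    have "(\<exists>x y t. h = frag_of (x \<oplus>\<^bsub>M\<^esub> y, t) - frag_of (x, t) - frag_of (y, t) \<and>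
         x \<in> carrier M \<and> y \<in> carrier M \<and> t \<in> carrier T) \<or>
      (\<exists>x s t. h = frag_of (x, s \<oplus>\<^sub>T t) - frag_of (x, s) - frag_of (x, t) \<and>
         x \<in> carrier M \<and> s \<in> carrier T \<and> t \<in> carrier T) \<or>
      (\<exists>x r t. h = frag_of (x \<star>\<^bsub>M\<^esub> r, t) - frag_of (x, \<tau> r \<otimes>\<^sub>T t) \<and>
         x \<in> carrier M \<and> r \<in> carrier R \<and> t \<in> carrier T)"
      using that by (simp only: relation_generators_def Un_iff mem_Collect_eq disj_assoc)
    then show ?thesis
    proof (elim disjE exE conjE)
      fix x y t assume h: "h = frag_of (x \<oplus>\<^bsub>M\<^esub> y, t) - frag_of (x, t) - frag_of (y, t)"
        and "x \<in> carrier M" "y \<in> carrier M" "t \<in> carrier T"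
      then show ?thesis unfolding h by (intro left)
    next
      fix x s t assume h: "h = frag_of (x, s \<oplus>\<^sub>T t) - frag_of (x, s) - frag_of (x, t)"
        and "x \<in> carrier M" "s \<in> carrier T" "t \<in> carrier T"
      then show ?thesis unfolding h by (intro right)
    next
      fix x r t assume h: "h = frag_of (x \<star>\<^bsub>M\<^esub> r, t) - frag_of (x, \<tau> r \<otimes>\<^sub>T t)"
        and "x \<in> carrier M" "r \<in> carrier R" "t \<in> carrier T"
      then show ?thesis unfolding h by (intro balanced)
    qed
  qed
  have "c \<in> generate ?G ?H" using assms(1) by (simp only: relations_eq)
  then show ?thesis
  proof induction
    case (inv h)
    have hr: "h \<in> relations M" using inv unfolding relations_eq by (rule generate.incl)
    then have "Poly_Mapping.keys h \<subseteq> carrier M \<times> carrier T"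
      using relations_subset by (auto simp: chains_def)
    then have "inv\<^bsub>?G\<^esub> h = - h" by simp
    then show ?case using um[OF hr gen[OF inv]] by simp
  next
    case one
    show ?case using \<open>P 0\<close> by simp
  next
    case (incl h)
    then show ?case by (rule gen)
  next
    case (eng h k)
    have "P (h + k)" by (rule add) (use eng in \<open>simp_all only: relations_eq\<close>)
    then show ?case by simp
  qed
qed

lemma relations_finsum:
  assumes "finite A" "f \<in> A \<rightarrow> carrier M" "t \<in> carrier T"
  shows "frag_of (finsum M f A, t) - (\<Sum>i\<in>A. frag_of (f i, t)) \<in> relations M"
  using assms
proof (induction A rule: finite_induct)
  case empty
  \<comment> \<open>Since \<open>0 + 0 = 0\<close>, this generator is the negative of the chain
    \<open>(0, t)\<close>.\<close>
  have "frag_of (\<zero>\<^bsub>M\<^esub> \<oplus>\<^bsub>M\<^esub> \<zero>\<^bsub>M\<^esub>, t) - frag_of (\<zero>\<^bsub>M\<^esub>, t) - frag_of (\<zero>\<^bsub>M\<^esub>, t) \<in> relations M"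
    by (rule relations_left) (use empty in auto)
  then show ?case using relations_uminus by fastforce
next
  case (insert a A)
  have "frag_of (f a \<oplus>\<^bsub>M\<^esub> finsum M f A, t) - frag_of (f a, t) - frag_of (finsum M f A, t) \<in> relations M"
    by (rule relations_left) (use insert in auto)
  moreover have "frag_of (finsum M f A, t) - (\<Sum>i\<in>A. frag_of (f i, t)) \<in> relations M"
    using insert by auto
  ultimately have "(frag_of (f a \<oplus>\<^bsub>M\<^esub> finsum M f A, t) - frag_of (f a, t) - frag_of (finsum M f A, t)) +
      (frag_of (finsum M f A, t) - (\<Sum>i\<in>A. frag_of (f i, t))) \<in> relations M"
    by (rule relations_add)
  then show ?case using insert by (simp add: algebra_simps)
qed

lemma relations_zero_right: "x \<in> carrier M \<Longrightarrow> frag_of (x, \<zero>\<^sub>T) \<in> relations M"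
  using relations_uminus[OF relations_right[of x "\<zero>\<^sub>T" "\<zero>\<^sub>T"]] by simp

lemma relations_minus_right:
  assumes "x \<in> carrier M" "s \<in> carrier T" "t \<in> carrier T"
  shows "frag_of (x, s \<ominus>\<^sub>T t) - (frag_of (x, s) - frag_of (x, t)) \<in> relations M"
proof -
  have "s \<ominus>\<^sub>T t \<oplus>\<^sub>T t = s" using assms by (simp add: a_minus_def T.a_assoc T.l_neg)
  then have "frag_of (x, s) - frag_of (x, s \<ominus>\<^sub>T t) - frag_of (x, t) \<in> relations M"
    using relations_right[of x "s \<ominus>\<^sub>T t" t] assms by simp
  then have "- (frag_of (x, s) - frag_of (x, s \<ominus>\<^sub>T t) - frag_of (x, t)) \<in> relations M"
    by (rule relations_uminus)
  then show ?thesis by (simp add: algebra_simps)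
qed

text \<open>The map \<open>(x, t) \<mapsto> f x t\<close> is biadditive, and it is balanced because
  \<open>f\<close> is linear along \<open>\<tau>\<close>. So its extension to chains kills the
  relations.\<close>

lemma evaluation:
  assumes f: "linear_map R M T\<^sub>R f"
  obtains h where "evaluates M f h" "\<And>c. c \<in> relations M \<Longrightarrow> h c = \<zero>\<^sub>T"
proof -
  let ?G = "free_Abelian_group (carrier M \<times> carrier T)"
  have fc: "f x \<in> carrier T" if "x \<in> carrier M" for x using linear_map_closed[OF f that] by simp
  have im: "(\<lambda>(x, t). f x \<otimes>\<^sub>T t) ` (carrier M \<times> carrier T) \<subseteq> carrier (add_monoid T)"
    using fc by auto
  obtain h where h: "h \<in> hom ?G (add_monoid T)"
    and hf: "\<And>x. x \<in> carrier M \<times> carrier T \<Longrightarrow> h (frag_of x) = (\<lambda>(x, t). f x \<otimes>\<^sub>T t) x"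
    by (rule comm_group.free_Abelian_group_universal[OF T.a_comm_group im]) blast
  have cl: "h c \<in> carrier T" if "c \<in> chains M" for c
    using h that by (auto simp: hom_def Pi_iff chains_def)
  have h_add: "h (c + d) = h c \<oplus>\<^sub>T h d" if "c \<in> chains M" "d \<in> chains M" for c d
    using h that by (auto simp: hom_def chains_def)
  have zero: "h 0 = \<zero>\<^sub>T"
    using h_add[OF chains_zero chains_zero] cl[OF chains_zero] by simp
  have diff: "h (c - d) = h c \<ominus>\<^sub>T h d" if "c \<in> chains M" "d \<in> chains M" for c d
  proof -
    have "h c = h (c - d) \<oplus>\<^sub>T h d" using h_add[OF chains_diff[OF that] that(2)] by simp
    then show ?thesis
      using cl[OF chains_diff[OF that]] cl[OF that(2)] by (simp add: a_minus_def T.a_assoc T.r_neg)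
  qed
  have frag: "h (frag_of (x, t)) = f x \<otimes>\<^sub>T t" if "x \<in> carrier M" "t \<in> carrier T" for x t
    using hf[of "(x, t)"] that by simp
  have cancel: "a \<oplus>\<^sub>T b \<ominus>\<^sub>T a \<ominus>\<^sub>T b = \<zero>\<^sub>T" if "a \<in> carrier T" "b \<in> carrier T" for a b
    using that T.a_comm[of a b] by (simp add: a_minus_def T.a_assoc T.r_neg)
  have "h c = \<zero>\<^sub>T" if "c \<in> relations M" for c
    using that
  proof (induction rule: relations_induct)
    case (add c d)
    then show ?case using h_add[of c d] relations_subset by auto
  next
    case (uminus c)
    then have "c \<in> chains M" using relations_subset by auto
    then have "h (0 - c) = h 0 \<ominus>\<^sub>T h c" by (rule diff[OF chains_zero])
    then show ?case using uminus zero by (simp add: a_minus_def)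
  next
    case (left x y t)
    then show ?case
      using linear_map_add[OF f, of x y] fc
      by (simp add: diff[OF chains_diff[OF chains_frag_of chains_frag_of] chains_frag_of]
          diff[OF chains_frag_of chains_frag_of] frag T.l_distr cancel)
  next
    case (right x s t)
    then show ?case
      using fc
      by (simp add: diff[OF chains_diff[OF chains_frag_of chains_frag_of] chains_frag_of]
          diff[OF chains_frag_of chains_frag_of] frag T.r_distr cancel)
  next
    case (balanced x r t)
    then show ?case
      using linear_map_ract[OF f, of x r] fc M.ract_closed
      by (simp add: diff[OF chains_frag_of chains_frag_of] frag T.m_assoc)
  qed (rule zero)
  then show thesis using cl h_add diff frag zero that[of h] unfolding evaluates_def by blast
qed

end

section \<open>Maps induced on tensor products\<close>

lemma push_relations:
  assumes M: "right_module R M" and N: "right_module R N" and \<alpha>: "linear_map R M N \<alpha>"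
    and c: "c \<in> relations M"
  shows "push \<alpha> c \<in> relations N"
  using c
proof (induction rule: relations_induct[OF M, consumes 1, case_names zero add uminus left right balanced])
  case zero
  then show ?case using relations_zero[OF N] by simp
next
  case (add c d)
  then show ?case using relations_add[OF N] by (simp add: frag_extend_add)
next
  case (uminus c)
  then show ?case using relations_uminus[OF N] by (simp add: frag_extend_minus)
next
  case (left x y t)
  then show ?case
    using relations_left[OF N, of "\<alpha> x" "\<alpha> y" t] \<alpha>
    by (simp add: frag_extend_diff linear_map_add[OF \<alpha>] linear_map_closed[OF \<alpha>])
next
  case (right x s t)
  then show ?case
    using relations_right[OF N, of "\<alpha> x" s t] \<alpha>
    by (simp add: frag_extend_diff linear_map_closed[OF \<alpha>])
next
  case (balanced x r t)
  then show ?case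
    using relations_balanced[OF N, of "\<alpha> x" r t] \<alpha>
    by (simp add: frag_extend_diff linear_map_ract[OF \<alpha>] linear_map_closed[OF \<alpha>])
qed

text \<open>Compatibility with addition is automatic; injectivity and surjectivity on cosets are
  spelled out for representatives. All later arguments about \<open>\<alpha> \<otimes> T\<close> go
  through this criterion.\<close>

lemma tensor_map_iso_iff:
  fixes M :: "('a, 'm) rmod" and N :: "('a, 'n) rmod"
  assumes M: "right_module R M" and N: "right_module R N" and \<alpha>: "linear_map R M N \<alpha>"
  shows "tensor_map R M N T \<tau> \<alpha> \<in> iso (tensor R M T \<tau>) (tensor R N T \<tau>) \<longleftrightarrow>
    (\<forall>c\<in>chains M. push \<alpha> c \<in> relations N \<longrightarrow> c \<in> relations M) \<and>
    (\<forall>d\<in>chains N. \<exists>c\<in>chains M. d - push \<alpha> c \<in> relations N)"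
proof -
  let ?cM = "\<lambda>c. (\<lambda>h. h + c) ` relations M" and ?cN = "\<lambda>c. (\<lambda>h. h + c) ` relations N"
  have carrier_tensor: "carrier (tensor R M T \<tau>) = ?cM ` chains M" "carrier (tensor R N T \<tau>) = ?cN ` chains N"
    by (auto simp: tensor_def carrier_FactGroup r_coset_def image_iff free_Abelian_group_def chains_def)
  have coset_eq: "(\<lambda>h. h + c) ` relations L = (\<lambda>h. h + d) ` relations L \<longleftrightarrow> c - d \<in> relations L"
    if L: "right_module R L" for L :: "('a, 'l) rmod" and c d
  proof
    assume eq: "(\<lambda>h. h + c) ` relations L = (\<lambda>h. h + d) ` relations L"
    have "c \<in> (\<lambda>h. h + c) ` relations L" using relations_zero[OF L] by (intro image_eqI[of _ _ 0]) auto
    then show "c - d \<in> relations L" unfolding eq by auto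
  next
    have sub: "(\<lambda>h. h + c) ` relations L \<subseteq> (\<lambda>h. h + d) ` relations L" if "c - d \<in> relations L" for c d
    proof
      fix x assume "x \<in> (\<lambda>h. h + c) ` relations L"
      then obtain h where "h \<in> relations L" "x = h + c" by auto
      then show "x \<in> (\<lambda>h. h + d) ` relations L"
        using relations_add[OF L, of h "c - d"] that by (intro image_eqI[of _ _ "h + (c - d)"]) auto
    qed
    assume cd: "c - d \<in> relations L"
    then have "d - c \<in> relations L" using relations_uminus[OF L, of "c - d"] by simp
    with cd show "(\<lambda>h. h + c) ` relations L = (\<lambda>h. h + d) ` relations L" using sub by blast
  qed
  have mult: "(\<lambda>h. h + c) ` relations L \<otimes>\<^bsub>tensor R L T \<tau>\<^esub> (\<lambda>h. h + d) ` relations L =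
      (\<lambda>h. h + (c + d)) ` relations L"
    if L: "right_module R L" for L :: "('a, 'l) rmod" and c d
  proof -
    have "(\<lambda>h. h + c) ` relations L \<otimes>\<^bsub>tensor R L T \<tau>\<^esub> (\<lambda>h. h + d) ` relations L =
        (\<Union>h\<in>relations L. \<Union>k\<in>relations L. {h + c + (k + d)})"
      by (auto simp: tensor_def set_mult_def free_Abelian_group_def)
    also have "\<dots> = (\<lambda>h. h + (c + d)) ` relations L"
    proof (intro equalityI subsetI)
      fix x assume "x \<in> (\<Union>h\<in>relations L. \<Union>k\<in>relations L. {h + c + (k + d)})"
      then obtain h k where "h \<in> relations L" "k \<in> relations L" "x = (h + k) + (c + d)"
        by (auto simp: algebra_simps)
      then show "x \<in> (\<lambda>h. h + (c + d)) ` relations L" using relations_add[OF L] by blast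
    next
      fix x assume "x \<in> (\<lambda>h. h + (c + d)) ` relations L"
      then obtain h where "h \<in> relations L" "x = h + c + (0 + d)" by (auto simp: algebra_simps)
      then show "x \<in> (\<Union>h\<in>relations L. \<Union>k\<in>relations L. {h + c + (k + d)})"
        using relations_zero[OF L] by blast
    qed
    finally show ?thesis .
  qed
  \<comment> \<open>\<open>push \<alpha>\<close> preserves relations, so the set inside
    \<open>tensor_map\<close> is a singleton and \<open>the_elem\<close> returns its
    element.\<close>
  have map: "tensor_map R M N T \<tau> \<alpha> (?cM c) = ?cN (push \<alpha> c)" for c
  proof -
    have "(\<lambda>c. tensor_relations R N T \<tau> #>\<^bsub>free_Abelian_group (carrier N \<times> carrier T)\<^esub> push \<alpha> c) ` ?cM c
        = {?cN (push \<alpha> c)}"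
    proof -
      have "?cN (push \<alpha> (h + c)) = ?cN (push \<alpha> c)" if "h \<in> relations M" for h
        using push_relations[OF M N \<alpha> that] coset_eq[OF N] by (simp add: frag_extend_add)
      moreover have "tensor_relations R N T \<tau> #>\<^bsub>free_Abelian_group (carrier N \<times> carrier T)\<^esub> d = ?cN d" for d
        by (auto simp: r_coset_def)
      ultimately show ?thesis using relations_zero[OF M] by (auto simp: image_image)
    qed
    then show ?thesis unfolding tensor_map_def by simp
  qed
  have hom: "tensor_map R M N T \<tau> \<alpha> \<in> hom (tensor R M T \<tau>) (tensor R N T \<tau>)"
  proof (rule homI)
    show "tensor_map R M N T \<tau> \<alpha> x \<in> carrier (tensor R N T \<tau>)" if "x \<in> carrier (tensor R M T \<tau>)" for x
      using that push_chains[OF \<alpha>] unfolding carrier_tensor by (auto simp: map)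
    show "tensor_map R M N T \<tau> \<alpha> (x \<otimes>\<^bsub>tensor R M T \<tau>\<^esub> y) =
        tensor_map R M N T \<tau> \<alpha> x \<otimes>\<^bsub>tensor R N T \<tau>\<^esub> tensor_map R M N T \<tau> \<alpha> y"
      if "x \<in> carrier (tensor R M T \<tau>)" "y \<in> carrier (tensor R M T \<tau>)" for x y
      using that unfolding carrier_tensor by (auto simp only: mult[OF M] mult[OF N] map frag_extend_add)
  qed
  have inj: "inj_on (tensor_map R M N T \<tau> \<alpha>) (?cM ` chains M) \<longleftrightarrow>
      (\<forall>c\<in>chains M. push \<alpha> c \<in> relations N \<longrightarrow> c \<in> relations M)"
  proof
    assume inj: "inj_on (tensor_map R M N T \<tau> \<alpha>) (?cM ` chains M)"
    show "\<forall>c\<in>chains M. push \<alpha> c \<in> relations N \<longrightarrow> c \<in> relations M"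
    proof (intro ballI impI)
      fix c assume c: "c \<in> chains M" and r: "push \<alpha> c \<in> relations N"
      have "?cN (push \<alpha> c) = ?cN (push \<alpha> 0)" using r by (subst coset_eq[OF N]) simp
      then have "tensor_map R M N T \<tau> \<alpha> (?cM c) = tensor_map R M N T \<tau> \<alpha> (?cM 0)"
        unfolding map .
      then have "?cM c = ?cM 0" by (rule inj_onD[OF inj]) (use c chains_zero in blast)+
      then show "c \<in> relations M" using coset_eq[OF M, of c 0] by simp
    qed
  next
    assume *: "\<forall>c\<in>chains M. push \<alpha> c \<in> relations N \<longrightarrow> c \<in> relations M"
    show "inj_on (tensor_map R M N T \<tau> \<alpha>) (?cM ` chains M)"
    proof (rule inj_onI)
      fix x y assume "x \<in> ?cM ` chains M" "y \<in> ?cM ` chains M"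
        and eq: "tensor_map R M N T \<tau> \<alpha> x = tensor_map R M N T \<tau> \<alpha> y"
      then obtain c d where x: "x = ?cM c" "c \<in> chains M" and y: "y = ?cM d" "d \<in> chains M" by blast
      have "push \<alpha> (c - d) \<in> relations N"
        using eq coset_eq[OF N] unfolding x(1) y(1) map by (simp add: frag_extend_diff)
      then have "c - d \<in> relations M" using * chains_diff[OF x(2) y(2)] by blast
      then show "x = y" unfolding x(1) y(1) by (simp add: coset_eq[OF M])
    qed
  qed
  have surj: "tensor_map R M N T \<tau> \<alpha> ` ?cM ` chains M = ?cN ` chains N \<longleftrightarrow>
      (\<forall>d\<in>chains N. \<exists>c\<in>chains M. d - push \<alpha> c \<in> relations N)"
  proof -
    have "tensor_map R M N T \<tau> \<alpha> ` ?cM ` chains M \<subseteq> ?cN ` chains N"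
      using push_chains[OF \<alpha>] by (auto simp: map)
    then have "tensor_map R M N T \<tau> \<alpha> ` ?cM ` chains M = ?cN ` chains N \<longleftrightarrow>
        (\<forall>d\<in>chains N. ?cN d \<in> tensor_map R M N T \<tau> \<alpha> ` ?cM ` chains M)" by blast
    also have "\<dots> \<longleftrightarrow> (\<forall>d\<in>chains N. \<exists>c\<in>chains M. d - push \<alpha> c \<in> relations N)"
      unfolding image_image map by (simp only: image_iff coset_eq[OF N])
    finally show ?thesis .
  qed
  show ?thesis
    using hom inj surj unfolding iso_def bij_betw_def carrier_tensor by blast
qed

end

section \<open>Linear maps into \<open>T\<close> and the maps that \<open>T\<close> inverts\<close>

context scalar_extension
begin

lemma chains_induct [consumes 1, case_names zero diff frag_of]:
  assumes "c \<in> chains M" and "P 0"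
    and diff: "\<And>c d. c \<in> chains M \<Longrightarrow> d \<in> chains M \<Longrightarrow> P c \<Longrightarrow> P d \<Longrightarrow> P (c - d)"
    and gen: "\<And>x t. x \<in> carrier M \<Longrightarrow> t \<in> carrier T \<Longrightarrow> P (frag_of (x, t))"
  shows "P c"
proof -
  have "Poly_Mapping.keys c \<subseteq> carrier M \<times> carrier T" using assms(1) by (simp add: chains_def)
  then show ?thesis
  proof (rule free_Abelian_group_induct)
    show "P 0" by (rule \<open>P 0\<close>)
    show "P (x - y)" if "Poly_Mapping.keys x \<subseteq> carrier M \<times> carrier T"
      "Poly_Mapping.keys y \<subseteq> carrier M \<times> carrier T" "P x" "P y" for x y
      using that by (intro diff) (simp_all add: chains_def)
    show "P (frag_of a)" if "a \<in> carrier M \<times> carrier T" for a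
      using that gen by (cases a) simp
  qed
qed

text \<open>Right multiplication by \<open>s\<close> on \<open>M \<otimes> T\<close>, at the level
  of chains. It recovers the \<open>T\<close>-module structure that the group \<open>tensor\<close>
  does not record.\<close>

abbreviation twist :: "'t \<Rightarrow> ('m \<times> 't \<Rightarrow>\<^sub>0 int) \<Rightarrow> ('m \<times> 't \<Rightarrow>\<^sub>0 int)" where
  "twist s \<equiv> frag_extend (\<lambda>(x, t). frag_of (x, t \<otimes>\<^sub>T s))"

lemma twist_chains:
  assumes "s \<in> carrier T" "c \<in> chains M"
  shows "twist s c \<in> chains M"
  using assms(2)
  by (induction rule: chains_induct)
    (use assms(1) in \<open>auto simp: frag_extend_diff chains_zero intro: chains_diff chains_frag_of\<close>)

lemma twist_push:
  assumes "c \<in> chains M"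
  shows "twist s (push \<alpha> c) = push \<alpha> (twist s c)"
  using assms by (induction rule: chains_induct) (auto simp: frag_extend_diff)

lemma twist_relations:
  assumes M: "right_module R M" and s: "s \<in> carrier T" and c: "c \<in> relations M"
  shows "twist s c \<in> relations M"
  using c
proof (induction rule: relations_induct[OF M, consumes 1, case_names zero add uminus left right balanced])
  case zero
  then show ?case using relations_zero[OF M] by simp
next
  case (add c d)
  then show ?case using relations_add[OF M] by (simp add: frag_extend_add)
next
  case (uminus c)
  then show ?case using relations_uminus[OF M] by (simp add: frag_extend_minus)
next
  case (left x y t)
  then show ?case using relations_left[OF M, of x y "t \<otimes>\<^sub>T s"] s by (simp add: frag_extend_diff)
next
  case (right x u t)
  then show ?case
    using relations_right[OF M, of x "u \<otimes>\<^sub>T s" "t \<otimes>\<^sub>T s"] s by (simp add: frag_extend_diff T.l_distr)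
next
  case (balanced x r t)
  then show ?case
    using relations_balanced[OF M, of x r "t \<otimes>\<^sub>T s"] s by (simp add: frag_extend_diff T.m_assoc)
qed

text \<open>This is \<open>Hom\<^sub>R(M, T) = Hom\<^sub>T(M \<otimes> T, T)\<close> in elementary form: the value of the extension at \<open>p\<close> is
  read off from the preimage of \<open>p \<otimes> 1\<close>.\<close>

lemma extension_along_inverted:
  fixes M :: "('a, 'm) rmod" and N :: "('a, 'n) rmod"
  assumes M: "right_module R M" and N: "right_module R N" and \<alpha>: "linear_map R M N \<alpha>"
    and iso: "tensor_map R M N T \<tau> \<alpha> \<in> iso (tensor R M T \<tau>) (tensor R N T \<tau>)"
    and f: "linear_map R M T\<^sub>R f"
  obtains g where "linear_map R N T\<^sub>R g" "\<And>y. y \<in> carrier M \<Longrightarrow> g (\<alpha> y) = f y"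
proof -
  interpret M: right_module R M by fact
  interpret N: right_module R N by fact
  have inj: "c \<in> relations M" if "c \<in> chains M" "push \<alpha> c \<in> relations N" for c
    using iso that unfolding tensor_map_iso_iff[OF M N \<alpha>] by blast
  have surj: "\<exists>c\<in>chains M. d - push \<alpha> c \<in> relations N" if "d \<in> chains N" for d
    using iso that unfolding tensor_map_iso_iff[OF M N \<alpha>] by blast
  obtain h where ev: "evaluates M f h" and h_rel: "\<And>c. c \<in> relations M \<Longrightarrow> h c = \<zero>\<^sub>T"
    by (rule evaluation[OF M f]) blast
  note hc = evaluatesD(1)[OF ev] and h_add = evaluatesD(2)[OF ev] and h_diff = evaluatesD(3)[OF ev]
    and h_frag = evaluatesD(4)[OF ev] and h_zero = evaluatesD(5)[OF ev]
  have fc: "f x \<in> carrier T" if "x \<in> carrier M" for x using linear_map_closed[OF f that] by simp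
  \<comment> \<open>Evaluation is linear over \<open>T\<close>, not merely additive; this will make
    the extension \<open>R\<close>-linear.\<close>
  have h_twist: "h (twist s c) = h c \<otimes>\<^sub>T s" if s: "s \<in> carrier T" and c: "c \<in> chains M" for s c
    using c
  proof (induction rule: chains_induct)
    case zero
    then show ?case using s by (simp add: h_zero)
  next
    case (diff c d)
    then show ?case
      using s hc by (simp add: frag_extend_diff h_diff twist_chains a_minus_def T.l_distr T.l_minus)
  next
    case (frag_of x t)
    then show ?case using s fc by (simp add: h_frag T.m_assoc)
  qed
  \<comment> \<open>\<open>c\<close> represents a preimage of \<open>p \<otimes> 1\<close>.
    Surjectivity provides one, and injectivity makes \<open>h c\<close> independent of the
    choice.\<close>
  define good where "good = (\<lambda>p c. c \<in> chains M \<and> frag_of (p, \<one>\<^sub>T) - push \<alpha> c \<in> relations N)"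
  have ex: "\<exists>c. good p c" if "p \<in> carrier N" for p
    using surj[OF chains_frag_of[OF that T.one_closed]] unfolding good_def by blast
  have uniq: "h c = h d" if "good p c" "good p d" for p c d
  proof -
    have cd: "c \<in> chains M" "d \<in> chains M" using that by (auto simp: good_def)
    have "(frag_of (p, \<one>\<^sub>T) - push \<alpha> d) - (frag_of (p, \<one>\<^sub>T) - push \<alpha> c) \<in> relations N"
      using that by (intro relations_diff[OF N, of "_ - _" "_ - _"]) (simp_all add: good_def)
    then have "push \<alpha> (c - d) \<in> relations N" by (simp add: frag_extend_diff)
    then have "h (c - d) = \<zero>\<^sub>T" using inj chains_diff[OF cd] h_rel by blast
    then show ?thesis using h_diff[OF cd] hc cd by simp
  qed
  define g where "g = (\<lambda>p. h (SOME c. good p c))"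
  have g: "g p = h c" if "good p c" for p c
    unfolding g_def by (rule uniq[OF someI[of "good p", OF that] that])
  show thesis
  proof (rule that)
    show "linear_map R N T\<^sub>R g"
    proof (rule linear_mapI; simp)
      fix p assume p: "p \<in> carrier N"
      obtain c where c: "good p c" using ex[OF p] by blast
      have cc: "c \<in> chains M" using c by (simp add: good_def)
      show "g p \<in> carrier T" using g[OF c] hc[OF cc] by simp
      show "g (p \<oplus>\<^bsub>N\<^esub> q) = g p \<oplus>\<^sub>T g q" if q: "q \<in> carrier N" for q
      proof -
        obtain d where d: "good q d" using ex[OF q] by blast
        have dc: "d \<in> chains M" using d by (simp add: good_def)
        have "frag_of (p \<oplus>\<^bsub>N\<^esub> q, \<one>\<^sub>T) - frag_of (p, \<one>\<^sub>T) - frag_of (q, \<one>\<^sub>T) \<in> relations N"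
          by (rule relations_left[OF N p q T.one_closed])
        moreover have "(frag_of (p, \<one>\<^sub>T) - push \<alpha> c) + (frag_of (q, \<one>\<^sub>T) - push \<alpha> d) \<in> relations N"
          using c d by (intro relations_add[OF N]) (auto simp: good_def)
        ultimately have "(frag_of (p \<oplus>\<^bsub>N\<^esub> q, \<one>\<^sub>T) - frag_of (p, \<one>\<^sub>T) - frag_of (q, \<one>\<^sub>T)) +
            ((frag_of (p, \<one>\<^sub>T) - push \<alpha> c) + (frag_of (q, \<one>\<^sub>T) - push \<alpha> d)) \<in> relations N"
          by (rule relations_add[OF N])
        then have "frag_of (p \<oplus>\<^bsub>N\<^esub> q, \<one>\<^sub>T) - push \<alpha> (c + d) \<in> relations N"
          by (simp add: frag_extend_add algebra_simps)
        then have "good (p \<oplus>\<^bsub>N\<^esub> q) (c + d)" using chains_add[OF cc dc] by (simp add: good_def)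
        then show ?thesis using g c d h_add[OF cc dc] by simp
      qed
      \<comment> \<open>Since \<open>p r \<otimes> 1 = p \<otimes> \<tau> r\<close>, twisting a
        preimage of \<open>p \<otimes> 1\<close> by \<open>\<tau> r\<close> gives a preimage of
        \<open>p r \<otimes> 1\<close>.\<close>
      show "g (p \<star>\<^bsub>N\<^esub> r) = g p \<otimes>\<^sub>T \<tau> r" if r: "r \<in> carrier R" for r
      proof -
        have \<tau>r: "\<tau> r \<in> carrier T" using r by simp
        have "frag_of (p \<star>\<^bsub>N\<^esub> r, \<one>\<^sub>T) - frag_of (p, \<tau> r) \<in> relations N"
          using relations_balanced[OF N p r T.one_closed] \<tau>r by simp
        moreover have "twist (\<tau> r) (frag_of (p, \<one>\<^sub>T) - push \<alpha> c) \<in> relations N"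
          using c by (intro twist_relations[OF N \<tau>r]) (simp add: good_def)
        then have "frag_of (p, \<tau> r) - push \<alpha> (twist (\<tau> r) c) \<in> relations N"
          using \<tau>r by (simp add: frag_extend_diff twist_push[OF cc])
        ultimately have "good (p \<star>\<^bsub>N\<^esub> r) (twist (\<tau> r) c)"
          using relations_trans[OF N] twist_chains[OF \<tau>r cc] unfolding good_def by blast
        then show ?thesis using g[OF c] g h_twist[OF \<tau>r cc] by simp
      qed
    qed
    fix y assume y: "y \<in> carrier M"
    have "good (\<alpha> y) (frag_of (y, \<one>\<^sub>T))"
      using chains_frag_of[OF y T.one_closed] relations_zero[OF N] by (simp add: good_def)
    then show "g (\<alpha> y) = f y" using g h_frag[OF y T.one_closed] fc[OF y] by simp
  qed
qed

lemma evaluates_push: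
  fixes M :: "('a, 'm) rmod" and N :: "('a, 'n) rmod"
  assumes \<alpha>: "linear_map R M N \<alpha>" and e: "evaluates N g e"
    and h: "evaluates M (\<lambda>x. g (\<alpha> x)) h" and c: "c \<in> chains M"
  shows "e (push \<alpha> c) = h c"
  using c
proof (induction rule: chains_induct)
  case zero
  then show ?case by (simp add: evaluatesD(5)[OF e] evaluatesD(5)[OF h])
next
  case (diff c d)
  then show ?case
    by (simp add: frag_extend_diff evaluatesD(3)[OF e] evaluatesD(3)[OF h] push_chains[OF \<alpha>])
next
  case (frag_of x t)
  then show ?case
    by (simp add: evaluatesD(4)[OF e] evaluatesD(4)[OF h] linear_map_closed[OF \<alpha>])
qed

text \<open>The element \<open>p \<otimes> 1\<close> comes from some \<open>c\<close> in
  \<open>M \<otimes> T\<close>. Evaluating \<open>g\<close> on it amounts to evaluating the zero map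
  \<open>g \<alpha>\<close> on \<open>c\<close>.\<close>

lemma unique_along_inverted:
  fixes M :: "('a, 'm) rmod" and N :: "('a, 'n) rmod"
  assumes M: "right_module R M" and N: "right_module R N" and \<alpha>: "linear_map R M N \<alpha>"
    and iso: "tensor_map R M N T \<tau> \<alpha> \<in> iso (tensor R M T \<tau>) (tensor R N T \<tau>)"
    and g: "linear_map R N T\<^sub>R g" and zero: "\<And>y. y \<in> carrier M \<Longrightarrow> g (\<alpha> y) = \<zero>\<^sub>T"
    and p: "p \<in> carrier N"
  shows "g p = \<zero>\<^sub>T"
proof -
  have d: "frag_of (p, \<one>\<^sub>T) \<in> chains N" (is "?d \<in> _") by (rule chains_frag_of[OF p T.one_closed])
  then obtain c where c: "c \<in> chains M" "?d - push \<alpha> c \<in> relations N"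
    using iso unfolding tensor_map_iso_iff[OF M N \<alpha>] by blast
  obtain e where e: "evaluates N g e" and e_rel: "\<And>c. c \<in> relations N \<Longrightarrow> e c = \<zero>\<^sub>T"
    by (rule evaluation[OF N g]) blast
  note pc = push_chains[OF \<alpha> c(1)]
  have "evaluates M (\<lambda>x. g (\<alpha> x)) (\<lambda>_. \<zero>\<^sub>T)"
    by (auto simp: evaluates_def zero a_minus_def)
  then have "e (push \<alpha> c) = \<zero>\<^sub>T" by (rule evaluates_push[OF \<alpha> e _ c(1)])
  moreover have "e ?d \<ominus>\<^sub>T e (push \<alpha> c) = \<zero>\<^sub>T"
    using e_rel[OF c(2)] evaluatesD(3)[OF e d pc] by simp
  then have "e ?d = e (push \<alpha> c)" using evaluatesD(1)[OF e d] evaluatesD(1)[OF e pc] by simp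
  ultimately show ?thesis
    using evaluatesD(4)[OF e p T.one_closed] linear_map_closed[OF g p] by simp
qed

text \<open>The dual basis expands each \<open>c\<close> in \<open>M \<otimes> T\<close> as the sum
  of the \<open>x k \<otimes> H k c\<close>, where \<open>H k\<close> is the evaluation of
  \<open>\<tau> (\<phi> k)\<close>. Since these functionals extend along \<open>\<alpha>\<close>,
  the coordinates \<open>H k c\<close> depend only on the image of \<open>c\<close> in
  \<open>N \<otimes> T\<close>; if the image vanishes, so does \<open>c\<close>. Surjectivity
  extends additively from pure tensors.\<close>

lemma tensor_map_isoI:
  fixes M :: "('a, 'm) rmod" and N :: "('a, 'n) rmod" and n :: nat
  assumes M: "right_module R M" and N: "right_module R N" and \<alpha>: "linear_map R M N \<alpha>"
    and surj: "\<And>p t. p \<in> carrier N \<Longrightarrow> t \<in> carrier T \<Longrightarrow>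
      \<exists>c\<in>chains M. frag_of (p, t) - push \<alpha> c \<in> relations N"
    and x: "\<And>k. k < n \<Longrightarrow> x k \<in> carrier M"
    and \<phi>: "\<And>k. k < n \<Longrightarrow> linear_map R M (regular R) (\<phi> k)"
    and dual_basis: "\<And>m. m \<in> carrier M \<Longrightarrow> finsum M (\<lambda>k. x k \<star>\<^bsub>M\<^esub> \<phi> k m) {..<n} = m"
    and ext: "\<And>k. k < n \<Longrightarrow>
      \<exists>g. linear_map R N T\<^sub>R g \<and> (\<forall>y\<in>carrier M. g (\<alpha> y) = \<tau> (\<phi> k y))"
  shows "tensor_map R M N T \<tau> \<alpha> \<in> iso (tensor R M T \<tau>) (tensor R N T \<tau>)"
  unfolding tensor_map_iso_iff[OF M N \<alpha>]
proof
  interpret M: right_module R M by fact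
  show "\<forall>d\<in>chains N. \<exists>c\<in>chains M. d - push \<alpha> c \<in> relations N"
  proof
    fix d assume "d \<in> chains N"
    then show "\<exists>c\<in>chains M. d - push \<alpha> c \<in> relations N"
    proof (induction rule: chains_induct)
      case zero
      show ?case using chains_zero relations_zero[OF N] by (intro bexI[of _ 0]) auto
    next
      case (diff d d')
      then obtain c c' where c: "c \<in> chains M" "d - push \<alpha> c \<in> relations N"
        "c' \<in> chains M" "d' - push \<alpha> c' \<in> relations N" by blast
      then have "(d - push \<alpha> c) - (d' - push \<alpha> c') \<in> relations N" by (intro relations_diff[OF N, of "d - _" "d' - _"])
      then have "(d - d') - push \<alpha> (c - c') \<in> relations N"
        by (simp add: frag_extend_diff algebra_simps)
      then show ?case using chains_diff[OF c(1,3)] by blast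
    qed (rule surj)
  qed
  show "\<forall>c\<in>chains M. push \<alpha> c \<in> relations N \<longrightarrow> c \<in> relations M"
  proof (intro ballI impI)
    fix c assume c: "c \<in> chains M" and push: "push \<alpha> c \<in> relations N"
    \<comment> \<open>The coordinate of \<open>c\<close> is read off from
      \<open>push \<alpha> c\<close>, which is a relation and so evaluates to zero.\<close>
    have "\<exists>h. evaluates M (\<lambda>m. \<tau> (\<phi> k m)) h \<and> h c = \<zero>\<^sub>T" if k: "k < n" for k
    proof -
      obtain g where g: "linear_map R N T\<^sub>R g" and g\<alpha>: "\<And>y. y \<in> carrier M \<Longrightarrow> g (\<alpha> y) = \<tau> (\<phi> k y)"
        using ext[OF k] by blast
      obtain h where h: "evaluates M (\<lambda>m. \<tau> (\<phi> k m)) h"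
        by (rule evaluation[OF M linear_map_compose[OF \<phi>[OF k] \<tau>_linear]]) blast
      obtain e where e: "evaluates N g e" and e_rel: "\<And>c. c \<in> relations N \<Longrightarrow> e c = \<zero>\<^sub>T"
        by (rule evaluation[OF N g]) blast
      have "evaluates M (\<lambda>x. g (\<alpha> x)) h" using h by (simp add: evaluates_def g\<alpha>)
      then have "h c = e (push \<alpha> c)" using evaluates_push[OF \<alpha> e _ c] by simp
      then show ?thesis using h e_rel[OF push] by auto
    qed
    then have "\<exists>H. \<forall>k. k < n \<longrightarrow> evaluates M (\<lambda>m. \<tau> (\<phi> k m)) (H k) \<and> H k c = \<zero>\<^sub>T"
      by (intro choice) blast
    then obtain H where H: "\<And>k. k < n \<Longrightarrow> evaluates M (\<lambda>m. \<tau> (\<phi> k m)) (H k)"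
      and Hc: "\<And>k. k < n \<Longrightarrow> H k c = \<zero>\<^sub>T" by blast
    \<comment> \<open>The expansion in the dual basis. Both sides are additive in \<open>c\<close>
      modulo relations; for a pure tensor \<open>m \<otimes> t\<close> the scalars
      \<open>\<phi> k m\<close> move across the tensor sign.\<close>
    have "c - (\<Sum>k<n. frag_of (x k, H k c)) \<in> relations M"
      using c
    proof (induction rule: chains_induct)
      case zero
      have "(\<Sum>k<n. frag_of (x k, H k 0)) \<in> relations M"
        by (intro relations_sum[OF M]) (simp add: evaluatesD(5)[OF H] relations_zero_right[OF M] x)
      then show ?case using relations_uminus[OF M] by simp
    next
      case (diff c d)
      have "(\<Sum>k<n. frag_of (x k, H k (c - d)) - (frag_of (x k, H k c) - frag_of (x k, H k d))) \<in> relations M"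
      proof (rule relations_sum[OF M])
        fix k assume "k \<in> {..<n}"
        then have k: "k < n" by simp
        show "frag_of (x k, H k (c - d)) - (frag_of (x k, H k c) - frag_of (x k, H k d)) \<in> relations M"
          using relations_minus_right[OF M x[OF k] evaluatesD(1)[OF H[OF k]] evaluatesD(1)[OF H[OF k]]] diff
          by (simp add: evaluatesD(3)[OF H[OF k]])
      qed
      then have "(c - (\<Sum>k<n. frag_of (x k, H k c))) - (d - (\<Sum>k<n. frag_of (x k, H k d))) -
          (\<Sum>k<n. frag_of (x k, H k (c - d)) - (frag_of (x k, H k c) - frag_of (x k, H k d))) \<in> relations M"
        by (rule relations_diff[OF M relations_diff[OF M diff.IH]])
      then show ?case by (simp add: sum_subtractf sum.distrib algebra_simps)

    next
      case (frag_of m t)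
      have \<phi>c: "\<phi> k m \<in> carrier R" if "k < n" for k
        using linear_map_closed[OF \<phi>[OF that] frag_of(1)] by simp
      have "frag_of (m, t) - (\<Sum>k<n. frag_of (x k \<star>\<^bsub>M\<^esub> \<phi> k m, t)) \<in> relations M"
        using relations_finsum[OF M, of "{..<n}" "\<lambda>k. x k \<star>\<^bsub>M\<^esub> \<phi> k m" t] frag_of x \<phi>c
        by (simp add: dual_basis M.ract_closed Pi_iff)
      moreover have "(\<Sum>k<n. frag_of (x k \<star>\<^bsub>M\<^esub> \<phi> k m, t) - frag_of (x k, H k (frag_of (m, t)))) \<in> relations M"
      proof (rule relations_sum[OF M])
        fix k assume "k \<in> {..<n}"
        then have k: "k < n" by simp
        show "frag_of (x k \<star>\<^bsub>M\<^esub> \<phi> k m, t) - frag_of (x k, H k (frag_of (m, t))) \<in> relations M"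
          using relations_balanced[OF M x[OF k] \<phi>c[OF k] frag_of(2)]
          by (simp add: evaluatesD(4)[OF H[OF k] frag_of])
      qed
      ultimately have "(frag_of (m, t) - (\<Sum>k<n. frag_of (x k \<star>\<^bsub>M\<^esub> \<phi> k m, t))) +
          (\<Sum>k<n. frag_of (x k \<star>\<^bsub>M\<^esub> \<phi> k m, t) - frag_of (x k, H k (frag_of (m, t)))) \<in> relations M"
        by (rule relations_add[OF M])
      then show ?case by (simp add: sum_subtractf)
    qed
    moreover have "(\<Sum>k<n. frag_of (x k, H k c)) \<in> relations M"
      by (intro relations_sum[OF M]) (simp add: Hc relations_zero_right[OF M] x)
    ultimately have "(c - (\<Sum>k<n. frag_of (x k, H k c))) + (\<Sum>k<n. frag_of (x k, H k c)) \<in> relations M"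
      by (rule relations_add[OF M])
    then show "c \<in> relations M" by simp
  qed
qed

end

section \<open>Dual bases\<close>

lemma (in right_module) finsum_ract:
  assumes "finite A" "f \<in> A \<rightarrow> carrier M" "r \<in> carrier R"
  shows "finsum M f A \<star>\<^bsub>M\<^esub> r = finsum M (\<lambda>i. f i \<star>\<^bsub>M\<^esub> r) A"
  using assms by (induction A rule: finite_induct) (auto simp: ract_add_left ract_closed Pi_iff)

lemma (in right_module) finite_combination_linear_map:
  assumes x: "\<And>k. k < n \<Longrightarrow> x k \<in> carrier M"
  shows "linear_map R (free_rmod R n) M (\<lambda>v. finsum M (\<lambda>k. x k \<star>\<^bsub>M\<^esub> v k) {..<n})"
proof (rule linear_mapI)
  have cl: "(\<lambda>k. x k \<star>\<^bsub>M\<^esub> v k) \<in> {..<n} \<rightarrow> carrier M" if "v \<in> carrier (free_rmod R n)" for v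
    using that x by (auto simp: PiE_iff ract_closed)
  fix v assume v: "v \<in> carrier (free_rmod R n)"
  show "finsum M (\<lambda>k. x k \<star>\<^bsub>M\<^esub> v k) {..<n} \<in> carrier M" by (rule M.finsum_closed[OF cl[OF v]])
  show "finsum M (\<lambda>k. x k \<star>\<^bsub>M\<^esub> (v \<oplus>\<^bsub>free_rmod R n\<^esub> w) k) {..<n} =
      finsum M (\<lambda>k. x k \<star>\<^bsub>M\<^esub> v k) {..<n} \<oplus>\<^bsub>M\<^esub> finsum M (\<lambda>k. x k \<star>\<^bsub>M\<^esub> w k) {..<n}"
    if w: "w \<in> carrier (free_rmod R n)" for w
  proof -
    have "finsum M (\<lambda>k. x k \<star>\<^bsub>M\<^esub> (v \<oplus>\<^bsub>free_rmod R n\<^esub> w) k) {..<n} =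
        finsum M (\<lambda>k. x k \<star>\<^bsub>M\<^esub> v k \<oplus>\<^bsub>M\<^esub> x k \<star>\<^bsub>M\<^esub> w k) {..<n}"
      using v w x cl[OF v] cl[OF w] by (intro M.finsum_cong') (auto simp: PiE_iff ract_add_right)
    then show ?thesis using M.finsum_addf[OF cl[OF v] cl[OF w]] by simp
  qed
  show "finsum M (\<lambda>k. x k \<star>\<^bsub>M\<^esub> (v \<star>\<^bsub>free_rmod R n\<^esub> r) k) {..<n} =
      finsum M (\<lambda>k. x k \<star>\<^bsub>M\<^esub> v k) {..<n} \<star>\<^bsub>M\<^esub> r" if r: "r \<in> carrier R" for r
    unfolding finsum_ract[OF finite_lessThan cl[OF v] r]
    using v r x by (intro M.finsum_cong') (auto simp: PiE_iff ract_assoc ract_closed)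
qed

lemma (in right_module) finitely_generated_cover:
  assumes "finitely_generated R M"
  obtains n :: nat and x where "\<And>k. k < n \<Longrightarrow> x k \<in> carrier M"
    "(\<lambda>v. finsum M (\<lambda>k. x k \<star>\<^bsub>M\<^esub> v k) {..<n}) ` carrier (free_rmod R n) = carrier M"
proof -
  from assms obtain X where "finite X \<and> X \<subseteq> carrier M \<and>
      (\<forall>N. right_submodule R M N \<and> X \<subseteq> N \<longrightarrow> N = carrier M)"
    unfolding finitely_generated_def ..
  then have X: "finite X" "X \<subseteq> carrier M"
    and gen: "\<And>N. right_submodule R M N \<Longrightarrow> X \<subseteq> N \<Longrightarrow> N = carrier M"
    by simp_all
  obtain x where "bij_betw x {0..<card X} X" using ex_bij_betw_nat_finite[OF X(1)] by blast
  then have im: "x ` {..<card X} = X" by (simp add: bij_betw_def atLeast0LessThan)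
  then have x: "x k \<in> carrier M" if "k < card X" for k using that X(2) by blast
  let ?p = "\<lambda>v. finsum M (\<lambda>k. x k \<star>\<^bsub>M\<^esub> v k) {..<card X}"
  let ?F = "free_rmod R (card X)"
  have F: "right_module R ?F" by (rule R.free_rmod_right_module)
  have "right_submodule R M (?p ` carrier ?F)"
    by (rule linear_image_submodule[OF F right_module_axioms finite_combination_linear_map[OF x]
          right_module.carrier_submodule[OF F]])
  moreover have "X \<subseteq> ?p ` carrier ?F"
  proof
    fix y assume "y \<in> X"
    then obtain j where j: "j < card X" "y = x j" using im by blast
    \<comment> \<open>The unit vector at \<open>j\<close>, which is sent to the generator
      \<open>x j\<close>.\<close>
    let ?e = "\<lambda>k\<in>{..<card X}. if j = k then \<one> else \<zero>"
    have "?p ?e = finsum M (\<lambda>k. if j = k then x k else \<zero>\<^bsub>M\<^esub>) {..<card X}"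
      using x by (intro M.finsum_cong') (auto simp: ract_one)
    also have "\<dots> = y"
      using M.add.finprod_singleton[of j "{..<card X}" x] j x by (auto simp: finsum_def)
    finally show "y \<in> ?p ` carrier ?F" by (intro image_eqI[of _ _ ?e]) auto
  qed
  ultimately show thesis using that[of "card X" x] x gen by blast
qed

text \<open>Projectivity splits a cover of \<open>P\<close> by a free module, and
  \<open>\<phi> k\<close> is the \<open>k\<close>-th coordinate of the section. Lifting is available
  only against modules over \<open>'u\<close>, so the free module is first copied there.\<close>

lemma projective_dual_basis:
  fixes P :: "('a, 'u) rmod" and \<iota> :: "'a list set \<Rightarrow> 'u"
  assumes \<iota>: "inj \<iota>" and proj: "projective TYPE('u) R P" and fg: "finitely_generated R P"
  obtains n :: nat and x \<phi> where "\<And>k. k < n \<Longrightarrow> x k \<in> carrier P"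
    "\<And>k. k < n \<Longrightarrow> linear_map R P (regular R) (\<phi> k)"
    "\<And>m. m \<in> carrier P \<Longrightarrow> finsum P (\<lambda>k. x k \<star>\<^bsub>P\<^esub> \<phi> k m) {..<n} = m"
proof -
  have P: "right_module R P" using proj by (simp add: projective_def)
  then interpret P: right_module R P .
  obtain n x where x: "\<And>k. k < n \<Longrightarrow> x k \<in> carrier P"
    and cover: "(\<lambda>v. finsum P (\<lambda>k. x k \<star>\<^bsub>P\<^esub> v k) {..<n}) ` carrier (free_rmod R n) = carrier P"
    by (rule P.finitely_generated_cover[OF fg]) blast
  let ?F = "free_rmod R n" and ?p = "\<lambda>v. finsum P (\<lambda>k. x k \<star>\<^bsub>P\<^esub> v k) {..<n}"
  have F: "right_module R ?F" by (rule P.R.free_rmod_right_module)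
  \<comment> \<open>A vector is coded by the singleton of its coordinate list. This is injective on
    the carrier because vectors are extensional.\<close>
  define c where "c = (\<lambda>v :: nat \<Rightarrow> 'a. \<iota> {map v [0..<n]})"
  have c: "inj_on c (carrier ?F)"
  proof (rule inj_onI)
    fix v w assume v: "v \<in> carrier ?F" and w: "w \<in> carrier ?F" and "c v = c w"
    then have "map v [0..<n] = map w [0..<n]" using \<iota> by (simp add: c_def inj_eq)
    then have "v k = w k" if "k < n" for k using that by (simp add: map_eq_conv)
    then show "v = w" using v w by (auto intro: PiE_ext)
  qed
  let ?F' = "transport c ?F" and ?i = "inv_into (carrier ?F) c"
  note TS = transport_simps[OF c]
  have F': "right_module R ?F'" by (rule transport_right_module[OF F c])
  have i_lin: "linear_map R ?F' ?F ?i" by (rule transport_linear_map_inv[OF F c])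
  have lin: "linear_map R ?F' P (\<lambda>y. ?p (?i y))"
    by (rule linear_map_compose[OF i_lin P.finite_combination_linear_map[OF x]])
  define g where "g = restrict (\<lambda>y. ?p (?i y)) (carrier ?F')"
  have g: "g \<in> Hom R ?F' P" unfolding g_def by (rule restrict_in_Hom[OF F' lin])
  have "g ` carrier ?F' = ?p ` ?i ` c ` carrier ?F"
    unfolding g_def TS(1) by (auto simp: image_iff)
  also have "?i ` c ` carrier ?F = carrier ?F" using c by (force simp: image_image)
  finally have g_surj: "g ` carrier ?F' = carrier P" using cover by simp
  have idl: "restrict (\<lambda>x. x) (carrier P) \<in> Hom R P P"
    by (rule restrict_in_Hom[OF P]) (rule linear_mapI; simp)
  obtain h where h: "h \<in> Hom R P ?F'" and gh: "\<And>m. m \<in> carrier P \<Longrightarrow> g (h m) = m"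
    using proj[unfolded projective_def, THEN conjunct2, rule_format,
        of ?F' P g "restrict (\<lambda>x. x) (carrier P)"] F' P g g_surj idl by auto
  have hl: "linear_map R P ?F' h" using h by (simp add: Hom_iff)
  have ih: "linear_map R P ?F (\<lambda>m. ?i (h m))" by (rule linear_map_compose[OF hl i_lin])
  show thesis
  proof (rule that)
    show "linear_map R P (regular R) (\<lambda>m. ?i (h m) k)" if k: "k < n" for k
    proof (rule linear_mapI)
      fix m assume m: "m \<in> carrier P"
      show "?i (h m) k \<in> carrier (regular R)"
        using linear_map_closed[OF ih m] k by (auto simp: PiE_iff)
      show "?i (h (m \<oplus>\<^bsub>P\<^esub> m')) k = ?i (h m) k \<oplus>\<^bsub>regular R\<^esub> ?i (h m') k" if "m' \<in> carrier P" for m'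
        using linear_map_add[OF ih m that] k by simp
      show "?i (h (m \<star>\<^bsub>P\<^esub> r)) k = ?i (h m) k \<star>\<^bsub>regular R\<^esub> r" if "r \<in> carrier R" for r
        using linear_map_ract[OF ih m that] k by simp
    qed
    show "finsum P (\<lambda>k. x k \<star>\<^bsub>P\<^esub> ?i (h m) k) {..<n} = m" if m: "m \<in> carrier P" for m
      using gh[OF m] linear_map_closed[OF hl m] by (simp add: g_def)
  qed (rule x)
qed

section \<open>Perfect Gabriel topologies\<close>

context gabriel_ring
begin

section \<open>Right ideals generated by a set\<close>

definition ideal_span :: "'a set \<Rightarrow> 'a set" where
  "ideal_span X = \<Inter>{K. right_ideal R K \<and> X \<subseteq> K}"

lemma ideal_span_least: "right_ideal R K \<Longrightarrow> X \<subseteq> K \<Longrightarrow> ideal_span X \<subseteq> K"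
  by (auto simp: ideal_span_def)

lemma subset_ideal_span: "X \<subseteq> ideal_span X"
  by (auto simp: ideal_span_def)

lemma ideal_span_mono: "X \<subseteq> Y \<Longrightarrow> ideal_span X \<subseteq> ideal_span Y"
  by (auto simp: ideal_span_def)

lemma ideal_span_right_ideal:
  assumes "X \<subseteq> carrier R"
  shows "right_ideal R (ideal_span X)"
proof (rule right_idealI)
  show "ideal_span X \<subseteq> carrier R" by (rule ideal_span_least[OF carrier_right_ideal assms])
qed (auto simp: ideal_span_def right_ideal_iff)

lemma ideal_span_finitely_generated:
  assumes X: "X \<subseteq> carrier R" "finite X"
  shows "finitely_generated R (ideal_mod R (ideal_span X))"
  unfolding finitely_generated_def
proof (intro exI[of _ X] conjI allI impI)
  show "finite X" by (rule X(2))
  show "X \<subseteq> carrier (ideal_mod R (ideal_span X))" using subset_ideal_span by simp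
  interpret S: right_module R "ideal_mod R (ideal_span X)"
    by (rule ideal_mod_right_module[OF ideal_span_right_ideal[OF X(1)]])
  fix N assume N: "right_submodule R (ideal_mod R (ideal_span X)) N \<and> X \<subseteq> N"
  have D: "N \<subseteq> ideal_span X" "\<zero> \<in> N" "\<And>x y. x \<in> N \<Longrightarrow> y \<in> N \<Longrightarrow> x \<oplus> y \<in> N"
    "\<And>x r. x \<in> N \<Longrightarrow> r \<in> carrier R \<Longrightarrow> x \<otimes> r \<in> N"
    using S.right_submoduleD[OF N[THEN conjunct1]] by simp_all
  have "ideal_span X \<subseteq> carrier R" by (rule ideal_span_least[OF carrier_right_ideal X(1)])
  then have "right_ideal R N" using D by (intro right_idealI) auto
  then show "N = carrier (ideal_mod R (ideal_span X))"
    using ideal_span_least[of N X] N D(1) by auto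
qed

end

locale perfect_quotient = gabriel_ring R \<G>
  for R :: "'a ring" (structure) and \<G> :: "'a set set" +
  fixes Q :: "'u ring" and lam :: "'a \<Rightarrow> 'u" and \<iota> :: "'a list set \<Rightarrow> 'u"
  assumes \<iota>: "inj \<iota>"
    and quotients: "ring_of_quotients R \<G> Q lam"
    and perfect: "perfect_topology R \<G> Q lam"

sublocale perfect_quotient \<subseteq> ext: scalar_extension R Q lam
  using quotients unfolding ring_of_quotients_def scalar_extension_def scalar_extension_axioms_def
  by (simp add: ring_axioms)

context perfect_quotient
begin

section \<open>Kernel and cokernel of \<open>lam\<close>, and finitely generated ideals in
  \<open>\<G>\<close>\<close>

lemma Q_reflection:
  "closed_reflection R \<G> (regular R) (restrict_scalars Q lam) (restrict lam (carrier R))"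
  using quotients by (simp add: ring_of_quotients_def)

lemma Q_closed: "gabriel_closed R \<G> (restrict_scalars Q lam)"
  using Q_reflection by (simp add: closed_reflection_def)

lemma Q_factor:
  assumes "gabriel_closed R \<G> (C :: ('a, 'u) rmod)" "f \<in> Hom R (regular R) C"
  shows "\<exists>!g. g \<in> Hom R (restrict_scalars Q lam) C \<and>
    compose (carrier R) g (restrict lam (carrier R)) = f"
  using Q_reflection[unfolded closed_reflection_def, THEN conjunct2, THEN conjunct2] assms by simp

text \<open>Let \<open>D\<close> consist of the elements that are torsion modulo the image of
  \<open>lam\<close>. As \<open>D\<close> is closed, the reflection turns \<open>lam\<close> into a
  map \<open>g\<close> from \<open>Q\<close> to \<open>D\<close>. Viewed as an endomorphism of
  \<open>Q\<close>, \<open>g\<close> fixes the image of \<open>lam\<close>, so it is the identity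
  and \<open>D\<close> is all of \<open>Q\<close>.\<close>

lemma cokernel_torsion:
  assumes q: "q \<in> carrier Q"
  shows "{r \<in> carrier R. q \<otimes>\<^bsub>Q\<^esub> lam r \<in> lam ` carrier R} \<in> \<G>"
proof -
  let ?Q = "restrict_scalars Q lam" and ?N = "lam ` carrier R"
  interpret reg: right_module R "regular R" by (rule regular_right_module)
  interpret QM: right_module R ?Q by (rule ext.T\<^sub>R_right_module)
  have N: "right_submodule R ?Q ?N"
    using linear_image_submodule[OF regular_right_module ext.T\<^sub>R_right_module ext.\<tau>_linear
        reg.carrier_submodule] by simp
  define D where "D = {x \<in> carrier ?Q. colon R ?Q ?N x \<in> \<G>}"
  have D: "gabriel_closed R \<G> (submod ?Q D)" unfolding D_def by (rule closure_closed[OF Q_closed N])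
  have lam_D: "lam r \<in> D" if "r \<in> carrier R" for r
  proof -
    have "{s \<in> carrier R. lam r \<otimes>\<^bsub>Q\<^esub> lam s \<in> ?N} = carrier R"
      using that by (auto simp: ext.\<tau>_simps(3)[symmetric] simp del: ext.\<tau>_simps(3))
    then show ?thesis using that G_carrier by (simp add: D_def)
  qed
  have lam_lin: "linear_map R (regular R) (submod ?Q D) lam"
    using lam_D by (intro linear_mapI) auto
  let ?l = "restrict lam (carrier R)"
  have l_D: "?l \<in> Hom R (regular R) (submod ?Q D)"
    using restrict_in_Hom[OF regular_right_module lam_lin] by simp
  obtain g where g: "g \<in> Hom R ?Q (submod ?Q D)" and gl: "compose (carrier R) g ?l = ?l"
    using Q_factor[OF D l_D] by blast
  have gQ: "g \<in> Hom R ?Q ?Q" using g D_def by (auto simp: Hom_iff linear_map_def Pi_iff)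
  have l_Q: "?l \<in> Hom R (regular R) ?Q"
    using restrict_in_Hom[OF regular_right_module ext.\<tau>_linear] by simp
  have idQ: "restrict (\<lambda>x. x) (carrier Q) \<in> Hom R ?Q ?Q"
    using restrict_in_Hom[OF ext.T\<^sub>R_right_module, of ?Q "\<lambda>x. x"] by (simp add: linear_map_def)
  have "compose (carrier R) (restrict (\<lambda>x. x) (carrier Q)) ?l = ?l"
    by (auto simp: compose_def restrict_def fun_eq_iff)
  then have "g = restrict (\<lambda>x. x) (carrier Q)"
    using Q_factor[OF Q_closed l_Q] gQ gl idQ by blast
  then have "g q = q" using q by simp
  then have "q \<in> D" using g q by (auto simp: Hom_iff linear_map_def Pi_iff)
  then show ?thesis by (simp add: D_def)
qed

text \<open>The map \<open>r \<mapsto> c r\<close> into a module that detects torsion factors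
  through \<open>lam\<close>, so \<open>lam x = 0\<close> forces \<open>c x = 0\<close>.\<close>

lemma kernel_torsion:
  assumes x: "x \<in> carrier R" and z: "lam x = \<zero>\<^bsub>Q\<^esub>"
  shows "{r \<in> carrier R. x \<otimes> r = \<zero>} \<in> \<G>"
proof -
  obtain C :: "('a, 'u) rmod" and c where C: "gabriel_closed R \<G> C" "c \<in> carrier C"
    and det: "\<And>x. x \<in> carrier R \<Longrightarrow> c \<star>\<^bsub>C\<^esub> x = \<zero>\<^bsub>C\<^esub> \<Longrightarrow> {r \<in> carrier R. x \<otimes> r = \<zero>} \<in> \<G>"
    by (rule closed_module_detecting_torsion[OF \<iota>]) blast
  interpret C: right_module R C by (rule closed_right_module[OF C(1)])
  let ?f = "restrict (\<lambda>r. c \<star>\<^bsub>C\<^esub> r) (carrier R)"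
  have f: "?f \<in> Hom R (regular R) C"
    using restrict_in_Hom[OF regular_right_module C.linear_map_ract_elem[OF C(2)]] by simp
  obtain g where g: "g \<in> Hom R (restrict_scalars Q lam) C"
    and gf: "compose (carrier R) g (restrict lam (carrier R)) = ?f"
    using Q_factor[OF C(1) f] by blast
  have "c \<star>\<^bsub>C\<^esub> x = g (lam x)" using fun_cong[OF gf, of x] x by (simp add: compose_def)
  also have "\<dots> = \<zero>\<^bsub>C\<^esub>"
    using linear_map_zero[OF ext.T\<^sub>R_right_module C.right_module_axioms, of g] g z by (simp add: Hom_iff)
  finally show ?thesis by (rule det[OF x])
qed

text \<open>A representation of \<open>1\<close> in \<open>IQ\<close> involves only a finite set
  \<open>X\<close> of elements of \<open>I\<close>. An ideal \<open>L\<close> in \<open>\<G>\<close>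
  clears the denominators, so \<open>lam\<close> sends \<open>L\<close> into the image of the right
  ideal generated by \<open>X\<close>. Up to torsion \<open>L\<close> is then contained in that
  ideal, which puts it into \<open>\<G>\<close>.\<close>

lemma finitely_generated_ideal_below:
  assumes I: "I \<in> \<G>"
  obtains J where "J \<in> \<G>" "J \<subseteq> I" "finitely_generated R (ideal_mod R J)"
proof -
  have IR: "I \<subseteq> carrier R" by (rule G_subset[OF I])
  let ?H = "{lam i \<otimes>\<^bsub>Q\<^esub> q | i q. i \<in> I \<and> q \<in> carrier Q}"
  \<comment> \<open>Some ideal in \<open>\<G>\<close> multiplies \<open>w\<close> into the image of
    a finitely generated ideal below \<open>I\<close>. The property passes to sums by uniting the
    generators and intersecting the ideals.\<close>
  let ?good = "\<lambda>w. \<exists>X L. finite X \<and> X \<subseteq> I \<and> L \<in> \<G> \<and> (\<forall>l\<in>L. w \<otimes>\<^bsub>Q\<^esub> lam l \<in> lam ` ideal_span X)"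
  have base: "?good (lam i \<otimes>\<^bsub>Q\<^esub> q)"
    if i: "i \<in> I" and q: "q \<in> carrier Q" for i q
  proof (intro exI conjI ballI)
    show "finite {i}" "{i} \<subseteq> I" using i by auto
    show "{r \<in> carrier R. q \<otimes>\<^bsub>Q\<^esub> lam r \<in> lam ` carrier R} \<in> \<G>" by (rule cokernel_torsion[OF q])
    fix l assume "l \<in> {r \<in> carrier R. q \<otimes>\<^bsub>Q\<^esub> lam r \<in> lam ` carrier R}"
    then obtain s where s: "s \<in> carrier R" "q \<otimes>\<^bsub>Q\<^esub> lam l = lam s" and l: "l \<in> carrier R" by auto
    have iR: "i \<in> carrier R" using i IR by auto
    have "lam i \<otimes>\<^bsub>Q\<^esub> q \<otimes>\<^bsub>Q\<^esub> lam l = lam (i \<otimes> s)"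
      using s l q iR by (simp add: ext.T.m_assoc)
    moreover have "i \<otimes> s \<in> ideal_span {i}"
      using ideal_span_right_ideal[of "{i}"] iR s subset_ideal_span[of "{i}"]
      by (auto simp: right_ideal_iff)
    ultimately show "lam i \<otimes>\<^bsub>Q\<^esub> q \<otimes>\<^bsub>Q\<^esub> lam l \<in> lam ` ideal_span {i}" by simp
  qed
  have "w \<in> carrier Q \<and> ?good w" if "w \<in> generate (add_monoid Q) ?H" for w
    using that
  proof induction
    case one
    have "\<zero> \<in> ideal_span {}" using ideal_span_right_ideal[of "{}"] by (auto simp: right_ideal_iff)
    moreover have "lam \<zero> = \<zero>\<^bsub>Q\<^esub>"
      using linear_map_zero[OF regular_right_module ext.T\<^sub>R_right_module ext.\<tau>_linear] by simp
    ultimately have "\<zero>\<^bsub>Q\<^esub> \<otimes>\<^bsub>Q\<^esub> lam l \<in> lam ` ideal_span {}" if "l \<in> carrier R" for l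
      using that by (auto intro: image_eqI[of _ _ "\<zero>"])
    then have "finite {} \<and> {} \<subseteq> I \<and> carrier R \<in> \<G> \<and>
        (\<forall>l\<in>carrier R. \<zero>\<^bsub>Q\<^esub> \<otimes>\<^bsub>Q\<^esub> lam l \<in> lam ` ideal_span {})" using G_carrier by simp
    then have "?good \<zero>\<^bsub>Q\<^esub>" by blast
    then show ?case by simp
  next
    case (incl w)
    then obtain i q where w: "w = lam i \<otimes>\<^bsub>Q\<^esub> q" "i \<in> I" "q \<in> carrier Q" by blast
    then show ?case using base[OF w(2,3)] IR by auto
  next
    case (inv w)
    then obtain i q where w: "w = lam i \<otimes>\<^bsub>Q\<^esub> q" "i \<in> I" "q \<in> carrier Q" by blast
    have "inv\<^bsub>add_monoid Q\<^esub> w = \<ominus>\<^bsub>Q\<^esub> w" by (simp add: a_inv_def)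
    also have "\<dots> = lam i \<otimes>\<^bsub>Q\<^esub> (\<ominus>\<^bsub>Q\<^esub> q)" using w IR by (auto simp: ext.T.r_minus)
    finally show ?case using base[OF w(2), of "\<ominus>\<^bsub>Q\<^esub> q"] w IR by auto
  next
    case (eng v w)
    obtain X L where X: "finite X" "X \<subseteq> I" "L \<in> \<G>" "\<forall>l\<in>L. v \<otimes>\<^bsub>Q\<^esub> lam l \<in> lam ` ideal_span X"
      using eng.IH(1) by blast
    obtain Y K where Y: "finite Y" "Y \<subseteq> I" "K \<in> \<G>" "\<forall>l\<in>K. w \<otimes>\<^bsub>Q\<^esub> lam l \<in> lam ` ideal_span Y"
      using eng.IH(2) by blast
    have v: "v \<in> carrier Q" and w: "w \<in> carrier Q" using eng.IH by auto
    have XY: "X \<union> Y \<subseteq> carrier R" using X Y IR by auto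
    note S = ideal_span_right_ideal[OF XY, unfolded right_ideal_iff]
    have "(v \<oplus>\<^bsub>Q\<^esub> w) \<otimes>\<^bsub>Q\<^esub> lam l \<in> lam ` ideal_span (X \<union> Y)" if l: "l \<in> L \<inter> K" for l
    proof -
      have lR: "l \<in> carrier R" using l G_subset[OF X(3)] by auto
      obtain a where a: "a \<in> ideal_span X" "v \<otimes>\<^bsub>Q\<^esub> lam l = lam a" using X(4) l by auto
      obtain b where b: "b \<in> ideal_span Y" "w \<otimes>\<^bsub>Q\<^esub> lam l = lam b" using Y(4) l by auto
      have ab: "a \<in> ideal_span (X \<union> Y)" "b \<in> ideal_span (X \<union> Y)"
        using a b ideal_span_mono[of X "X \<union> Y"] ideal_span_mono[of Y "X \<union> Y"] by auto
      then have "a \<in> carrier R" "b \<in> carrier R" "a \<oplus> b \<in> ideal_span (X \<union> Y)" using S by auto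
      then show ?thesis using a b v w lR by (auto simp: ext.T.l_distr intro!: image_eqI[of _ _ "a \<oplus> b"])
    qed
    then have "finite (X \<union> Y) \<and> X \<union> Y \<subseteq> I \<and> L \<inter> K \<in> \<G> \<and>
        (\<forall>l\<in>L \<inter> K. (v \<oplus>\<^bsub>Q\<^esub> w) \<otimes>\<^bsub>Q\<^esub> lam l \<in> lam ` ideal_span (X \<union> Y))"
      using X Y G_Int[OF X(3) Y(3)] by simp
    then have "?good (v \<oplus>\<^bsub>Q\<^esub> w)" by blast
    then show ?case using v w by simp
  qed
  moreover have "generate (add_monoid Q) ?H = carrier Q"
    using perfect I unfolding perfect_topology_def by blast
  ultimately obtain X L where X: "finite X" "X \<subseteq> I" and L: "L \<in> \<G>"
    and XL: "\<And>l. l \<in> L \<Longrightarrow> \<one>\<^bsub>Q\<^esub> \<otimes>\<^bsub>Q\<^esub> lam l \<in> lam ` ideal_span X"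
    using ext.T.one_closed by metis
  have XR: "X \<subseteq> carrier R" using X IR by auto
  note J = ideal_span_right_ideal[OF XR]
  note JD = J[unfolded right_ideal_iff]
  \<comment> \<open>Equality of \<open>lam l\<close> and \<open>lam j\<close> only says that
    \<open>l - j\<close> is torsion, so \<open>l r = j r\<close> for all \<open>r\<close> in some
    ideal of \<open>\<G>\<close>. The local condition absorbs this.\<close>
  have "ideal_span X \<in> \<G>"
  proof (rule G_local[OF J L])
    fix l assume l: "l \<in> L"
    then have lR: "l \<in> carrier R" using G_subset[OF L] by auto
    obtain j where j: "j \<in> ideal_span X" "lam l = lam j" using XL[OF l] lR by auto
    have jR: "j \<in> carrier R" using JD j by auto
    have "lam (l \<ominus> j) \<oplus>\<^bsub>Q\<^esub> lam j = lam (l \<ominus> j \<oplus> j)"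
      using lR jR by (intro ext.\<tau>_simps(2)[symmetric]) auto
    also have "l \<ominus> j \<oplus> j = l" using lR jR by (simp add: a_minus_def a_assoc l_neg)
    also have "lam l = \<zero>\<^bsub>Q\<^esub> \<oplus>\<^bsub>Q\<^esub> lam j" using j jR by simp
    finally have "lam (l \<ominus> j) = \<zero>\<^bsub>Q\<^esub>"
      using lR jR ext.T.add.right_cancel[of "lam j" "lam (l \<ominus> j)" "\<zero>\<^bsub>Q\<^esub>"] by simp
    then have "{r \<in> carrier R. (l \<ominus> j) \<otimes> r = \<zero>} \<in> \<G>" using lR jR by (intro kernel_torsion) auto
    then show "residual (ideal_span X) l \<in> \<G>"
    proof (rule G_superset)
      show "right_ideal R (residual (ideal_span X) l)"
        using colon_right_ideal[OF regular_right_module, of "ideal_span X" l] J lR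
        by (simp add: right_ideal_def)
      show "{r \<in> carrier R. (l \<ominus> j) \<otimes> r = \<zero>} \<subseteq> residual (ideal_span X) l"
      proof clarify
        fix r assume r: "r \<in> carrier R" "(l \<ominus> j) \<otimes> r = \<zero>"
        then have "l \<otimes> r \<ominus> j \<otimes> r = \<zero>" using lR jR by (simp add: a_minus_def l_distr l_minus)
        then have "l \<otimes> r = j \<otimes> r" using lR jR r by simp
        then show "l \<otimes> r \<in> ideal_span X" using JD j r by auto
      qed
    qed
  qed
  moreover have "ideal_span X \<subseteq> I" by (rule ideal_span_least[OF G_right_ideal[OF I] X(2)])
  ultimately show thesis using that ideal_span_finitely_generated[OF XR X(1)] by blast
qed

text \<open>The module \<open>R/J\<close> is finitely presented, and it is torsion because the class
  of \<open>x\<close> has annihilator \<open>(J : x)\<close>. Only an isomorphic copy is sure to lie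
  in \<open>\<U>\<close>; the image \<open>e\<close> of the class of \<open>1\<close> carries all
  that is needed of it.\<close>

lemma cyclic_torsion_representative:
  assumes U: "representative_fp_modules R (gabriel_torsion_class R \<G>) (\<U> :: ('a, 'u) rmod set)"
    and J: "J \<in> \<G>" and fg: "finitely_generated R (ideal_mod R J)"
  obtains U e where "U \<in> \<U>" "right_module R U" "e \<in> carrier U"
    "\<And>u. u \<in> carrier U \<Longrightarrow> \<exists>r\<in>carrier R. u = e \<star>\<^bsub>U\<^esub> r"
    "\<And>r. r \<in> carrier R \<Longrightarrow> e \<star>\<^bsub>U\<^esub> r = \<zero>\<^bsub>U\<^esub> \<longleftrightarrow> r \<in> J"
proof -
  interpret reg: right_module R "regular R" by (rule regular_right_module)
  note JD = G_right_ideal[OF J, unfolded right_ideal_iff]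
  have Jsub: "right_submodule R (regular R) J" using G_right_ideal[OF J] by (simp add: right_ideal_def)
  have J_neg: "\<ominus> x \<in> J" if "x \<in> J" for x
  proof -
    have "x \<otimes> \<ominus> \<one> \<in> J" "x \<in> carrier R" using JD that by auto
    then show ?thesis by (simp add: r_minus)
  qed
  \<comment> \<open>The coset of \<open>x\<close> modulo \<open>J\<close>, with elements turned into
    singleton lists so that \<open>\<iota>\<close> can store it in \<open>'u\<close>.\<close>
  define \<kappa> where "\<kappa> = (\<lambda>x. \<iota> ((\<lambda>y. [y]) ` {y \<in> carrier R. y \<ominus> x \<in> J}))"
  have \<kappa>: "\<kappa> x = \<kappa> y \<longleftrightarrow> x \<ominus> y \<in> J" if x: "x \<in> carrier R" and y: "y \<in> carrier R" for x y
  proof -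
    have s: "inj (\<lambda>y::'a. [y])" by (auto simp: inj_def)
    have "\<kappa> x = \<kappa> y \<longleftrightarrow> {z \<in> carrier R. z \<ominus> x \<in> J} = {z \<in> carrier R. z \<ominus> y \<in> J}"
      using \<iota> by (simp add: \<kappa>_def inj_eq inj_image_eq_iff[OF s])
    also have "\<dots> \<longleftrightarrow> x \<ominus> y \<in> J"
    proof
      assume eq: "{z \<in> carrier R. z \<ominus> x \<in> J} = {z \<in> carrier R. z \<ominus> y \<in> J}"
      have "x \<in> {z \<in> carrier R. z \<ominus> x \<in> J}" using x JD by (simp add: a_minus_def r_neg)
      then show "x \<ominus> y \<in> J" unfolding eq by simp
    next
      have sub: "{z \<in> carrier R. z \<ominus> x \<in> J} \<subseteq> {z \<in> carrier R. z \<ominus> y \<in> J}"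
        if "x \<in> carrier R" "y \<in> carrier R" "x \<ominus> y \<in> J" for x y
      proof clarify
        fix z assume z: "z \<in> carrier R" "z \<ominus> x \<in> J"
        have "z \<ominus> y = (z \<ominus> x) \<oplus> (x \<ominus> y)"
          using z that by (simp add: a_minus_def a_assoc r_neg1)
        then show "z \<ominus> y \<in> J" using JD z that by simp
      qed
      assume xy: "x \<ominus> y \<in> J"
      have "y \<ominus> x = \<ominus> (x \<ominus> y)" using x y by (simp add: a_minus_def minus_add a_comm)
      then have "y \<ominus> x \<in> J" using J_neg[OF xy] by simp
      then show "{z \<in> carrier R. z \<ominus> x \<in> J} = {z \<in> carrier R. z \<ominus> y \<in> J}"
        using sub[OF x y xy] sub[OF y x] by blast
    qed
    finally show ?thesis .
  qed
  \<comment> \<open>\<open>regular R\<close> is another record, so its subtraction is another term;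
    uniqueness of negatives identifies the two.\<close>
  have minus_eq: "x \<ominus>\<^bsub>regular R\<^esub> y = x \<ominus> y" if "x \<in> carrier R" "y \<in> carrier R" for x y
    using that reg.M.minus_equality[of "\<ominus> y" y] by (simp add: a_minus_def l_neg)
  let ?M = "transport \<kappa> (regular R)"
  have M: "right_module R ?M" and lin: "linear_map R (regular R) ?M \<kappa>"
    using transport_quotient[OF regular_right_module Jsub, of \<kappa>] \<kappa> minus_eq by simp_all
  interpret M: right_module R ?M by (rule M)
  have carM: "carrier ?M = \<kappa> ` carrier R" and zeroM: "\<zero>\<^bsub>?M\<^esub> = \<kappa> \<zero>" by (simp_all add: transport_def)
  have act: "\<kappa> x \<star>\<^bsub>?M\<^esub> r = \<kappa> (x \<otimes> r)" if "x \<in> carrier R" "r \<in> carrier R" for x r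
    using linear_map_ract[OF lin, of x r] that by simp
  have \<kappa>_zero: "\<kappa> x = \<zero>\<^bsub>?M\<^esub> \<longleftrightarrow> x \<in> J" if "x \<in> carrier R" for x
    using \<kappa>[OF that zero_closed] that by (simp add: zeroM a_minus_def)
  have "annihilator R ?M m \<in> \<G>" if m: "m \<in> carrier ?M" for m
  proof -
    obtain x where x: "x \<in> carrier R" "m = \<kappa> x" using m carM by auto
    have "annihilator R ?M m = residual J x"
      using x by (auto simp: annihilator_def act \<kappa>_zero)
    then show ?thesis using G_colon[OF J x(1)] by simp
  qed
  then have torsion: "?M \<in> gabriel_torsion_class R \<G>" using M by (simp add: gabriel_torsion_class_def)
  have fp: "finitely_presented R ?M"
    unfolding finitely_presented_def
  proof (intro conjI exI bexI)
    \<comment> \<open>One generator suffices. The kernel consists of the vectors with entry in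
      \<open>J\<close>, a copy of \<open>J\<close> under \<open>?s\<close> below, and inherits
      finite generation.\<close>
    let ?F = "free_rmod R 1" and ?p = "restrict (\<lambda>v. \<kappa> (v 0)) (carrier (free_rmod R 1))"
    have F: "right_module R ?F" by (rule free_rmod_right_module)
    interpret F: right_module R ?F by (rule F)
    have ev: "linear_map R ?F (regular R) (\<lambda>v. v 0)" by (rule linear_mapI) auto
    show "right_module R ?M" by (rule M)
    show p: "?p \<in> Hom R ?F ?M" by (rule restrict_in_Hom[OF F linear_map_compose[OF ev lin]])
    show "?p ` carrier ?F = carrier ?M"
    proof
      show "?p ` carrier ?F \<subseteq> carrier ?M" by (auto simp: carM)
      show "carrier ?M \<subseteq> ?p ` carrier ?F"
      proof
        fix m assume "m \<in> carrier ?M"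
        then obtain x where "x \<in> carrier R" "m = \<kappa> x" using carM by auto
        then show "m \<in> ?p ` carrier ?F" by (intro image_eqI[of _ _ "\<lambda>i\<in>{..<1}. x"]) auto
      qed
    qed
    define L where "L = {v \<in> carrier ?F. v 0 \<in> J}"
    have ker: "hom_kernel ?F ?M ?p = L"
      by (auto simp: L_def hom_kernel_def \<kappa>_zero PiE_iff)
    have K: "right_submodule R ?F L"
      using linear_preimage_submodule[OF F regular_right_module ev Jsub] unfolding L_def by simp
    interpret K: right_module R "submod ?F L"
      by (rule F.submod_right_module[OF K])
    obtain X where X: "finite X" "X \<subseteq> J"
      and gen: "\<And>N. right_submodule R (ideal_mod R J) N \<Longrightarrow> X \<subseteq> N \<Longrightarrow> N = J"
      using fg unfolding finitely_generated_def by auto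
    interpret Jm: right_module R "ideal_mod R J" by (rule ideal_mod_right_module[OF G_right_ideal[OF J]])
    let ?s = "\<lambda>x. \<lambda>i\<in>{..<1::nat}. x"
    have s_lin: "linear_map R (ideal_mod R J) (submod ?F L) ?s"
      using JD by (intro linear_mapI) (auto simp: L_def restrict_def fun_eq_iff split: if_splits)
    show "finitely_generated R (submod ?F (hom_kernel ?F ?M ?p))"
      unfolding ker finitely_generated_def
    proof (intro exI[of _ "?s ` X"] conjI allI impI)
      show "finite (?s ` X)" using X by simp
      show "?s ` X \<subseteq> carrier (submod ?F L)"
        using X linear_map_closed[OF s_lin] by auto
      fix N assume N: "right_submodule R (submod ?F L) N \<and> ?s ` X \<subseteq> N"
      have "right_submodule R (ideal_mod R J) {x \<in> J. ?s x \<in> N}"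
        using linear_preimage_submodule[OF Jm.right_module_axioms K.right_module_axioms s_lin N[THEN conjunct1]]
        by simp
      then have all: "{x \<in> J. ?s x \<in> N} = J" using X N by (intro gen) auto
      have "v \<in> N" if v: "v \<in> L" for v
      proof -
        have eq: "?s (v 0) = v" and "v 0 \<in> J"
          using v by (auto simp: L_def PiE_iff extensional_def fun_eq_iff)
        then have "?s (v 0) \<in> N" using all by blast
        then show ?thesis unfolding eq .
      qed
      then show "N = carrier (submod ?F L)"
        using K.right_submoduleD(1)[OF N[THEN conjunct1]] by auto
    qed
  qed
  obtain U f where UU: "U \<in> \<U>" and f: "f \<in> Hom R ?M U" and bij: "bij_betw f (carrier ?M) (carrier U)"
    using U torsion fp unfolding representative_fp_modules_def rmod_isomorphic_def by blast
  have UM: "right_module R U" using U UU unfolding representative_fp_modules_def finitely_presented_def by blast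
  have fl: "linear_map R ?M U f" using f by (simp add: Hom_iff)
  have one: "\<kappa> \<one> \<in> carrier ?M" by (simp add: carM)
  have f_act: "f (\<kappa> \<one>) \<star>\<^bsub>U\<^esub> r = f (\<kappa> r)" if "r \<in> carrier R" for r
    using linear_map_ract[OF fl one that] act[OF one_closed that] that by simp
  show thesis
  proof (rule that[OF UU UM linear_map_closed[OF fl one]])
    show "\<exists>r\<in>carrier R. u = f (\<kappa> \<one>) \<star>\<^bsub>U\<^esub> r" if u: "u \<in> carrier U" for u
    proof -
      obtain r where "r \<in> carrier R" "u = f (\<kappa> r)"
        using u bij by (auto simp: bij_betw_def carM)
      then show ?thesis using f_act by metis
    qed
    show "f (\<kappa> \<one>) \<star>\<^bsub>U\<^esub> r = \<zero>\<^bsub>U\<^esub> \<longleftrightarrow> r \<in> J" if r: "r \<in> carrier R" for r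
    proof -
      have "f (\<kappa> r) = f \<zero>\<^bsub>?M\<^esub> \<longleftrightarrow> \<kappa> r = \<zero>\<^bsub>?M\<^esub>"
        using bij r by (intro inj_on_eq_iff[of f "carrier ?M"]) (auto simp: bij_betw_def carM zeroM)
      then show ?thesis using f_act[OF r] linear_map_zero[OF M UM fl] \<kappa>_zero[OF r] by simp
    qed
  qed
qed

text \<open>Lifting a projective presentation of \<open>R/J\<close> to \<open>R\<close> gives \<open>h : P0 \<rightarrow> R\<close> with \<open>h \<alpha>\<close> mapping into \<open>J\<close>.
  A linear map \<open>f : J \<rightarrow> T\<close> extends to \<open>R\<close> because \<open>f h \<alpha>\<close> extends along \<open>\<alpha>\<close>.\<close>

lemma inverting_closed:
  fixes T :: "'t ring" and \<U> :: "('a, 'u) rmod set"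
  assumes U: "representative_fp_modules R (gabriel_torsion_class R \<G>) \<U>"
    and res: "\<And>U. U \<in> \<U> \<Longrightarrow> fg_projective_resolution R (P1 U) (\<alpha> U) (P0 U) (\<pi> U) U"
    and T: "ring T" "\<tau> \<in> ring_hom R T" and inverting: "inverting R \<U> P1 \<alpha> P0 T \<tau>"
  shows "gabriel_closed R \<G> (restrict_scalars T \<tau>)"
proof -
  interpret tau: scalar_extension R T \<tau>
    using T ring_axioms by (simp add: scalar_extension_def scalar_extension_axioms_def)
  let ?T = "restrict_scalars T \<tau>"
  interpret TM: right_module R ?T by (rule tau.T\<^sub>R_right_module)
  \<comment> \<open>The two clauses of closedness, for the ideals \<open>J\<close> whose quotient
    has a copy in \<open>\<U>\<close>.\<close>
  have presented: "(\<forall>t\<in>carrier T. (\<forall>j\<in>J. t \<otimes>\<^bsub>T\<^esub> \<tau> j = \<zero>\<^bsub>T\<^esub>) \<longrightarrow> t = \<zero>\<^bsub>T\<^esub>) \<and>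
      (\<forall>f. linear_map R (ideal_mod R J) ?T f \<longrightarrow> (\<exists>t\<in>carrier T. \<forall>j\<in>J. f j = t \<otimes>\<^bsub>T\<^esub> \<tau> j))"
    if J: "J \<in> \<G>" and fg: "finitely_generated R (ideal_mod R J)" for J
  proof -
    have JR: "J \<subseteq> carrier R" by (rule G_subset[OF J])
    note JD = G_right_ideal[OF J, unfolded right_ideal_iff]
    obtain U e where UU: "U \<in> \<U>" and UM: "right_module R U" and e: "e \<in> carrier U"
      and gen: "\<And>u. u \<in> carrier U \<Longrightarrow> \<exists>r\<in>carrier R. u = e \<star>\<^bsub>U\<^esub> r"
      and ann: "\<And>r. r \<in> carrier R \<Longrightarrow> e \<star>\<^bsub>U\<^esub> r = \<zero>\<^bsub>U\<^esub> \<longleftrightarrow> r \<in> J"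
      by (rule cyclic_torsion_representative[OF U J fg]) blast
    interpret UM: right_module R U by (rule UM)
    define A B a p where "A = P1 U" and "B = P0 U" and "a = \<alpha> U" and "p = \<pi> U"
    have "fg_projective_resolution R A a B p U" unfolding A_def B_def a_def p_def by (rule res[OF UU])
    then have projA: "projective TYPE('u) R A" and projB: "projective TYPE('u) R B"
      and aH: "a \<in> Hom R A B" and pH: "p \<in> Hom R B U"
      and p_surj: "p ` carrier B = carrier U" and exact: "a ` carrier A = hom_kernel B U p"
      unfolding fg_projective_resolution_def by blast+
    have AM: "right_module R A" and BM: "right_module R B"
      using projA projB by (simp_all add: projective_def)
    interpret AM: right_module R A by (rule AM)
    interpret BM: right_module R B by (rule BM)
    have a: "linear_map R A B a" and p: "linear_map R B U p" using aH pH by (auto simp: Hom_iff)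
    have pa: "p (a y) = \<zero>\<^bsub>U\<^esub>" if "y \<in> carrier A" for y
      using exact that unfolding hom_kernel_def by blast
    have iso: "tensor_map R A B T \<tau> a \<in> iso (tensor R A T \<tau>) (tensor R B T \<tau>)"
      using inverting UU unfolding inverting_def A_def B_def a_def by blast
    \<comment> \<open>The lift of \<open>p\<close> along \<open>r \<mapsto> e r\<close>. Lifting
      works against modules over \<open>'u\<close>, hence the copy of \<open>R\<close> under
      \<open>\<rho>\<close>.\<close>
    obtain h where h: "linear_map R B (regular R) h"
      and eh: "\<And>x. x \<in> carrier B \<Longrightarrow> e \<star>\<^bsub>U\<^esub> h x = p x"
    proof -
      define \<rho> where "\<rho> = (\<lambda>r::'a. \<iota> {[r]})"
      have \<rho>: "inj_on \<rho> (carrier (regular R))" by (rule inj_onI) (simp add: \<rho>_def inj_eq[OF \<iota>])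
      let ?R' = "transport \<rho> (regular R)" and ?i = "inv_into (carrier (regular R)) \<rho>"
      have R': "right_module R ?R'" by (rule transport_right_module[OF regular_right_module \<rho>])
      have i: "linear_map R ?R' (regular R) ?i" by (rule transport_linear_map_inv[OF regular_right_module \<rho>])
      let ?g = "restrict (\<lambda>y. e \<star>\<^bsub>U\<^esub> ?i y) (carrier ?R')"
      have g: "?g \<in> Hom R ?R' U"
        by (rule restrict_in_Hom[OF R' linear_map_compose[OF i UM.linear_map_ract_elem[OF e]]])
      have "?g ` carrier ?R' = carrier U"
      proof
        show "?g ` carrier ?R' \<subseteq> carrier U" using g by (auto simp: Hom_def)
        show "carrier U \<subseteq> ?g ` carrier ?R'"
        proof
          fix u assume "u \<in> carrier U"
          then obtain r where r: "r \<in> carrier R" "u = e \<star>\<^bsub>U\<^esub> r" using gen by blast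
          then show "u \<in> ?g ` carrier ?R'"
            using \<rho> by (intro image_eqI[of _ _ "\<rho> r"]) (auto simp: transport_simps[OF \<rho>])
        qed
      qed
      then obtain h' where h': "h' \<in> Hom R B ?R'" and gh: "\<And>x. x \<in> carrier B \<Longrightarrow> ?g (h' x) = p x"
        using projB[unfolded projective_def, THEN conjunct2, rule_format, of ?R' U ?g p] R' UM g pH by auto
      have hl: "linear_map R B ?R' h'" using h' by (simp add: Hom_iff)
      show thesis
      proof (rule that)
        show "linear_map R B (regular R) (\<lambda>x. ?i (h' x))" by (rule linear_map_compose[OF hl i])
        show "e \<star>\<^bsub>U\<^esub> ?i (h' x) = p x" if "x \<in> carrier B" for x
          using gh[OF that] linear_map_closed[OF hl that] by simp
      qed
    qed
    have hR: "h x \<in> carrier R" if "x \<in> carrier B" for x using linear_map_closed[OF h that] by simp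
    have haJ: "h (a y) \<in> J" if y: "y \<in> carrier A" for y
    proof -
      have ay: "a y \<in> carrier B" by (rule linear_map_closed[OF a y])
      show ?thesis using ann[OF hR[OF ay]] eh[OF ay] pa[OF y] by simp
    qed
    obtain b where b: "b \<in> carrier B" "p b = e" using p_surj e by (metis imageE)
    \<comment> \<open>\<open>e (1 - h b) = e - p b = 0\<close>, and \<open>J\<close> is the
      annihilator of \<open>e\<close>. The splitting of \<open>1\<close> into \<open>h b\<close> and
      this element drives both halves below.\<close>
    have bJ: "\<one> \<ominus> h b \<in> J"
    proof -
      have "e \<star>\<^bsub>U\<^esub> (\<one> \<ominus> h b) = e \<ominus>\<^bsub>U\<^esub> e"
        using e hR[OF b(1)] eh[OF b(1)] b(2)
        by (simp add: a_minus_def UM.ract_add_right UM.ract_minus UM.ract_one)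
      then have "e \<star>\<^bsub>U\<^esub> (\<one> \<ominus> h b) = \<zero>\<^bsub>U\<^esub>" using e by simp
      then show ?thesis using ann[of "\<one> \<ominus> h b"] hR[OF b(1)] by simp
    qed
    show ?thesis
    proof (intro conjI ballI allI impI)
      fix t assume t: "t \<in> carrier T" and z: "\<forall>j\<in>J. t \<otimes>\<^bsub>T\<^esub> \<tau> j = \<zero>\<^bsub>T\<^esub>"
      \<comment> \<open>As \<open>h a\<close> has values in \<open>J\<close>, this map vanishes on
        the image of \<open>a\<close>, hence also at \<open>b\<close>. Together with
        \<open>t (1 - h b) = 0\<close> this kills \<open>t\<close>.\<close>
      have lin: "linear_map R B ?T (\<lambda>x. t \<star>\<^bsub>?T\<^esub> h x)"
        using linear_map_compose[OF h TM.linear_map_ract_elem[of t]] t by simp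
      have "t \<star>\<^bsub>?T\<^esub> h b = \<zero>\<^bsub>T\<^esub>"
        by (rule tau.unique_along_inverted[OF AM BM a iso lin _ b(1)]) (use z haJ in simp)
      moreover have "t \<otimes>\<^bsub>T\<^esub> \<tau> (\<one> \<ominus> h b) = \<zero>\<^bsub>T\<^esub>" using z bJ by simp
      moreover have "t = t \<otimes>\<^bsub>T\<^esub> \<tau> (h b \<oplus> (\<one> \<ominus> h b))"
        using t hR[OF b(1)] by (simp add: a_minus_def r_neg2 a_lcomm[of "h b"] r_neg del: tau.\<tau>_simps(2))
      then have "t = t \<otimes>\<^bsub>T\<^esub> \<tau> (h b) \<oplus>\<^bsub>T\<^esub> t \<otimes>\<^bsub>T\<^esub> \<tau> (\<one> \<ominus> h b)"
        using t hR[OF b(1)] by (simp add: tau.T.r_distr)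
      ultimately show "t = \<zero>\<^bsub>T\<^esub>" by simp
    next
      fix f assume f: "linear_map R (ideal_mod R J) ?T f"
      have "linear_map R A (ideal_mod R J) (\<lambda>y. h (a y))"
        using haJ linear_map_closed[OF a]
        by (intro linear_mapI) (simp_all add: linear_map_add[OF a] linear_map_ract[OF a] linear_map_add[OF h] linear_map_ract[OF h])
      then have lin: "linear_map R A ?T (\<lambda>y. f (h (a y)))" by (rule linear_map_compose[OF _ f])
      obtain k where k: "linear_map R B ?T k" and ka: "\<And>y. y \<in> carrier A \<Longrightarrow> k (a y) = f (h (a y))"
        by (rule tau.extension_along_inverted[OF AM BM a iso lin]) blast
      have fJ: "f j \<in> carrier T" if "j \<in> J" for j using linear_map_closed[OF f, of j] that by simp
      have kb: "k b \<in> carrier T" using linear_map_closed[OF k b(1)] by simp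
      show "\<exists>t\<in>carrier T. \<forall>j\<in>J. f j = t \<otimes>\<^bsub>T\<^esub> \<tau> j"
      \<comment> \<open>Since \<open>b j\<close> lies in the image of \<open>a\<close>, multiplying
        \<open>k b\<close> by \<open>\<tau> j\<close> gives \<open>f (h b j)\<close>. The other part
        \<open>(1 - h b) j\<close> of \<open>j\<close> is served by \<open>f (1 - h b)\<close>,
        because \<open>1 - h b\<close> lies in \<open>J\<close>. This explains the witness.\<close>
      proof (intro bexI ballI)
        show "k b \<oplus>\<^bsub>T\<^esub> f (\<one> \<ominus> h b) \<in> carrier T" using kb fJ[OF bJ] by simp
        fix j assume j: "j \<in> J"
        then have jR: "j \<in> carrier R" using JR by auto
        have "p (b \<star>\<^bsub>B\<^esub> j) = \<zero>\<^bsub>U\<^esub>"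
          using linear_map_ract[OF p b(1) jR] b(2) ann[OF jR] j by simp
        then have "b \<star>\<^bsub>B\<^esub> j \<in> a ` carrier A"
          using BM.ract_closed[OF b(1) jR] unfolding exact hom_kernel_def by simp
        then obtain y where y: "y \<in> carrier A" "a y = b \<star>\<^bsub>B\<^esub> j" by auto
        have hbj: "h b \<otimes> j \<in> J" using haJ[OF y(1)] y(2) linear_map_ract[OF h b(1) jR] by simp
        have "k b \<otimes>\<^bsub>T\<^esub> \<tau> j = k (b \<star>\<^bsub>B\<^esub> j)" using linear_map_ract[OF k b(1) jR] by simp
        also have "\<dots> = f (h b \<otimes> j)" using ka[OF y(1)] y(2) linear_map_ract[OF h b(1) jR] by simp
        finally have 1: "k b \<otimes>\<^bsub>T\<^esub> \<tau> j = f (h b \<otimes> j)" .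
        have 2: "f (\<one> \<ominus> h b) \<otimes>\<^bsub>T\<^esub> \<tau> j = f ((\<one> \<ominus> h b) \<otimes> j)"
          using linear_map_ract[OF f, of "\<one> \<ominus> h b" j] bJ jR by simp
        have bjJ: "(\<one> \<ominus> h b) \<otimes> j \<in> J" using JD bJ jR by simp
        have "f j = f (h b \<otimes> j \<oplus> (\<one> \<ominus> h b) \<otimes> j)"
        proof -
          have "j = h b \<otimes> j \<oplus> (\<one> \<ominus> h b) \<otimes> j"
            using hR[OF b(1)] jR by (simp add: a_minus_def l_distr l_minus a_lcomm[of "h b \<otimes> j"] r_neg)
          then show ?thesis by simp
        qed
        also have "\<dots> = f (h b \<otimes> j) \<oplus>\<^bsub>T\<^esub> f ((\<one> \<ominus> h b) \<otimes> j)"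
          using linear_map_add[OF f, of "h b \<otimes> j" "(\<one> \<ominus> h b) \<otimes> j"] hbj bjJ by simp
        also have "\<dots> = (k b \<oplus>\<^bsub>T\<^esub> f (\<one> \<ominus> h b)) \<otimes>\<^bsub>T\<^esub> \<tau> j"
          using kb fJ[OF bJ] jR 1 2 by (simp add: tau.T.l_distr)
        finally show "f j = (k b \<oplus>\<^bsub>T\<^esub> f (\<one> \<ominus> h b)) \<otimes>\<^bsub>T\<^esub> \<tau> j" .
      qed
    qed
  qed
  have torsion_free: "t = \<zero>\<^bsub>T\<^esub>" if I: "I \<in> \<G>" and t: "t \<in> carrier T" "\<And>i. i \<in> I \<Longrightarrow> t \<otimes>\<^bsub>T\<^esub> \<tau> i = \<zero>\<^bsub>T\<^esub>" for I t
  proof -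
    obtain J where "J \<in> \<G>" "J \<subseteq> I" "finitely_generated R (ideal_mod R J)"
      by (rule finitely_generated_ideal_below[OF I]) blast
    then show ?thesis using presented[of J] t by blast
  qed
  show ?thesis
    unfolding gabriel_closed_iff
  proof (intro conjI ballI allI impI)
    show "right_module R ?T" by (rule tau.T\<^sub>R_right_module)
    fix I assume I: "I \<in> \<G>"
    have IR: "I \<subseteq> carrier R" by (rule G_subset[OF I])
    show "c = \<zero>\<^bsub>?T\<^esub>" if "c \<in> carrier ?T" "\<forall>i\<in>I. c \<star>\<^bsub>?T\<^esub> i = \<zero>\<^bsub>?T\<^esub>" for c
      using torsion_free[OF I, of c] that by simp
    fix f assume f: "linear_map R (ideal_mod R I) ?T f"
    obtain J where J: "J \<in> \<G>" "J \<subseteq> I" "finitely_generated R (ideal_mod R J)"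
      by (rule finitely_generated_ideal_below[OF I]) blast
    have "linear_map R (ideal_mod R J) ?T f" using f J(2) by (auto simp: linear_map_def Pi_iff subset_iff)
    then obtain t where t: "t \<in> carrier T" and tJ: "\<And>j. j \<in> J \<Longrightarrow> f j = t \<otimes>\<^bsub>T\<^esub> \<tau> j"
      using presented[OF J(1,3)] by blast
    \<comment> \<open>\<open>t\<close> represents \<open>f\<close> on \<open>J\<close> only. For
      \<open>i\<close> in \<open>I\<close> the difference is killed by \<open>(J : i)\<close>, and
      torsion-freeness makes it zero.\<close>
    have "f i = t \<otimes>\<^bsub>T\<^esub> \<tau> i" if i: "i \<in> I" for i
    proof -
      have iR: "i \<in> carrier R" using i IR by auto
      have fi: "f i \<in> carrier T" using linear_map_closed[OF f, of i] i by simp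
      have "f i \<ominus>\<^bsub>T\<^esub> t \<otimes>\<^bsub>T\<^esub> \<tau> i = \<zero>\<^bsub>T\<^esub>"
      proof (rule torsion_free[OF G_colon[OF J(1) iR]])
        fix r assume "r \<in> residual J i"
        then have r: "r \<in> carrier R" "i \<otimes> r \<in> J" by auto
        have "f i \<otimes>\<^bsub>T\<^esub> \<tau> r = t \<otimes>\<^bsub>T\<^esub> \<tau> i \<otimes>\<^bsub>T\<^esub> \<tau> r"
          using linear_map_ract[OF f, of i r] i r(1) tJ[OF r(2)] t iR by (simp add: tau.T.m_assoc)
        then show "(f i \<ominus>\<^bsub>T\<^esub> t \<otimes>\<^bsub>T\<^esub> \<tau> i) \<otimes>\<^bsub>T\<^esub> \<tau> r = \<zero>\<^bsub>T\<^esub>"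
          using fi t iR r(1) by (simp add: a_minus_def tau.T.l_distr tau.T.l_minus tau.T.r_neg)
      qed (use fi t iR in simp)
      then show ?thesis using fi t iR by simp
    qed
    then show "\<exists>c\<in>carrier ?T. \<forall>i\<in>I. f i = c \<star>\<^bsub>?T\<^esub> i" using t by (intro bexI[of _ t]) auto
  qed
qed

text \<open>For surjectivity, \<open>b \<otimes> lam i q = b i \<otimes> q\<close>, and
  \<open>b i\<close> lies in the image of \<open>a\<close> when \<open>i\<close> kills
  \<open>p b\<close>; perfectness reaches all of \<open>Q\<close> by sums of such
  \<open>lam i q\<close>. For injectivity, \<open>lam (\<phi> k)\<close> extends along
  \<open>a\<close>, which is injective with torsion cokernel, and \<open>tensor_map_isoI\<close>
  applies.\<close>

lemma quotients_inverting:
  fixes \<U> :: "('a, 'u) rmod set"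
  assumes U: "\<U> \<subseteq> gabriel_torsion_class R \<G>"
    and res: "\<And>U. U \<in> \<U> \<Longrightarrow> fg_projective_resolution R (P1 U) (\<alpha> U) (P0 U) (\<pi> U) U"
  shows "inverting R \<U> P1 \<alpha> P0 Q lam"
  unfolding inverting_def
proof
  fix U :: "('a, 'u) rmod" assume UU: "U \<in> \<U>"
  define A B a p where "A = P1 U" and "B = P0 U" and "a = \<alpha> U" and "p = \<pi> U"
  have "fg_projective_resolution R A a B p U" unfolding A_def B_def a_def p_def by (rule res[OF UU])
  then have projA: "projective TYPE('u) R A" and projB: "projective TYPE('u) R B"
    and fgA: "finitely_generated R A"
    and aH: "a \<in> Hom R A B" and a_inj: "inj_on a (carrier A)" and pH: "p \<in> Hom R B U"
    and exact: "a ` carrier A = hom_kernel B U p"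
    unfolding fg_projective_resolution_def by blast+
  have UM: "right_module R U" and Utor: "\<And>u. u \<in> carrier U \<Longrightarrow> annihilator R U u \<in> \<G>"
    using U UU by (auto simp: gabriel_torsion_class_def)
  have AM: "right_module R A" and BM: "right_module R B"
    using projA projB by (simp_all add: projective_def)
  interpret AM: right_module R A by (rule AM)
  interpret BM: right_module R B by (rule BM)
  have a: "linear_map R A B a" and p: "linear_map R B U p" using aH pH by (auto simp: Hom_iff)
  \<comment> \<open>By exactness the cokernel of \<open>a\<close> is the image of \<open>p\<close>,
    so both ideals annihilate the class of \<open>b\<close>.\<close>
  have colon: "colon R B (a ` carrier A) b = annihilator R U (p b)" if "b \<in> carrier B" for b
    unfolding exact annihilator_def hom_kernel_def
    using that by (auto simp: linear_map_ract[OF p] BM.ract_closed)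
  have coker: "colon R B (a ` carrier A) b \<in> \<G>" if "b \<in> carrier B" for b
    using colon[OF that] Utor linear_map_closed[OF p that] by simp
  obtain n :: nat and x \<phi> where x: "\<And>k. k < n \<Longrightarrow> x k \<in> carrier A"
    and \<phi>: "\<And>k. k < n \<Longrightarrow> linear_map R A (regular R) (\<phi> k)"
    and db: "\<And>m. m \<in> carrier A \<Longrightarrow> finsum A (\<lambda>k. x k \<star>\<^bsub>A\<^esub> \<phi> k m) {..<n} = m"
    by (rule projective_dual_basis[OF \<iota> projA fgA]) blast
  have "tensor_map R A B Q lam a \<in> iso (tensor R A Q lam) (tensor R B Q lam)"
  proof (rule ext.tensor_map_isoI[OF AM BM a _ x \<phi> db])
    fix b q assume b: "b \<in> carrier B" and q: "q \<in> carrier Q"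
    let ?I = "annihilator R U (p b)"
    have I: "?I \<in> \<G>" using coker[OF b] colon[OF b] by simp
    have base: "\<exists>c\<in>ext.chains A. frag_of (b, lam i \<otimes>\<^bsub>Q\<^esub> q') - ext.push a c \<in> ext.relations B"
      if i: "i \<in> ?I" and q': "q' \<in> carrier Q" for i q'
    proof -
      have iR: "i \<in> carrier R" using i by (simp add: annihilator_def)
      obtain y where y: "y \<in> carrier A" "b \<star>\<^bsub>B\<^esub> i = a y" using i colon[OF b] by blast
      have "- (frag_of (b \<star>\<^bsub>B\<^esub> i, q') - frag_of (b, lam i \<otimes>\<^bsub>Q\<^esub> q')) \<in> ext.relations B"
        by (rule ext.relations_uminus[OF BM ext.relations_balanced[OF BM b iR q']])
      then have "frag_of (b, lam i \<otimes>\<^bsub>Q\<^esub> q') - ext.push a (frag_of (y, q')) \<in> ext.relations B"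
        using y(2) by simp
      then show ?thesis using ext.chains_frag_of[OF y(1) q'] by blast
    qed
    have IR: "?I \<subseteq> carrier R" by (auto simp: annihilator_def)
    have "q \<in> generate (add_monoid Q) {lam i \<otimes>\<^bsub>Q\<^esub> q | i q. i \<in> ?I \<and> q \<in> carrier Q}"
      using perfect I q unfolding perfect_topology_def by blast
    then have "q \<in> carrier Q \<and> (\<exists>c\<in>ext.chains A. frag_of (b, q) - ext.push a c \<in> ext.relations B)"
    proof induction
      case one
      show ?case
        using ext.relations_zero_right[OF BM b] ext.chains_zero by (auto intro!: bexI[of _ 0])
    next
      case (incl q)
      then obtain i q' where q': "q = lam i \<otimes>\<^bsub>Q\<^esub> q'" "i \<in> ?I" "q' \<in> carrier Q" by blast
      then show ?case using base[OF q'(2,3)] IR by auto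
    next
      case (inv q)
      then obtain i q' where q': "q = lam i \<otimes>\<^bsub>Q\<^esub> q'" "i \<in> ?I" "q' \<in> carrier Q" by blast
      have "inv\<^bsub>add_monoid Q\<^esub> q = \<ominus>\<^bsub>Q\<^esub> q" by (simp add: a_inv_def)
      also have "\<dots> = lam i \<otimes>\<^bsub>Q\<^esub> (\<ominus>\<^bsub>Q\<^esub> q')" using q' IR by (auto simp: ext.T.r_minus)
      finally show ?case using base[OF q'(2), of "\<ominus>\<^bsub>Q\<^esub> q'"] q' IR by auto
    next
      case (eng v w)
      obtain c where c: "c \<in> ext.chains A" "frag_of (b, v) - ext.push a c \<in> ext.relations B"
        using eng.IH(1) by blast
      obtain d where d: "d \<in> ext.chains A" "frag_of (b, w) - ext.push a d \<in> ext.relations B"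
        using eng.IH(2) by blast
      have v: "v \<in> carrier Q" and w: "w \<in> carrier Q" using eng.IH by auto
      have "(frag_of (b, v \<oplus>\<^bsub>Q\<^esub> w) - frag_of (b, v) - frag_of (b, w)) +
          ((frag_of (b, v) - ext.push a c) + (frag_of (b, w) - ext.push a d)) \<in> ext.relations B"
        by (rule ext.relations_add[OF BM ext.relations_right[OF BM b v w]
              ext.relations_add[OF BM c(2) d(2)]])
      then have "frag_of (b, v \<oplus>\<^bsub>Q\<^esub> w) - ext.push a (c + d) \<in> ext.relations B"
        by (simp add: frag_extend_add algebra_simps)
      then show ?case using v w ext.chains_add[OF c(1) d(1)] by auto
    qed
    then show "\<exists>c\<in>ext.chains A. frag_of (b, q) - ext.push a c \<in> ext.relations B" by blast
  next
    fix k assume k: "k < n"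
    have lin: "linear_map R A (restrict_scalars Q lam) (\<lambda>y. lam (\<phi> k y))"
      by (rule linear_map_compose[OF \<phi>[OF k] ext.\<tau>_linear])
    have "lam (\<phi> k y) = \<zero>\<^bsub>restrict_scalars Q lam\<^esub>" if y: "y \<in> carrier A" and z: "a y = \<zero>\<^bsub>B\<^esub>" for y
    proof -
      have "a y = a \<zero>\<^bsub>A\<^esub>" using z linear_map_zero[OF AM BM a] by simp
      then have "y = \<zero>\<^bsub>A\<^esub>" by (rule inj_onD[OF a_inj]) (simp_all add: y)
      then show ?thesis using linear_map_zero[OF AM ext.T\<^sub>R_right_module lin] by simp
    qed
    then obtain g where "linear_map R B (restrict_scalars Q lam) g"
      "\<And>y. y \<in> carrier A \<Longrightarrow> g (a y) = lam (\<phi> k y)"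
      using linear_map_extension[OF Q_closed BM AM a lin _ coker] by blast
    then show "\<exists>g. linear_map R B (restrict_scalars Q lam) g \<and> (\<forall>y\<in>carrier A. g (a y) = lam (\<phi> k y))"
      by blast
  qed
  then show "tensor_map R (P1 U) (P0 U) Q lam (\<alpha> U) \<in> iso (tensor R (P1 U) Q lam) (tensor R (P0 U) Q lam)"
    by (simp add: A_def B_def a_def)
qed

text \<open>An \<open>R\<close>-linear extension \<open>g\<close> of \<open>\<tau>\<close> is
  multiplicative: for fixed \<open>q\<close> the maps \<open>q' \<mapsto> g (q q')\<close> and
  \<open>q' \<mapsto> (g q) (g q')\<close> are \<open>R\<close>-linear and agree on the image of
  \<open>lam\<close>, hence everywhere. A competing ring homomorphism is \<open>R\<close>-linear
  too, so it equals \<open>g\<close>.\<close>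

lemma quotients_universal:
  fixes T :: "'t ring"
  assumes T: "ring T" "\<tau> \<in> ring_hom R T" and closed: "gabriel_closed R \<G> (restrict_scalars T \<tau>)"
  shows "\<exists>!\<phi>. \<phi> \<in> ring_hom Q T \<and> \<phi> \<in> extensional (carrier Q) \<and> (\<forall>r\<in>carrier R. \<phi> (lam r) = \<tau> r)"
proof -
  interpret tau: scalar_extension R T \<tau>
    using T ring_axioms by (simp add: scalar_extension_def scalar_extension_axioms_def)
  let ?T = "restrict_scalars T \<tau>" and ?Q = "restrict_scalars Q lam"
  interpret TM: right_module R ?T by (rule tau.T\<^sub>R_right_module)
  have coker: "colon R ?Q (lam ` carrier R) q \<in> \<G>" if "q \<in> carrier ?Q" for q
    using cokernel_torsion[of q] that by simp
  \<comment> \<open>An ideal in \<open>\<G>\<close> kills \<open>y\<close>, hence also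
    \<open>\<tau> y\<close>, which lies in a closed module.\<close>
  have ker: "\<tau> y = \<zero>\<^bsub>?T\<^esub>" if y: "y \<in> carrier (regular R)" and z: "lam y = \<zero>\<^bsub>?Q\<^esub>" for y
  proof (rule closed_torsion_zero[OF closed])
    have yR: "y \<in> carrier R" using y by simp
    show "{r \<in> carrier R. y \<otimes> r = \<zero>} \<in> \<G>" using kernel_torsion[OF yR] z by simp
    show "\<tau> y \<in> carrier ?T" using yR by simp
    have \<tau>0: "\<tau> \<zero> = \<zero>\<^bsub>T\<^esub>"
      using linear_map_zero[OF regular_right_module tau.T\<^sub>R_right_module tau.\<tau>_linear] by simp
    show "\<forall>r\<in>{r \<in> carrier R. y \<otimes> r = \<zero>}. \<tau> y \<star>\<^bsub>?T\<^esub> r = \<zero>\<^bsub>?T\<^esub>"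
    proof
      fix r assume r: "r \<in> {r \<in> carrier R. y \<otimes> r = \<zero>}"
      then have "\<tau> y \<otimes>\<^bsub>T\<^esub> \<tau> r = \<tau> (y \<otimes> r)" using yR by (intro tau.\<tau>_simps(3)[symmetric]) auto
      then show "\<tau> y \<star>\<^bsub>?T\<^esub> r = \<zero>\<^bsub>?T\<^esub>" using r \<tau>0 by simp
    qed
  qed
  have coker': "colon R ?Q (lam ` carrier (regular R)) m \<in> \<G>" if "m \<in> carrier ?Q" for m
    using coker[OF that] by simp
  obtain g where g: "linear_map R ?Q ?T g" and gl: "\<And>r. r \<in> carrier R \<Longrightarrow> g (lam r) = \<tau> r"
    using linear_map_extension[OF closed ext.T\<^sub>R_right_module regular_right_module ext.\<tau>_linear
        tau.\<tau>_linear ker coker'] by auto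
  have gT: "g q \<in> carrier T" if "q \<in> carrier Q" for q using linear_map_closed[OF g, of q] that by simp
  have g_ract: "g (q \<otimes>\<^bsub>Q\<^esub> lam r) = g q \<otimes>\<^bsub>T\<^esub> \<tau> r" if "q \<in> carrier Q" "r \<in> carrier R" for q r
    using linear_map_ract[OF g, of q r] that by simp
  have g_add: "g (q \<oplus>\<^bsub>Q\<^esub> q') = g q \<oplus>\<^bsub>T\<^esub> g q'" if "q \<in> carrier Q" "q' \<in> carrier Q" for q q'
    using linear_map_add[OF g, of q q'] that by simp
  have g_mult: "g (q \<otimes>\<^bsub>Q\<^esub> q') = g q \<otimes>\<^bsub>T\<^esub> g q'" if q: "q \<in> carrier Q" and q': "q' \<in> carrier Q" for q q'
  proof (rule linear_map_unique[OF closed _ _ coker])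
    show "linear_map R ?Q ?T (\<lambda>q'. g (q \<otimes>\<^bsub>Q\<^esub> q'))"
      using q by (intro linear_mapI)
        (simp_all add: gT ext.T.r_distr g_add g_ract ext.T.m_assoc[symmetric])
    show "linear_map R ?Q ?T (\<lambda>q'. g q \<otimes>\<^bsub>T\<^esub> g q')"
      using q by (intro linear_mapI)
        (simp_all add: gT tau.T.r_distr g_add g_ract tau.T.m_assoc)
    show "g (q \<otimes>\<^bsub>Q\<^esub> x) = g q \<otimes>\<^bsub>T\<^esub> g x" if "x \<in> lam ` carrier R" for x
      using that q by (auto simp: g_ract gl)
  qed (use q' in auto)
  have g_one: "g \<one>\<^bsub>Q\<^esub> = \<one>\<^bsub>T\<^esub>" using gl[OF one_closed] by simp
  show ?thesis
  proof (rule ex1I)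
    show "restrict g (carrier Q) \<in> ring_hom Q T \<and> restrict g (carrier Q) \<in> extensional (carrier Q) \<and>
        (\<forall>r\<in>carrier R. restrict g (carrier Q) (lam r) = \<tau> r)"
      by (auto intro!: ring_hom_memI simp: gT g_add g_mult g_one gl)
    fix \<phi> assume \<phi>: "\<phi> \<in> ring_hom Q T \<and> \<phi> \<in> extensional (carrier Q) \<and> (\<forall>r\<in>carrier R. \<phi> (lam r) = \<tau> r)"
    then have hom: "\<phi> \<in> ring_hom Q T" and l: "\<And>r. r \<in> carrier R \<Longrightarrow> \<phi> (lam r) = \<tau> r" by auto
    have lin: "linear_map R ?Q ?T \<phi>"
      by (rule linear_mapI)
        (simp_all add: ring_hom_closed[OF hom] ring_hom_add[OF hom] ring_hom_mult[OF hom] l)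
    show "\<phi> = restrict g (carrier Q)"
    proof (rule extensionalityI)
      fix q assume q: "q \<in> carrier Q"
      have "\<phi> q = g q"
        by (rule linear_map_unique[OF closed lin g coker]) (use q l gl in auto)
      then show "\<phi> q = restrict g (carrier Q) q" using q by simp
    qed (use \<phi> in auto)
  qed
qed

end

section \<open>Uniqueness of universal localizations and the theorem\<close>

lemma universal_localization_unique:
  fixes S S' :: "'s ring"
  assumes S: "universal_localization TYPE('s) R \<U> P1 \<alpha> P0 S \<sigma>"
    and S': "universal_localization TYPE('s) R \<U> P1 \<alpha> P0 S' \<sigma>'"
  shows "equivalent_ring_homs R S \<sigma> S' \<sigma>'"
proof -
  \<comment> \<open>The rings live on the test type \<open>'s\<close> itself, so each may serve as
    test ring for the other and for itself.\<close>
  have hom: "\<exists>!\<phi>. \<phi> \<in> ring_hom A B \<and> \<phi> \<in> extensional (carrier A) \<and> (\<forall>r\<in>carrier R. \<phi> (a r) = b r)"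
    if "universal_localization TYPE('s) R \<U> P1 \<alpha> P0 A a" "universal_localization TYPE('s) R \<U> P1 \<alpha> P0 B b"
    for A B :: "'s ring" and a b
  proof -
    have "ring B" "b \<in> ring_hom R B" "inverting R \<U> P1 \<alpha> P0 B b"
      using that(2) by (simp_all add: universal_localization_def)
    then show ?thesis
      using that(1)[unfolded universal_localization_def, THEN conjunct2, THEN conjunct2, THEN conjunct2,
          THEN spec, of B, THEN spec, of b] by simp
  qed
  \<comment> \<open>Uniqueness holds among extensional functions only, hence the comparison of
    restrictions.\<close>
  have id: "\<phi> q = q"
    if A: "universal_localization TYPE('s) R \<U> P1 \<alpha> P0 A a" and \<phi>: "\<phi> \<in> ring_hom A A"
      "\<And>r. r \<in> carrier R \<Longrightarrow> \<phi> (a r) = a r" and q: "q \<in> carrier A" for A :: "'s ring" and a \<phi> q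
  proof -
    have A_hom: "a \<in> ring_hom R A" and "ring A" using A by (simp_all add: universal_localization_def)
    then interpret A: ring A by simp
    have P: "restrict f (carrier A) \<in> ring_hom A A \<and> restrict f (carrier A) \<in> extensional (carrier A) \<and>
        (\<forall>r\<in>carrier R. restrict f (carrier A) (a r) = a r)"
      if f: "f \<in> ring_hom A A" "\<And>r. r \<in> carrier R \<Longrightarrow> f (a r) = a r" for f
    proof -
      show ?thesis
        using f A_hom by (auto intro!: ring_hom_memI simp: ring_hom_closed ring_hom_add ring_hom_mult ring_hom_one)
    qed
    have "id \<in> ring_hom A A" by (auto simp: ring_hom_def)
    then have "restrict \<phi> (carrier A) = restrict id (carrier A)"
      by (intro Uniq_D[OF ex1_iff_ex_Uniq[THEN iffD1, OF hom[OF A A], THEN conjunct2]] P[OF \<phi>] P) auto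
    then show ?thesis using q by (metis id_apply restrict_apply')
  qed
  obtain \<phi> where \<phi>: "\<phi> \<in> ring_hom S S'" "\<And>r. r \<in> carrier R \<Longrightarrow> \<phi> (\<sigma> r) = \<sigma>' r"
    using ex1_implies_ex[OF hom[OF S S']] by blast
  obtain \<psi> where \<psi>: "\<psi> \<in> ring_hom S' S" "\<And>r. r \<in> carrier R \<Longrightarrow> \<psi> (\<sigma>' r) = \<sigma> r"
    using ex1_implies_ex[OF hom[OF S' S]] by blast
  have "(\<psi> \<circ> \<phi>) q = q" if "q \<in> carrier S" for q
    by (rule id[OF S ring_hom_trans[OF \<phi>(1) \<psi>(1)]]) (simp_all add: \<phi>(2) \<psi>(2) that)
  moreover have "(\<phi> \<circ> \<psi>) q = q" if "q \<in> carrier S'" for q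
    by (rule id[OF S' ring_hom_trans[OF \<psi>(1) \<phi>(1)]]) (simp_all add: \<phi>(2) \<psi>(2) that)
  ultimately have "bij_betw \<phi> (carrier S) (carrier S')"
    using ring_hom_closed[OF \<phi>(1)] ring_hom_closed[OF \<psi>(1)]
    by (intro bij_betwI[where g = \<psi>]) auto
  then have "\<phi> \<in> ring_iso S S'" using \<phi>(1) by (simp add: ring_iso_def)
  then show ?thesis using \<phi>(2) unfolding equivalent_ring_homs_def by (intro bexI[of _ \<phi>]) auto
qed

text \<open>The test type \<open>'t\<close> is arbitrary, because the extension of maps to
  \<open>Q\<close> was obtained for closed modules on any type.\<close>

lemma quotients_universal_localization:
  fixes R :: "'a ring" and \<iota> :: "'a list set \<Rightarrow> 'u" and Q :: "'u ring" and \<U> :: "('a, 'u) rmod set"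
  assumes "inj \<iota>" and "ring R" and "gabriel_topology R \<G>"
    and "ring_of_quotients R \<G> Q lam" and "perfect_topology R \<G> Q lam"
    and U: "representative_fp_modules R (gabriel_torsion_class R \<G>) \<U>"
    and res: "\<And>U. U \<in> \<U> \<Longrightarrow> fg_projective_resolution R (P1 U) (\<alpha> U) (P0 U) (\<pi> U) U"
  shows "universal_localization TYPE('t) R \<U> P1 \<alpha> P0 Q lam"
proof -
  interpret perfect_quotient R \<G> Q lam \<iota>
    using assms(1-5)
    by (simp add: perfect_quotient_def gabriel_ring_def gabriel_ring_axioms_def perfect_quotient_axioms_def)
  have "\<U> \<subseteq> gabriel_torsion_class R \<G>" using U unfolding representative_fp_modules_def by blast
  then have "inverting R \<U> P1 \<alpha> P0 Q lam" by (rule quotients_inverting[OF _ res])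
  moreover have "\<exists>!\<phi>. \<phi> \<in> ring_hom Q T \<and> \<phi> \<in> extensional (carrier Q) \<and> (\<forall>r\<in>carrier R. \<phi> (lam r) = \<tau> r)"
    if "ring T \<and> \<tau> \<in> ring_hom R T \<and> inverting R \<U> P1 \<alpha> P0 T \<tau>" for T :: "'t ring" and \<tau>
    using that by (intro quotients_universal inverting_closed[OF U res]) auto
  ultimately show ?thesis
    unfolding universal_localization_def using ext.T.ring_axioms ext.\<tau>_hom by simp
qed

theorem proposition4p3:
  fixes R :: "'a ring"
    and \<iota> :: "'a list set \<Rightarrow> 'u"
    and \<G> :: "'a set set"
    and \<T> \<F> \<U> :: "('a, 'u) rmod set"
    and Q :: "'u ring" and lam :: "'a \<Rightarrow> 'u"
    and P1 P0 :: "('a, 'u) rmod \<Rightarrow> ('a, 'u) rmod"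
    and \<alpha> \<pi> :: "('a, 'u) rmod \<Rightarrow> 'u \<Rightarrow> 'u"
  assumes large: "inj \<iota>"
    and semihereditary: "right_semihereditary TYPE('u) R"
    and gabriel: "gabriel_topology R \<G>"
    and quotients: "ring_of_quotients R \<G> Q lam"
    and perfect: "perfect_topology R \<G> Q lam"
    and torsion_pair: "hereditary_torsion_pair R \<T> \<F>"
    and associated: "\<T> = gabriel_torsion_class R \<G>"
    and representatives: "representative_fp_modules R \<T> \<U>"
    and resolutions:
      "\<And>U. U \<in> \<U> \<Longrightarrow> fg_projective_resolution R (P1 U) (\<alpha> U) (P0 U) (\<pi> U) U"
  shows "universal_localization TYPE('t) R \<U> P1 \<alpha> P0 Q lam \<and>
    (\<forall>(R\<^sub>U :: 'u ring) lam\<^sub>U.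
       universal_localization TYPE('u) R \<U> P1 \<alpha> P0 R\<^sub>U lam\<^sub>U \<longrightarrow>
       equivalent_ring_homs R Q lam R\<^sub>U lam\<^sub>U)"
proof -
  have R: "ring R" using semihereditary by (simp add: right_semihereditary_def)
  have U: "representative_fp_modules R (gabriel_torsion_class R \<G>) \<U>"
    using representatives associated by simp
  \<comment> \<open>This fact stays schematic in the test type: it is used at \<open>'t\<close> for
    the first claim and at \<open>'u\<close> for the comparison with
    \<open>R\<^sub>U\<close>.\<close>
  note univ = quotients_universal_localization[OF large R gabriel quotients perfect U resolutions]
  show ?thesis
  proof (intro conjI allI impI)
    show "universal_localization TYPE('t) R \<U> P1 \<alpha> P0 Q lam" by (rule univ)
    show "equivalent_ring_homs R Q lam R\<^sub>U lam\<^sub>U"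
      if "universal_localization TYPE('u) R \<U> P1 \<alpha> P0 R\<^sub>U lam\<^sub>U" for R\<^sub>U :: "'u ring" and lam\<^sub>U
      by (rule universal_localization_unique[OF univ that])
  qed
qed

end
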